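(* Consider a family of hidden Markov models indexed by $\theta\in\Theta$ with finite signal space $S$, as described in the context, satisfying the assumptions (H0), (H1), (H2), (H3) listed there. Let $L_n^{Y,2}=\frac1n\sum_{k=1}^n\delta_{(Y_{k-1},Y_k)}$. Then for $\theta\in\Theta$ and any initial distribution $\nu$ of $X_0$, under $\mathbb{P}_{\theta,\nu}$, as $n\to\infty$, $$2n\,H(L_n^{Y,2}|Q_\theta^{Y,2})\xrightarrow{\text{in law}}\sum_{y,y'}\frac{\xi^2(y,y')}{Q_\theta^{Y,2}(y,y')}$$ and $$n\,\chi^2(L_n^{Y,2}|Q_\theta^{Y,2})\xrightarrow{\text{in law}}\sum_{y,y'}\frac{\xi^2(y,y')}{Q_\theta^{Y,2}(y,y')},$$ where $\xi=(\xi(y,y'))_{(y,y')\in S^2}$ is a centered Gaussian vector with covariance matrix $$\begin{aligned}\Gamma((y,y'),(\tilde y,\tilde y'))&:=\mathrm{Cov}(\xi(y,y'),\xi(\tilde y,\tilde y'))\\&=\mathrm{Cov}\big(1_{(y,y')}(Y_0,Y_1),1_{(\tilde y,\tilde y')}(Y_0,Y_1)\big)\\&\quad+\sum_{k=1}^{+\infty}\mathrm{Cov}\big(1_{(y,y')}(Y_0,Y_1),1_{(\tilde y,\tilde y')}(Y_k,Y_{k+1})\big)\\&\quad+\sum_{k=1}^{+\infty}\mathrm{Cov}\big(1_{(\tilde y,\tilde y')}(Y_0,Y_1),1_{(y,y')}(Y_k,Y_{k+1})\big),\end{aligned}$$ the covariances of the $Y$'s being taken under the stationary probability measure $\mathb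b{P}_{\theta,\mu_\theta}$.
   Context: Setting. $\mathbb{M}=\{1,\dots,m\}$ with $m\ge 2$. $S$ is a finite set; $\mathcal{M}_1(S)$ is the set of probability measures on $S$. $\{q_\beta:\beta\in\bar O\}\subset\mathcal{M}_1(S)$ is a family of probability measures on $S$. For each $\theta\in\Theta$ we have a stochastic matrix $P_\theta=(p_{ij}(\theta))_{i,j\in\mathbb{M}}$ and parameters $\beta_i(\theta)\in\bar O$, $i\in\mathbb{M}$. Under $\mathbb{P}_{\theta,\nu}$, the process $(X_n,Y_n)_{n\ge0}$ is the hidden Markov model: $(X_n)$ is a Markov chain on $\mathbb{M}$ with transition matrix $P_\theta$ and $X_0\sim\nu$, and conditionally on $X_0=x_0,\dots,X_n=x_n$, the $Y_0,\dots,Y_n$ are independent with $Y_k$ of law $q_{\beta_{x_k}(\theta)}$. Assumptions. (H0) $\Theta$ is the closure of a bounded open set $\Theta^0\subset\mathbb{R}^M$; $\bar O$ is the closure of a bounded open set $O\subset\mathbb{R}^d$, and $\beta_i(\theta)\in\bar O$ for all $i\in\mathbb{M}$, $\theta\in\Theta$; $\theta\mapsto((p_{ij}(\theta))_{i,j\in\mathbb{M}},(\beta_i(\theta))_{i\in\mathbb{M}})$ is continuous and injective on $\Theta$; $\beta\mapsto q_\beta$ is continuous from $\bar O$ to $\mathcal{M}_1(S)$ with the weak convergence topology. (H1) There are an integer $n_0\ge1$, $\kappa>0$ and a probability measure $\nu_0$ on $\mathbb{M}$ charging all states of $\mathbb{M}$ such that for any $\theta\in\Theta$, $P_\theta^{n_0}(i,j)\ge\kappa\nu_0(j)$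 for all $i,j\in\mathbb{M}$. Consequently $P_\theta$ has a unique invariant probability measure $\mu_\theta$, and $\mu_\theta(i)>0$ for all $i$. (H2) (the hidden states are ordered by $(\beta_i=\beta_i(\theta))$) For any bijection $\tau:\mathbb{M}\to\mathbb{M}$, if $(\beta_{\tau(1)},\dots,\beta_{\tau(m)})=(\beta_1,\dots,\beta_m)$, then $\tau(i)=i$ for all $i\in\mathbb{M}$. In other words the hidden states are ordered by the parameters $(\beta_1,\dots,\beta_m)$. This implies that $\beta_i\ne\beta_j$ for different hidden states $i,j$. (H3) (identifiability of the hidden states) For $\beta_i,\tilde\beta_i\in\bar O$, $i=1,\dots,m$, if $\sum_{i=1}^mc_iq_{\beta_i}=\sum_{i=1}^m\tilde c_iq_{\tilde\beta_i}$ where $c_i,\tilde c_i\ge0$ and $\sum_ic_i=\sum_i\tilde c_i=1$, then $\sum_ic_i\delta_{\beta_i}=\sum_i\tilde c_i\delta_{\tilde\beta_i}$ ($\delta$ denotes Dirac measures). Notation. $Q_\theta^{Y,2}(y,y')=\sum_{i,j\in\mathbb{M}}\mu_\theta(i)p_{ij}(\theta)q_{\beta_i(\theta)}(y)q_{\beta_j(\theta)}(y')$ is the stationary law of $(Y_0,Y_1)$ on $S^2$. For probability measures on a finite set, $H(\nu|\mu)=\sum_{z:\nu(z)>0}\nu(z)\log\frac{\nu(z)}{\mu(z)}$ if $\nu\ll\mu$ and $+\infty$ otherwise (natural logarithm), and $\chi^2(\nu|\mu)=\sum_z\frac{(\nu(z)-\mu(z))^2}{\mu(z)}$. $1_{(y,y')}$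 is the indicator function of the point $(y,y')$. *)

theory Defs
  imports "HOL-Probability.Probability"
begin

section \<open>Stochastic matrices and hidden Markov models\<close>

definition stochastic_matrix :: "real ^ 'm ^ 'm \<Rightarrow> bool" where
  "stochastic_matrix P \<longleftrightarrow> (\<forall>i j. 0 \<le> P $ i $ j) \<and> (\<forall>i. (\<Sum>j\<in>UNIV. P $ i $ j) = 1)"

text \<open>Powers for the matrix product; the type \<^typ>\<open>real ^ 'm ^ 'm\<close> carries a componentwise
  \<open>(*)\<close>, so \<open>P ^ n\<close> would be the wrong notion.\<close>

definition matrix_power :: "real ^ 'm ^ 'm \<Rightarrow> nat \<Rightarrow> real ^ 'm ^ 'm" where
  "matrix_power P n = (((**) P) ^^ n) (mat 1)"

definition invariant_law :: "real ^ 'm ^ 'm \<Rightarrow> 'm pmf \<Rightarrow> bool" where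
  "invariant_law P \<mu> \<longleftrightarrow> (\<forall>j. (\<Sum>i\<in>UNIV. pmf \<mu> i * P $ i $ j) = pmf \<mu> j)"

text \<open>Meaningful only if the invariant probability measure is unique, which the minorization
  condition below guarantees.\<close>

definition stationary_law :: "real ^ 'm ^ 'm \<Rightarrow> 'm pmf" where
  "stationary_law P = (THE \<mu>. invariant_law P \<mu>)"

definition markov_chain ::
  "'w measure \<Rightarrow> (nat \<Rightarrow> 'w \<Rightarrow> 'm::finite) \<Rightarrow> real ^ 'm ^ 'm \<Rightarrow> 'm pmf \<Rightarrow> bool" where
  "markov_chain M X P \<nu> \<longleftrightarrow>
     prob_space M \<and>
     (\<forall>n. X n \<in> measurable M (count_space UNIV)) \<and>
     distr M (count_space UNIV) (X 0) = measure_pmf \<nu> \<and>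
     (\<forall>n x j. \<P>(\<omega> in M. \<forall>k\<le>n. X k \<omega> = x k) > 0 \<longrightarrow>
        \<P>(\<omega> in M. X (Suc n) \<omega> = j \<bar> \<forall>k\<le>n. X k \<omega> = x k) = P $ x n $ j)"

text \<open>\<open>e i\<close> is the law of the signal emitted in the hidden state \<open>i\<close>. The conditional law given
  \<open>X\<^sub>0 = x\<^sub>0, \<dots>, X\<^sub>n = x\<^sub>n\<close> is \<^const>\<open>uniform_measure\<close> on that event.\<close>

definition hidden_markov_model ::
  "'w measure \<Rightarrow> (nat \<Rightarrow> 'w \<Rightarrow> 'm::finite) \<Rightarrow> (nat \<Rightarrow> 'w \<Rightarrow> 's::finite) \<Rightarrow>
   real ^ 'm ^ 'm \<Rightarrow> ('m \<Rightarrow> 's pmf) \<Rightarrow> 'm pmf \<Rightarrow> bool" where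
  "hidden_markov_model M X Y P e \<nu> \<longleftrightarrow>
     markov_chain M X P \<nu> \<and>
     (\<forall>n. Y n \<in> measurable M (count_space UNIV)) \<and>
     (\<forall>n x. \<P>(\<omega> in M. \<forall>k\<le>n. X k \<omega> = x k) > 0 \<longrightarrow>
        (let C = uniform_measure M {\<omega> \<in> space M. \<forall>k\<le>n. X k \<omega> = x k} in
           prob_space.indep_vars C (\<lambda>_. count_space UNIV) Y {..n} \<and>
           (\<forall>k\<le>n. distr C (count_space UNIV) (Y k) = measure_pmf (e (x k)))))"


section \<open>Standing assumptions\<close>

text \<open>\<open>S\<close> is finite, so weak continuity of \<open>\<beta> \<mapsto> q\<^sub>\<beta>\<close> is tested on all real functions on \<open>S\<close>.\<close>

definition regular_parametrization ::
  "(real ^ 'k) set \<Rightarrow> (real ^ 'd) set \<Rightarrow> (real ^ 'k \<Rightarrow> real ^ 'm ^ 'm) \<Rightarrow>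
   (real ^ 'k \<Rightarrow> (real ^ 'd) ^ 'm) \<Rightarrow> (real ^ 'd \<Rightarrow> 's::finite pmf) \<Rightarrow> bool" where
  "regular_parametrization \<Theta> Ob P \<beta> q \<longleftrightarrow>
     (\<exists>\<Theta>0. open \<Theta>0 \<and> bounded \<Theta>0 \<and> \<Theta> = closure \<Theta>0) \<and>
     (\<exists>O0. open O0 \<and> bounded O0 \<and> Ob = closure O0) \<and>
     (\<forall>\<theta>\<in>\<Theta>. \<forall>i. \<beta> \<theta> $ i \<in> Ob) \<and>
     continuous_on \<Theta> (\<lambda>\<theta>. (P \<theta>, \<beta> \<theta>)) \<and>
     inj_on (\<lambda>\<theta>. (P \<theta>, \<beta> \<theta>)) \<Theta> \<and>
     (\<forall>f :: 's \<Rightarrow> real. continuous_on Ob (\<lambda>b. measure_pmf.expectation (q b) f))"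

definition uniform_minorization ::
  "(real ^ 'k) set \<Rightarrow> (real ^ 'k \<Rightarrow> real ^ 'm ^ 'm) \<Rightarrow> bool" where
  "uniform_minorization \<Theta> P \<longleftrightarrow>
     (\<exists>(n0::nat) (\<kappa>::real) (\<nu>0 :: 'm pmf). n0 \<ge> 1 \<and> \<kappa> > 0 \<and> (\<forall>j. pmf \<nu>0 j > 0) \<and>
        (\<forall>\<theta>\<in>\<Theta>. \<forall>i j. matrix_power (P \<theta>) n0 $ i $ j \<ge> \<kappa> * pmf \<nu>0 j))"

definition hidden_states_ordered ::
  "(real ^ 'k) set \<Rightarrow> (real ^ 'k \<Rightarrow> (real ^ 'd) ^ 'm) \<Rightarrow> bool" where
  "hidden_states_ordered \<Theta> \<beta> \<longleftrightarrow>
     (\<forall>\<theta>\<in>\<Theta>. \<forall>\<tau> :: 'm \<Rightarrow> 'm. bij \<tau> \<longrightarrow> (\<forall>i. \<beta> \<theta> $ \<tau> i = \<beta> \<theta> $ i) \<longrightarrow> (\<forall>i. \<tau> i = i))"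

text \<open>The type argument fixes the number of mixture components, \<open>m = CARD('m)\<close>.\<close>

definition mixtures_identifiable ::
  "'m::finite itself \<Rightarrow> (real ^ 'd) set \<Rightarrow> (real ^ 'd \<Rightarrow> 's pmf) \<Rightarrow> bool" where
  "mixtures_identifiable _ Ob q \<longleftrightarrow>
     (\<forall>(b :: 'm \<Rightarrow> real ^ 'd) (b' :: 'm \<Rightarrow> real ^ 'd) (c :: 'm \<Rightarrow> real) (c' :: 'm \<Rightarrow> real).
        (\<forall>i. b i \<in> Ob \<and> b' i \<in> Ob \<and> 0 \<le> c i \<and> 0 \<le> c' i) \<longrightarrow>
        (\<Sum>i\<in>UNIV. c i) = 1 \<longrightarrow> (\<Sum>i\<in>UNIV. c' i) = 1 \<longrightarrow>
        (\<forall>y. (\<Sum>i\<in>UNIV. c i * pmf (q (b i)) y) = (\<Sum>i\<in>UNIV. c' i * pmf (q (b' i)) y)) \<longrightarrow>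
        (\<forall>A\<in>sets borel. (\<Sum>i\<in>UNIV. c i * measure (return borel (b i)) A)
                      = (\<Sum>i\<in>UNIV. c' i * measure (return borel (b' i)) A)))"


section \<open>Empirical and stationary two-step laws, divergences\<close>

text \<open>Probability measures on \<open>S\<^sup>2\<close> are represented by their mass functions.\<close>

definition two_step_law ::
  "real ^ 'm ^ 'm \<Rightarrow> ('m \<Rightarrow> 's pmf) \<Rightarrow> 's \<times> 's \<Rightarrow> real" where
  "two_step_law P e = (\<lambda>(y, y'). \<Sum>i\<in>UNIV. \<Sum>j\<in>UNIV.
     pmf (stationary_law P) i * P $ i $ j * pmf (e i) y * pmf (e j) y')"

definition empirical_two_step :: "(nat \<Rightarrow> 'w \<Rightarrow> 's) \<Rightarrow> nat \<Rightarrow> 'w \<Rightarrow> 's \<times> 's \<Rightarrow> real" where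
  "empirical_two_step Y n \<omega> = (\<lambda>z. 1 / real n * (\<Sum>k=1..n. indicator {z} (Y (k - 1) \<omega>, Y k \<omega>)))"

definition relative_entropy :: "('z::finite \<Rightarrow> real) \<Rightarrow> ('z \<Rightarrow> real) \<Rightarrow> ereal" where
  "relative_entropy \<nu> \<mu> =
     (if \<forall>z. \<mu> z = 0 \<longrightarrow> \<nu> z = 0
      then ereal (\<Sum>z | \<nu> z > 0. \<nu> z * ln (\<nu> z / \<mu> z)) else \<infinity>)"

text \<open>Division is taken in \<^typ>\<open>ereal\<close>, where \<open>0 / 0 = 0\<close> and \<open>a / 0 = \<infinity>\<close> for \<open>a > 0\<close>: these are
  the usual conventions at points not charged by \<open>\<mu>\<close>.\<close>

definition chi_square :: "('z::finite \<Rightarrow> real) \<Rightarrow> ('z \<Rightarrow> real) \<Rightarrow> ereal" where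
  "chi_square \<nu> \<mu> = (\<Sum>z\<in>UNIV. ereal ((\<nu> z - \<mu> z)\<^sup>2) / ereal (\<mu> z))"


section \<open>Covariances, Gaussian vectors, convergence in law\<close>

definition covariance :: "'w measure \<Rightarrow> ('w \<Rightarrow> real) \<Rightarrow> ('w \<Rightarrow> real) \<Rightarrow> real" where
  "covariance M U V =
     (\<integral>\<omega>. (U \<omega> - (\<integral>\<omega>'. U \<omega>' \<partial>M)) * (V \<omega> - (\<integral>\<omega>'. V \<omega>' \<partial>M)) \<partial>M)"

text \<open>The normal law with mean \<open>a\<close> and standard deviation \<open>\<sigma> \<ge> 0\<close>; degenerate for \<open>\<sigma> = 0\<close>.\<close>

definition normal_law :: "real \<Rightarrow> real \<Rightarrow> real measure" where
  "normal_law a \<sigma> = (if \<sigma> = 0 then return borel a else density lborel (normal_density a \<sigma>))"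

text \<open>Gaussian vectors may be degenerate: every linear functional is (possibly degenerate)
  normal.\<close>

definition gaussian_vector :: "'w measure \<Rightarrow> ('w \<Rightarrow> real ^ 'z) \<Rightarrow> bool" where
  "gaussian_vector N \<xi> \<longleftrightarrow>
     prob_space N \<and> \<xi> \<in> borel_measurable N \<and>
     (\<forall>u. \<exists>a \<sigma>. \<sigma> \<ge> 0 \<and> distr N borel (\<lambda>\<omega>. u \<bullet> \<xi> \<omega>) = normal_law a \<sigma>)"

definition centered_gaussian_vector ::
  "'w measure \<Rightarrow> ('w \<Rightarrow> real ^ 'z) \<Rightarrow> ('z \<Rightarrow> 'z \<Rightarrow> real) \<Rightarrow> bool" where
  "centered_gaussian_vector N \<xi> \<Gamma> \<longleftrightarrow>
     gaussian_vector N \<xi> \<and>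
     (\<forall>z. (\<integral>\<omega>. \<xi> \<omega> $ z \<partial>N) = 0) \<and>
     (\<forall>z w. covariance N (\<lambda>\<omega>. \<xi> \<omega> $ z) (\<lambda>\<omega>. \<xi> \<omega> $ w) = \<Gamma> z w)"

text \<open>Convergence in law tested on bounded continuous functions. The library notion
  \<^const>\<open>weak_conv_m\<close> covers only laws on \<open>\<real>\<close>, while \<^const>\<open>relative_entropy\<close> and
  \<^const>\<open>chi_square\<close> may be infinite.\<close>

definition converges_in_law ::
  "'w measure \<Rightarrow> (nat \<Rightarrow> 'w \<Rightarrow> 'b::topological_space) \<Rightarrow> 'v measure \<Rightarrow> ('v \<Rightarrow> 'b) \<Rightarrow> bool" where
  "converges_in_law M U N V \<longleftrightarrow>
     (\<forall>n. U n \<in> borel_measurable M) \<and> V \<in> borel_measurable N \<and>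
     (\<forall>f :: 'b \<Rightarrow> real. continuous_on UNIV f \<longrightarrow> bounded (range f) \<longrightarrow>
        (\<lambda>n. \<integral>\<omega>. f (U n \<omega>) \<partial>M) \<longlonglongrightarrow> (\<integral>\<omega>. f (V \<omega>) \<partial>N))"


section \<open>The limiting covariance\<close>

definition pair_indicator :: "(nat \<Rightarrow> 'w \<Rightarrow> 's) \<Rightarrow> 's \<times> 's \<Rightarrow> nat \<Rightarrow> 'w \<Rightarrow> real" where
  "pair_indicator Y z k \<omega> = indicator {z} (Y k \<omega>, Y (Suc k) \<omega>)"

text \<open>\<open>M\<close> is meant to be the stationary measure. The series, over \<open>k \<ge> 1\<close>, are indexed by
  \<open>Suc k\<close>; \<^const>\<open>suminf\<close> is meaningful only for summable ones.\<close>

definition limit_covariance ::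
  "'w measure \<Rightarrow> (nat \<Rightarrow> 'w \<Rightarrow> 's) \<Rightarrow> 's \<times> 's \<Rightarrow> 's \<times> 's \<Rightarrow> real" where
  "limit_covariance M Y z w =
     covariance M (pair_indicator Y z 0) (pair_indicator Y w 0)
     + (\<Sum>k. covariance M (pair_indicator Y z 0) (pair_indicator Y w (Suc k)))
     + (\<Sum>k. covariance M (pair_indicator Y w 0) (pair_indicator Y z (Suc k)))"

end

theory Submission
  imports Defs "HOL-Real_Asymp.Real_Asymp"
begin

text \<open>The pairs \<open>(X\<^sub>n, Y\<^sub>n)\<close> form a Markov chain on a finite set to which the minorization of the
  hidden chain transfers, so that Poisson equations \<open>g - R g = f\<close> can be solved for centered \<open>f\<close>.
  One Poisson equation reduces \<open>\<surd>n (L\<^sub>n - Q)\<close> to a martingale, a second one replaces the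
  conditional variance by its mean \<open>\<sigma>\<^sup>2\<close>, and the characteristic function of the martingale then
  satisfies the recursion \<open>a\<^sub>k\<^sub>+\<^sub>1 = (1 - \<sigma>\<^sup>2/2n) a\<^sub>k + O(n\<^sup>-\<^sup>3\<^sup>/\<^sup>2)\<close>. The limiting covariance is
  the Gram matrix of the martingale increments, which also produces the Gaussian vector.

  Tightness and the multidimensional continuity theorem are avoided: averaging characteristic
  functions over Gaussian arguments gives \<open>E exp (- k n \<chi>\<^sup>2) \<longlonglongrightarrow> E exp (- k \<Sum> \<xi>\<^sup>2/Q)\<close> for all \<open>k\<close>,
  and by the Weierstrass theorem in the variable \<open>exp (- x)\<close> these limits determine convergence in
  law on \<open>[0, \<infinity>]\<close>. Finally \<open>exp (- 2 k n H)\<close> and \<open>exp (- k n \<chi>\<^sup>2)\<close> differ by \<open>O(n\<^sup>-\<^sup>1\<^sup>/\<^sup>2)\<close>, uniformly in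
  the empirical measure.\<close>

section \<open>Finite Markov kernels under a Doeblin condition\<close>

text \<open>The correction by a second Poisson solution takes the place of a law of large numbers
  for the conditional variance: the recursion then has the same factor for every state, and
  \<open>n\<close> errors of order \<open>n^(-3/2)\<close> cost only \<open>O(n^(-1/2))\<close>. The
  initial law enters through \<open>a_0 = 1 + O(1/n)\<close> alone, which is why it may be
  arbitrary. The limiting covariance is singular, since the coordinates of \<open>L_n - Q\<close>
  add up to zero, so no density is available. The Gaussian vector is a linear image of independent
  standard normals, one for each transition of the pair chain. Where \<open>Q\<close> vanishes, both
  divergences divide by zero. Positivity of the stationary law excludes such pairs of signals almost
  surely under every initial law, and the matching Gaussian coordinates have variance zero, so
  everything is finite off null sets. The entropy comparison is uniform because its remainder is of
  third order, thus of size \<open>T^(3/2) n^(-1/2)\<close> for \<open>T = n chi^2\<close>, while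
  both exponents dominate a multiple of \<open>T\<close>: exponential decay absorbs
  \<open>T^(3/2)\<close>.\<close>

lemma sum_mult_indicator_singleton:
  "(\<Sum>a\<in>UNIV. p a * indicator {b} a) = (p b :: real)" for b :: "'a::finite"
  by (subst sum.remove[of _ b]) (auto intro!: sum.neutral)

definition kernel_op :: "('a::finite \<Rightarrow> 'a \<Rightarrow> real) \<Rightarrow> ('a \<Rightarrow> real) \<Rightarrow> 'a \<Rightarrow> real" where
  "kernel_op R f = (\<lambda>a. \<Sum>b\<in>UNIV. R a b * f b)"

locale stochastic_kernel =
  fixes R :: "'a::finite \<Rightarrow> 'a \<Rightarrow> real"
  assumes nonneg: "0 \<le> R a b" and sum_one: "(\<Sum>b\<in>UNIV. R a b) = 1"
begin

abbreviation iter :: "nat \<Rightarrow> ('a \<Rightarrow> real) \<Rightarrow> 'a \<Rightarrow> real" where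
  "iter k \<equiv> kernel_op R ^^ k"

lemma iter_Suc: "iter (Suc k) f a = (\<Sum>b\<in>UNIV. R a b * iter k f b)"
  by (simp add: kernel_op_def[of R "iter k f"])

lemma iter_linear: "iter k (\<lambda>a. c * f a + d * g a) = (\<lambda>a. c * iter k f a + d * iter k g a)"
  by (induction k) (simp_all add: kernel_op_def ring_distribs sum.distrib sum_distrib_left mult_ac)

lemma iter_const: "iter k (\<lambda>_. c) = (\<lambda>_. c)"
  by (induction k) (simp_all add: kernel_op_def sum_one flip: sum_distrib_right)

lemma iter_affine: "iter k (\<lambda>a. c * f a + d) = (\<lambda>a. c * iter k f a + d)"
  using iter_linear[of k c f 1 "\<lambda>_. d"] by (simp add: iter_const)

lemma iter_diff_const:
  "iter k (\<lambda>a. f a - d) = (\<lambda>a. iter k f a - d)"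
  "iter k (\<lambda>a. d - f a) = (\<lambda>a. d - iter k f a)"
  using iter_affine[of k 1 f "-d"] iter_affine[of k "-1" f d] by simp_all

lemma iter_mono: "(\<And>a. f a \<le> g a) \<Longrightarrow> iter k f a \<le> iter k g a"
  by (induction k arbitrary: a) (auto simp: kernel_op_def intro!: sum_mono mult_left_mono nonneg)

text \<open>The values \<open>iter k (indicator {b}) a\<close> are the entries of the k-th power of
  the kernel; this expansion stands in for a power defined on kernels.\<close>

lemma iter_eq_sum_indicator: "iter k f a = (\<Sum>b\<in>UNIV. f b * iter k (indicator {b}) a)"
proof (induction k arbitrary: a)
  case 0
  show ?case using sum_mult_indicator_singleton[of f a] by (simp add: indicator_def eq_commute)
next
  case (Suc k)
  have "iter (Suc k) f a = (\<Sum>c\<in>UNIV. \<Sum>b\<in>UNIV. R a c * (f b * iter k (indicator {b}) c))"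
    unfolding iter_Suc by (simp add: Suc sum_distrib_left)
  also have "\<dots> = (\<Sum>b\<in>UNIV. \<Sum>c\<in>UNIV. R a c * (f b * iter k (indicator {b}) c))"
    by (rule sum.swap)
  also have "\<dots> = (\<Sum>b\<in>UNIV. f b * iter (Suc k) (indicator {b}) a)"
    unfolding iter_Suc by (simp add: sum_distrib_left mult_ac)
  finally show ?case .
qed

lemma kernel_op_indicator: "kernel_op R (indicator {b}) = (\<lambda>a. R a b)"
  by (simp add: kernel_op_def sum_mult_indicator_singleton)

lemma obtain_bounds:
  fixes f :: "'a \<Rightarrow> real"
  assumes "\<And>a b. f a - f b \<le> c"
  obtains lo hi where "hi - lo \<le> c" "\<And>a. lo \<le> f a" "\<And>a. f a \<le> hi"
proof
  have "Max (range f) \<in> range f" "Min (range f) \<in> range f" by (auto intro!: Max_in Min_in)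
  then show "Max (range f) - Min (range f) \<le> c" using assms by fastforce
qed auto

lemma iter_osc_le:
  assumes "\<And>a b. f a - f b \<le> c"
  shows "iter k f a - iter k f b \<le> c"
proof -
  obtain lo hi where "hi - lo \<le> c" "\<And>a. lo \<le> f a" "\<And>a. f a \<le> hi"
    using assms by (rule obtain_bounds[of f c]) blast
  moreover from this have "iter k f a \<le> hi" using iter_mono[of f "\<lambda>_. hi" k a] by (simp add: iter_const)
  moreover from calculation have "lo \<le> iter k f b" using iter_mono[of "\<lambda>_. lo" f k b] by (simp add: iter_const)
  ultimately show ?thesis by linarith
qed

lemma invariant_iter:
  assumes "\<And>b. (\<Sum>a\<in>UNIV. \<pi> a * R a b) = \<pi> b"
  shows "(\<Sum>a\<in>UNIV. \<pi> a * iter k f a) = (\<Sum>a\<in>UNIV. \<pi> a * f a)"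
proof (induction k)
  case (Suc k)
  have "(\<Sum>a\<in>UNIV. \<pi> a * iter (Suc k) f a) = (\<Sum>a\<in>UNIV. \<Sum>b\<in>UNIV. \<pi> a * R a b * iter k f b)"
    by (simp add: kernel_op_def sum_distrib_left mult_ac)
  also have "\<dots> = (\<Sum>b\<in>UNIV. (\<Sum>a\<in>UNIV. \<pi> a * R a b) * iter k f b)"
    unfolding sum_distrib_right by (rule sum.swap)
  finally show ?case by (simp add: assms Suc)
qed simp

end

text \<open>The minorization is put on nonnegative functions rather than on entries, because the
  contraction applies it to \<open>f - lo\<close> and \<open>hi - f\<close>.\<close>

locale doeblin_kernel = stochastic_kernel R for R :: "'a::finite \<Rightarrow> 'a \<Rightarrow> real" +
  fixes n0 :: nat and \<kappa> :: real and \<nu>0 :: "'a \<Rightarrow> real"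
  assumes n0: "0 < n0" and \<kappa>: "0 < \<kappa>" and \<nu>0_sum: "(\<Sum>a\<in>UNIV. \<nu>0 a) = 1"
    and minorization: "(\<And>b. 0 \<le> f b) \<Longrightarrow> \<kappa> * (\<Sum>b\<in>UNIV. \<nu>0 b * f b) \<le> (kernel_op R ^^ n0) f a"
begin

lemma \<kappa>_le_1: "\<kappa> \<le> 1"
  using minorization[of "\<lambda>_. 1"] by (simp add: iter_const \<nu>0_sum)

text \<open>Minorizing \<open>f - lo\<close> and \<open>hi - f\<close> bounds the iterate away from
  \<open>lo\<close> and \<open>hi\<close> in terms of the \<open>\<nu>0\<close>-mean of
  \<open>f\<close>. This mean cancels when the two inequalities are added, which leaves the factor
  \<open>1 - \<kappa>\<close>.\<close>

lemma contraction:
  assumes "\<And>a b. f a - f b \<le> c"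
  shows "iter n0 f a - iter n0 f b \<le> (1 - \<kappa>) * c"
proof -
  obtain lo hi where c: "hi - lo \<le> c" and bds: "\<And>a. lo \<le> f a" "\<And>a. f a \<le> hi"
    using assms by (rule obtain_bounds[of f c]) blast
  let ?\<nu>f = "\<Sum>b\<in>UNIV. \<nu>0 b * f b"
  have 1: "\<kappa> * (?\<nu>f - lo) \<le> iter n0 f b - lo"
    using minorization[of "\<lambda>a. f a - lo" b] bds
    by (simp add: iter_diff_const right_diff_distrib sum_subtractf \<nu>0_sum flip: sum_distrib_right)
  have 2: "\<kappa> * (hi - ?\<nu>f) \<le> hi - iter n0 f a"
    using minorization[of "\<lambda>a. hi - f a" a] bds
    by (simp add: iter_diff_const right_diff_distrib sum_subtractf \<nu>0_sum flip: sum_distrib_right)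
  have "iter n0 f a - iter n0 f b \<le> (1 - \<kappa>) * (hi - lo)"
    using 1 2 by (simp add: algebra_simps)
  also have "\<dots> \<le> (1 - \<kappa>) * c"
    using c \<kappa>_le_1 by (intro mult_left_mono) auto
  finally show ?thesis .
qed

text \<open>Each full block of \<open>n0\<close> steps contracts; the \<open>k mod n0\<close>
  leftover steps are averages and cannot increase the oscillation.\<close>

lemma iter_osc:
  assumes "\<And>a b. f a - f b \<le> c"
  shows "iter k f a - iter k f b \<le> (1 - \<kappa>) ^ (k div n0) * c"
proof -
  have *: "iter (n0 * j) f a - iter (n0 * j) f b \<le> (1 - \<kappa>) ^ j * c" for j a b
  proof (induction j arbitrary: a b)
    case (Suc j)
    show ?case
      using contraction[OF Suc] by (simp add: funpow_add mult_ac)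
  qed (use assms in simp)
  have "iter (k mod n0) (iter (n0 * (k div n0)) f) a - iter (k mod n0) (iter (n0 * (k div n0)) f) b
      \<le> (1 - \<kappa>) ^ (k div n0) * c"
    by (rule iter_osc_le) (rule *)
  moreover have "iter (k mod n0) (iter (n0 * (k div n0)) f) = iter k f"
    by (metis comp_apply funpow_add mod_mult_div_eq)
  ultimately show ?thesis by simp
qed

text \<open>The exponent is constant on blocks of length \<open>n0\<close>, so the partial sums stay
  below \<open>n0\<close> times a geometric series.\<close>

lemma summable_rate: "summable (\<lambda>k. (1 - \<kappa>) ^ (k div n0))"
proof (rule summableI_nonneg_bounded)
  let ?r = "1 - \<kappa>"
  have r: "0 \<le> ?r" "?r < 1" using \<kappa> \<kappa>_le_1 by auto
  show "0 \<le> ?r ^ (k div n0)" for k using r by simp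
  show "(\<Sum>k<n. ?r ^ (k div n0)) \<le> real n0 * (1 / (1 - ?r))" for n
  proof -
    have "(\<Sum>k<n. ?r ^ (k div n0)) \<le> (\<Sum>k<n*n0. ?r ^ (k div n0))"
      using n0 r by (intro sum_mono2) (auto intro: less_le_trans)
    also have "\<dots> = (\<Sum>m<n. \<Sum>k\<in>{m*n0..<m*n0+n0}. ?r ^ (k div n0))"
      by (rule sum.nat_group[symmetric])
    also have "\<dots> = (\<Sum>m<n. \<Sum>k\<in>{m*n0..<m*n0+n0}. ?r ^ m)"
    proof (intro sum.cong refl)
      fix m k assume "k \<in> {m * n0..<m * n0 + n0}"
      then have "k div n0 = m" by (intro div_nat_eqI) (auto simp: mult_ac)
      then show "?r ^ (k div n0) = ?r ^ m" by simp
    qed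
    also have "\<dots> = real n0 * (\<Sum>m<n. ?r ^ m)"
      by (simp add: sum_distrib_left)
    also have "\<dots> \<le> real n0 * (\<Sum>m. ?r ^ m)"
      using r by (intro mult_left_mono sum_le_suminf summable_geometric) auto
    finally show ?thesis using r by (simp add: suminf_geometric)
  qed
qed

lemma obtain_osc:
  fixes f :: "'a \<Rightarrow> real"
  obtains c where "\<And>a b. f a - f b \<le> c"
proof
  fix a b
  show "f a - f b \<le> Max (range f) - Min (range f)"
    by (intro diff_mono Max_ge Min_le) auto
qed

text \<open>Every iterate has \<open>\<pi>\<close>-mean zero, so its value at \<open>a\<close> is
  the \<open>\<pi>\<close>-average of its differences to the values at \<open>b\<close>, which the
  decaying oscillation controls.\<close>

lemma summable_iter:
  assumes \<pi>0: "\<And>a. 0 \<le> \<pi> a" and \<pi>1: "(\<Sum>a\<in>UNIV. \<pi> a) = 1"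
    and inv: "\<And>b. (\<Sum>a\<in>UNIV. \<pi> a * R a b) = \<pi> b"
    and f: "(\<Sum>a\<in>UNIV. \<pi> a * f a) = 0"
  shows "summable (\<lambda>k. iter k f a)"
proof -
  obtain c where c: "\<And>a b. f a - f b \<le> c" by (rule obtain_osc[of f]) blast
  have "norm (iter k f a) \<le> (1 - \<kappa>) ^ (k div n0) * c" for k
  proof -
    have "iter k f a = (\<Sum>b\<in>UNIV. \<pi> b * (iter k f a - iter k f b))"
      by (simp add: right_diff_distrib sum_subtractf invariant_iter[OF inv] f \<pi>1 flip: sum_distrib_right)
    also have "norm \<dots> \<le> (\<Sum>b\<in>UNIV. \<pi> b * ((1 - \<kappa>) ^ (k div n0) * c))"
    proof (rule order.trans[OF norm_sum], rule sum_mono)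
      fix b
      show "norm (\<pi> b * (iter k f a - iter k f b)) \<le> \<pi> b * ((1 - \<kappa>) ^ (k div n0) * c)"
        using iter_osc[of f c, OF c, of k a b] iter_osc[of f c, OF c, of k b a] \<pi>0[of b]
        by (auto simp: abs_mult intro!: mult_left_mono)
    qed
    finally show ?thesis by (simp add: \<pi>1 flip: sum_distrib_right)
  qed
  then show ?thesis
    using summable_mult2[OF summable_rate] by (rule summable_comparison_test'[rotated])
qed

text \<open>No invariant law is at hand yet. A single increment is itself an average of differences
  between values of \<open>iter k f\<close>, hence bounded by its oscillation, and the increments
  are summable.\<close>

lemma convergent_iter: "convergent (\<lambda>k. iter k f a)"
proof -
  obtain c where c: "\<And>a b. f a - f b \<le> c" by (rule obtain_osc[of f]) blast
  have "norm (iter (Suc k) f a - iter k f a) \<le> (1 - \<kappa>) ^ (k div n0) * c" for k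
  proof -
    have "iter (Suc k) f a - iter k f a = (\<Sum>b\<in>UNIV. R a b * (iter k f b - iter k f a))"
      by (simp add: kernel_op_def right_diff_distrib sum_subtractf sum_one flip: sum_distrib_right)
    also have "norm \<dots> \<le> (\<Sum>b\<in>UNIV. R a b * ((1 - \<kappa>) ^ (k div n0) * c))"
    proof (rule order.trans[OF norm_sum], rule sum_mono)
      fix b
      show "norm (R a b * (iter k f b - iter k f a)) \<le> R a b * ((1 - \<kappa>) ^ (k div n0) * c)"
        using iter_osc[of f c, OF c, of k a b] iter_osc[of f c, OF c, of k b a] nonneg[of a b]
        by (auto simp: abs_mult intro!: mult_left_mono)
    qed
    finally show ?thesis by (simp add: sum_one flip: sum_distrib_right)
  qed
  then have "summable (\<lambda>k. iter (Suc k) f a - iter k f a)"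
    using summable_mult2[OF summable_rate] by (rule summable_comparison_test'[rotated])
  then have "convergent (\<lambda>n. \<Sum>k<n. iter (Suc k) f a - iter k f a)"
    by (simp add: summable_iff_convergent)
  then have "convergent (\<lambda>n. iter n f a - f a)"
    unfolding sum_lessThan_telescope[of "\<lambda>k. iter k f a"] by simp
  then have "convergent (\<lambda>n. (iter n f a - f a) + f a)"
    by (intro convergent_add convergent_const)
  then show ?thesis by simp
qed

text \<open>The invariant law is the limit of the rows of the kernel powers, for an arbitrary
  starting state \<open>a0\<close>.\<close>

lemma ex_invariant:
  obtains \<pi> where "\<And>a. 0 \<le> \<pi> a" "(\<Sum>a\<in>UNIV. \<pi> a) = 1" "\<And>b. (\<Sum>a\<in>UNIV. \<pi> a * R a b) = \<pi> b"
proof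
  fix a0 :: 'a
  define \<pi> where "\<pi> = (\<lambda>b. lim (\<lambda>k. iter k (indicator {b}) a0))"
  have lim: "(\<lambda>k. iter k (indicator {b}) a0) \<longlonglongrightarrow> \<pi> b" for b
    unfolding \<pi>_def using convergent_iter by (simp add: convergent_LIMSEQ_iff)
  have lim_f: "(\<lambda>k. iter k f a0) \<longlonglongrightarrow> (\<Sum>b\<in>UNIV. f b * \<pi> b)" for f
    by (subst iter_eq_sum_indicator) (intro tendsto_intros lim)
  show "0 \<le> \<pi> b" for b
  proof (rule LIMSEQ_le_const[OF lim])
    have "0 \<le> iter k (indicator {b}) a0" for k
      using iter_mono[of "\<lambda>_. 0" "indicator {b}" k a0] by (simp add: iter_const)
    then show "\<exists>N. \<forall>n\<ge>N. 0 \<le> iter n (indicator {b}) a0" by blast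
  qed
  show "(\<Sum>b\<in>UNIV. \<pi> b) = 1"
    using LIMSEQ_unique[OF lim_f[of "\<lambda>_. 1"], of 1] by (simp add: iter_const)
  \<comment> \<open>The entry of the power \<open>k + 1\<close> is read in two ways: as a term of
    the shifted sequence, and as the \<open>k\<close>-th iterate of the column
    \<open>\<lambda>a. R a b\<close>.\<close>
  show "(\<Sum>a\<in>UNIV. \<pi> a * R a b) = \<pi> b" for b
  proof (rule LIMSEQ_unique)
    show "(\<lambda>k. iter (Suc k) (indicator {b}) a0) \<longlonglongrightarrow> \<pi> b"
      using lim by (rule LIMSEQ_Suc)
    show "(\<lambda>k. iter (Suc k) (indicator {b}) a0) \<longlonglongrightarrow> (\<Sum>a\<in>UNIV. \<pi> a * R a b)"
      using lim_f[of "\<lambda>a. R a b"]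
      unfolding funpow_Suc_right by (simp add: kernel_op_indicator mult_ac)
  qed
qed

text \<open>The function \<open>f\<close> is \<open>indicator {b}\<close> minus its
  \<open>\<pi>\<close>-mean, so its iterates tend to zero. Its \<open>\<pi>'\<close>-mean does not
  change under iteration and equals \<open>\<pi>' b - \<pi> b\<close>.\<close>

lemma invariant_unique:
  assumes \<pi>0: "\<And>a. 0 \<le> \<pi> a" and \<pi>1: "(\<Sum>a\<in>UNIV. \<pi> a) = 1"
    and inv: "\<And>b. (\<Sum>a\<in>UNIV. \<pi> a * R a b) = \<pi> b"
    and \<pi>'1: "(\<Sum>a\<in>UNIV. \<pi>' a) = 1" and inv': "\<And>b. (\<Sum>a\<in>UNIV. \<pi>' a * R a b) = \<pi>' b"
  shows "\<pi>' = \<pi>"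
proof
  fix b
  define f where "f = (\<lambda>a. 1 * indicator {b} a + (- \<pi> b))"
  have eq: "(\<Sum>a\<in>UNIV. p a * f a) = p b - \<pi> b" if "(\<Sum>a\<in>UNIV. p a) = 1" for p
    using that by (simp add: f_def right_diff_distrib sum_subtractf sum_mult_indicator_singleton
        flip: sum_distrib_right)
  have "(\<lambda>k. iter k f a) \<longlonglongrightarrow> 0" for a
    using summable_iter[OF \<pi>0 \<pi>1 inv, of f a] eq[OF \<pi>1] by (intro summable_LIMSEQ_zero) auto
  then have "(\<lambda>k. \<Sum>a\<in>UNIV. \<pi>' a * iter k f a) \<longlonglongrightarrow> (\<Sum>a\<in>UNIV. \<pi>' a * 0)"
    by (intro tendsto_intros)
  then have "(\<lambda>k. \<pi>' b - \<pi> b) \<longlonglongrightarrow> 0"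
    by (simp add: invariant_iter[OF inv'] eq[OF \<pi>'1])
  then show "\<pi>' b = \<pi> b" by (simp add: LIMSEQ_const_iff)
qed

text \<open>The minorization of \<open>indicator {b}\<close> is averaged over \<open>\<pi>\<close>.
  Through this bound the stationary law charges every hidden state.\<close>

lemma invariant_ge:
  assumes \<pi>0: "\<And>a. 0 \<le> \<pi> a" and \<pi>1: "(\<Sum>a\<in>UNIV. \<pi> a) = 1"
    and inv: "\<And>b. (\<Sum>a\<in>UNIV. \<pi> a * R a b) = \<pi> b"
  shows "\<kappa> * \<nu>0 b \<le> \<pi> b"
proof -
  have "\<kappa> * \<nu>0 b = (\<Sum>a\<in>UNIV. \<pi> a * (\<kappa> * (\<Sum>c\<in>UNIV. \<nu>0 c * indicator {b} c)))"
    by (simp add: sum_mult_indicator_singleton \<pi>1 flip: sum_distrib_right)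
  also have "\<dots> \<le> (\<Sum>a\<in>UNIV. \<pi> a * iter n0 (indicator {b}) a)"
    by (intro sum_mono mult_left_mono minorization \<pi>0) auto
  also have "\<dots> = \<pi> b" by (simp add: invariant_iter[OF inv] sum_mult_indicator_singleton)
  finally show ?thesis .
qed

end

section \<open>Stochastic matrices and their stationary law\<close>

lemma kernel_op_funpow_matrix:
  "(kernel_op (\<lambda>i j. P $ i $ j) ^^ n) f i = (\<Sum>j\<in>UNIV. matrix_power P n $ i $ j * f j)"
proof (induction n arbitrary: i)
  case 0
  show ?case by (simp add: matrix_power_def mat_def if_distrib[of "\<lambda>x. x * _"] cong: if_cong)
next
  case (Suc n)
  have "(kernel_op (\<lambda>i j. P $ i $ j) ^^ Suc n) f i
      = (\<Sum>k\<in>UNIV. \<Sum>j\<in>UNIV. P $ i $ k * matrix_power P n $ k $ j * f j)"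
    by (simp add: kernel_op_def Suc sum_distrib_left mult_ac)
  also have "\<dots> = (\<Sum>j\<in>UNIV. (\<Sum>k\<in>UNIV. P $ i $ k * matrix_power P n $ k $ j) * f j)"
    unfolding sum_distrib_right by (rule sum.swap)
  also have "\<dots> = (\<Sum>j\<in>UNIV. matrix_power P (Suc n) $ i $ j * f j)"
    by (simp add: matrix_power_def matrix_matrix_mult_def)
  finally show ?case .
qed

lemma doeblin_kernel_matrix:
  assumes "stochastic_matrix P" "1 \<le> n0" "0 < \<kappa>"
    and "\<And>i j. matrix_power P n0 $ i $ j \<ge> \<kappa> * pmf \<nu>0 j"
  shows "doeblin_kernel (\<lambda>i j. P $ i $ j) n0 \<kappa> (pmf \<nu>0)"
proof
  show "0 \<le> P $ a $ b" "(\<Sum>b\<in>UNIV. P $ a $ b) = 1" for a b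
    using assms(1) by (auto simp: stochastic_matrix_def)
  show "(\<Sum>a\<in>UNIV. pmf \<nu>0 a) = 1" by (rule sum_pmf_eq_1) auto
  show "\<kappa> * (\<Sum>b\<in>UNIV. pmf \<nu>0 b * f b) \<le> (kernel_op (\<lambda>i j. P $ i $ j) ^^ n0) f a"
    if "\<And>b. 0 \<le> f b" for f a
    unfolding kernel_op_funpow_matrix sum_distrib_left mult.assoc[symmetric]
    using that assms(4) by (intro sum_mono mult_right_mono) auto
qed (use assms in auto)

text \<open>Existence and uniqueness of the invariant law give the definite description in
  \<open>stationary_law\<close> its meaning.\<close>

lemma
  assumes P: "stochastic_matrix P" and n0: "1 \<le> n0" and \<kappa>: "0 < \<kappa>" and \<nu>0: "\<And>j. 0 < pmf \<nu>0 j"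
    and minor: "\<And>i j. matrix_power P n0 $ i $ j \<ge> \<kappa> * pmf \<nu>0 j"
  shows invariant_law_stationary_law: "invariant_law P (stationary_law P)"
    and stationary_law_pos: "0 < pmf (stationary_law P) i"
proof -
  interpret doeblin_kernel "\<lambda>i j. P $ i $ j" n0 \<kappa> "pmf \<nu>0"
    by (rule doeblin_kernel_matrix[OF P n0 \<kappa> minor])
  obtain \<pi> where \<pi>: "\<And>a. 0 \<le> \<pi> a" "(\<Sum>a\<in>UNIV. \<pi> a) = 1" "\<And>b. (\<Sum>a\<in>UNIV. \<pi> a * P $ a $ b) = \<pi> b"
    by (rule ex_invariant) blast
  have "(\<integral>\<^sup>+ x. ennreal (\<pi> x) \<partial>count_space UNIV) = 1"
    using \<pi> by (simp add: nn_integral_count_space_finite)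
  then have pmf: "pmf (embed_pmf \<pi>) a = \<pi> a" for a
    using \<pi>(1) by (intro pmf_embed_pmf) auto
  have "\<mu> = embed_pmf \<pi>" if "invariant_law P \<mu>" for \<mu>
    using that invariant_unique[OF \<pi>, of "pmf \<mu>"]
    by (intro pmf_eqI) (auto simp: pmf invariant_law_def sum_pmf_eq_1)
  moreover have "invariant_law P (embed_pmf \<pi>)"
    by (simp add: invariant_law_def pmf \<pi>)
  ultimately have eq: "stationary_law P = embed_pmf \<pi>"
    unfolding stationary_law_def by (intro the_equality)
  show "invariant_law P (stationary_law P)"
    unfolding eq by fact
  show "0 < pmf (stationary_law P) i"
    unfolding eq pmf using invariant_ge[OF \<pi>, of i] mult_pos_pos[OF \<kappa> \<nu>0[of i]] by linarith
qed

section \<open>A central limit theorem for finite Markov chains\<close>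

locale ergodic_kernel = stochastic_kernel R for R :: "'a::finite \<Rightarrow> 'a \<Rightarrow> real" +
  fixes \<pi> :: "'a \<Rightarrow> real"
  assumes \<pi>_nonneg: "0 \<le> \<pi> a" and \<pi>_sum: "(\<Sum>a\<in>UNIV. \<pi> a) = 1"
    and invariant: "(\<Sum>a\<in>UNIV. \<pi> a * R a b) = \<pi> b"
    and ergodic: "(\<Sum>a\<in>UNIV. \<pi> a * f a) = 0 \<Longrightarrow> summable (\<lambda>k. (kernel_op R ^^ k) f a)"
begin

text \<open>The Neumann series for the inverse of \<open>I - R\<close>, convergent on functions of
  \<open>\<pi>\<close>-mean zero.\<close>

definition potential :: "('a \<Rightarrow> real) \<Rightarrow> 'a \<Rightarrow> real" where
  "potential f a = (\<Sum>k. iter k f a)"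

lemma poisson_equation:
  assumes "(\<Sum>a\<in>UNIV. \<pi> a * f a) = 0"
  shows "(\<Sum>b\<in>UNIV. R a b * potential f b) = potential f a - f a"
proof -
  have "(\<Sum>b\<in>UNIV. R a b * potential f b) = (\<Sum>k. \<Sum>b\<in>UNIV. R a b * iter k f b)"
    unfolding potential_def using ergodic[OF assms]
    by (subst suminf_sum) (auto intro!: sum.cong suminf_mult[symmetric] summable_mult)
  also have "\<dots> = (\<Sum>k. iter (Suc k) f a)"
    by (simp only: iter_Suc)
  also have "\<dots> = potential f a - f a"
    using suminf_split_head[OF ergodic[OF assms, of a]] by (simp add: potential_def)
  finally show ?thesis .
qed

definition pair_mean :: "('a \<Rightarrow> 'a \<Rightarrow> real) \<Rightarrow> real" where
  "pair_mean \<phi> = (\<Sum>a\<in>UNIV. \<Sum>b\<in>UNIV. \<pi> a * R a b * \<phi> a b)"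

lemma pair_mean_add: "pair_mean (\<lambda>a b. \<phi> a b + \<psi> a b) = pair_mean \<phi> + pair_mean \<psi>"
  by (simp add: pair_mean_def ring_distribs sum.distrib)

lemma pair_mean_diff: "pair_mean (\<lambda>a b. \<phi> a b - \<psi> a b) = pair_mean \<phi> - pair_mean \<psi>"
  by (simp add: pair_mean_def right_diff_distrib sum_subtractf)

lemma pair_mean_cmult: "pair_mean (\<lambda>a b. c * \<phi> a b) = c * pair_mean \<phi>"
  by (simp add: pair_mean_def sum_distrib_left mult_ac)

lemma pair_mean_sum: "pair_mean (\<lambda>a b. \<Sum>z\<in>A. \<phi> z a b) = (\<Sum>z\<in>A. pair_mean (\<phi> z))"
  by (induction A rule: infinite_finite_induct) (simp_all add: pair_mean_add, simp_all add: pair_mean_def)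

lemma pair_mean_fst:
  "pair_mean (\<lambda>a b. f a * \<phi> a b) = (\<Sum>a\<in>UNIV. \<pi> a * (f a * (\<Sum>b\<in>UNIV. R a b * \<phi> a b)))"
  by (simp add: pair_mean_def sum_distrib_left mult_ac)

lemma pair_mean_snd: "pair_mean (\<lambda>a b. f b) = (\<Sum>b\<in>UNIV. \<pi> b * f b)"
proof -
  have "pair_mean (\<lambda>a b. f b) = (\<Sum>b\<in>UNIV. (\<Sum>a\<in>UNIV. \<pi> a * R a b) * f b)"
    unfolding pair_mean_def sum_distrib_right by (rule sum.swap)
  then show ?thesis by (simp add: invariant)
qed

lemma pair_mean_sums:
  assumes "(\<Sum>a\<in>UNIV. \<pi> a * f a) = 0"
  shows "(\<lambda>k. pair_mean (\<lambda>a b. \<phi> a b * iter k f b)) sums pair_mean (\<lambda>a b. \<phi> a b * potential f b)"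
  unfolding pair_mean_def potential_def
  by (intro sums_sum sums_mult summable_sums ergodic assms)

definition drift :: "('a \<Rightarrow> 'a \<Rightarrow> real) \<Rightarrow> 'a \<Rightarrow> real" where
  "drift h a = (\<Sum>b\<in>UNIV. R a b * h a b)"

lemma drift_mean: "(\<Sum>a\<in>UNIV. \<pi> a * drift h a) = pair_mean h"
  by (simp add: drift_def pair_mean_def sum_distrib_left mult_ac)

text \<open>Differs from \<open>h\<close> by a coboundary, which telescopes along a path. The
  Poisson equation for \<open>drift h\<close> makes its conditional mean vanish when
  \<open>pair_mean h = 0\<close>.\<close>

definition martingale_part :: "('a \<Rightarrow> 'a \<Rightarrow> real) \<Rightarrow> 'a \<Rightarrow> 'a \<Rightarrow> real" where
  "martingale_part h a b = h a b + potential (drift h) b - potential (drift h) a"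

lemma martingale_part_drift:
  assumes "pair_mean h = 0"
  shows "(\<Sum>b\<in>UNIV. R a b * martingale_part h a b) = 0"
  using poisson_equation[of "drift h" a] assms
  by (simp add: martingale_part_def ring_distribs sum.distrib sum_subtractf sum_one drift_mean
      flip: sum_distrib_right) (simp add: drift_def)

text \<open>The product expands into nine terms. By \<open>R g = g - drift h\<close> and invariance,
  the six terms without a factor \<open>g b\<close> or \<open>g' b\<close> paired with
  \<open>h'\<close> or \<open>h\<close>, other than \<open>h h'\<close>, cancel in the mean. The two
  mixed terms that remain unfold along the Neumann series into sums over lags.\<close>

lemma pair_mean_martingale_part:
  assumes h: "pair_mean h = 0" and h': "pair_mean h' = 0"
  shows "pair_mean (\<lambda>a b. martingale_part h a b * martingale_part h' a b) =
    pair_mean (\<lambda>a b. h a b * h' a b)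
    + (\<Sum>k. pair_mean (\<lambda>a b. h a b * iter k (drift h') b))
    + (\<Sum>k. pair_mean (\<lambda>a b. h' a b * iter k (drift h) b))"
proof -
  define g g' where "g = potential (drift h)" and "g' = potential (drift h')"
  have T: "(\<Sum>b\<in>UNIV. R a b * g b) = g a - drift h a" "(\<Sum>b\<in>UNIV. R a b * g' b) = g' a - drift h' a" for a
    using h h' by (simp_all add: g_def g'_def poisson_equation drift_mean)
  have 1: "pair_mean (\<lambda>a b. g' a * h a b) = (\<Sum>a\<in>UNIV. \<pi> a * (g' a * drift h a))"
    "pair_mean (\<lambda>a b. g a * h' a b) = (\<Sum>a\<in>UNIV. \<pi> a * (g a * drift h' a))"
    "pair_mean (\<lambda>a b. g' a * g b) = (\<Sum>a\<in>UNIV. \<pi> a * (g a * g' a)) - (\<Sum>a\<in>UNIV. \<pi> a * (g' a * drift h a))"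
    "pair_mean (\<lambda>a b. g a * g' b) = (\<Sum>a\<in>UNIV. \<pi> a * (g a * g' a)) - (\<Sum>a\<in>UNIV. \<pi> a * (g a * drift h' a))"
    unfolding pair_mean_fst T
    by (simp_all add: drift_def right_diff_distrib sum_subtractf mult_ac)
  have 2: "pair_mean (\<lambda>a b. g b * g' b) = (\<Sum>a\<in>UNIV. \<pi> a * (g a * g' a))"
    "pair_mean (\<lambda>a b. g a * g' a) = (\<Sum>a\<in>UNIV. \<pi> a * (g a * g' a))"
    using pair_mean_fst[of "\<lambda>a. g a * g' a" "\<lambda>a b. 1"] by (simp_all add: pair_mean_snd sum_one)
  have "martingale_part h a b * martingale_part h' a b =
      h a b * h' a b + h a b * g' b + h' a b * g b - g' a * h a b - g a * h' a b
      + g b * g' b + g a * g' a - g' a * g b - g a * g' b" for a b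
    by (simp add: martingale_part_def g_def g'_def algebra_simps)
  then have "pair_mean (\<lambda>a b. martingale_part h a b * martingale_part h' a b) =
      pair_mean (\<lambda>a b. h a b * h' a b) + pair_mean (\<lambda>a b. h a b * g' b) + pair_mean (\<lambda>a b. h' a b * g b)"
    by (simp add: pair_mean_add pair_mean_diff 1 2)
  then show ?thesis
    using sums_unique[OF pair_mean_sums[of "drift h'" h]] sums_unique[OF pair_mean_sums[of "drift h" h']] h h'
    by (simp add: g_def g'_def drift_mean)
qed

end

section \<open>Markov processes on a finite set\<close>

locale finite_markov_process = prob_space M + stochastic_kernel R
  for M :: "'w measure" and R :: "'a::finite \<Rightarrow> 'a \<Rightarrow> real" +
  fixes Z :: "nat \<Rightarrow> 'w \<Rightarrow> 'a"
  assumes Z_measurable [measurable]: "Z n \<in> measurable M (count_space UNIV)"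
    and Z_path: "prob {\<omega> \<in> space M. \<forall>k\<le>Suc n. Z k \<omega> = z k}
      = prob {\<omega> \<in> space M. \<forall>k\<le>n. Z k \<omega> = z k} * R (z n) (z (Suc n))"
begin

text \<open>A functional of the first \<open>n + 1\<close> states takes finitely many values, one
  for each path. Integrals thus become finite sums of path probabilities and no conditional
  expectations are needed.\<close>

lemma path_expansion:
  fixes H :: "(nat \<Rightarrow> 'a) \<Rightarrow> 'c::real_vector"
  assumes "\<And>x y. (\<And>k. k \<le> n \<Longrightarrow> x k = y k) \<Longrightarrow> H x = H y"
  shows "H (\<lambda>k. Z k \<omega>) = (\<Sum>p\<in>PiE {..n} (\<lambda>_. UNIV). indicator {\<omega>. \<forall>k\<le>n. Z k \<omega> = p k} \<omega> *\<^sub>R H p)"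
proof -
  define p0 where "p0 = restrict (\<lambda>k. Z k \<omega>) {..n}"
  have "(\<Sum>p\<in>PiE {..n} (\<lambda>_. UNIV). indicator {\<omega>. \<forall>k\<le>n. Z k \<omega> = p k} \<omega> *\<^sub>R H p)
      = (\<Sum>p\<in>{p0}. indicator {\<omega>. \<forall>k\<le>n. Z k \<omega> = p k} \<omega> *\<^sub>R H p)"
  proof (rule sum.mono_neutral_right)
    show "\<forall>p\<in>PiE {..n} (\<lambda>_. UNIV) - {p0}. indicator {\<omega>. \<forall>k\<le>n. Z k \<omega> = p k} \<omega> *\<^sub>R H p = 0"
    proof
      fix p :: "nat \<Rightarrow> 'a" assume "p \<in> PiE {..n} (\<lambda>_. UNIV) - {p0}"
      then have "\<not> (\<forall>k\<le>n. Z k \<omega> = p k)"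
        by (auto simp: p0_def fun_eq_iff PiE_iff extensional_def split: if_splits)
      then show "indicator {\<omega>. \<forall>k\<le>n. Z k \<omega> = p k} \<omega> *\<^sub>R H p = 0"
        by (simp add: indicator_def)
    qed
  qed (auto simp: p0_def intro: finite_PiE)
  also have "\<dots> = H p0"
    by (simp add: p0_def indicator_def)
  also have "\<dots> = H (\<lambda>k. Z k \<omega>)"
    by (rule assms) (simp add: p0_def)
  finally show ?thesis by simp
qed

text \<open>Both sides are finite sums over paths, compared term by term. The value type is general
  because characteristic functions need complex \<open>F\<close> and covariances real
  \<open>F\<close>.\<close>

lemma markov_property:
  fixes F :: "(nat \<Rightarrow> 'a) \<Rightarrow> 'c::{real_normed_field, banach, second_countable_topology}"
  assumes F: "\<And>x y. (\<And>k. k \<le> n \<Longrightarrow> x k = y k) \<Longrightarrow> F x = F y"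
  shows "(\<integral>\<omega>. F (\<lambda>k. Z k \<omega>) * \<psi> (Z n \<omega>) (Z (Suc n) \<omega>) \<partial>M)
    = (\<integral>\<omega>. F (\<lambda>k. Z k \<omega>) * (\<Sum>b\<in>UNIV. R (Z n \<omega>) b *\<^sub>R \<psi> (Z n \<omega>) b) \<partial>M)"
proof -
  define S :: "(nat \<Rightarrow> 'a) set" where "S = PiE {..n} (\<lambda>_. UNIV)"
  let ?E = "\<lambda>p. {\<omega> \<in> space M. \<forall>k\<le>n. Z k \<omega> = p k}"
  let ?E' = "\<lambda>p b. {\<omega> \<in> space M. (\<forall>k\<le>n. Z k \<omega> = p k) \<and> Z (Suc n) \<omega> = b}"
  have E'_prob: "prob (?E' p b) = prob (?E p) * R (p n) b" for p b
  proof -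
    have "?E' p b = {\<omega> \<in> space M. \<forall>k\<le>Suc n. Z k \<omega> = (p(Suc n := b)) k}"
      by (auto simp: le_Suc_eq)
    moreover have "?E p = {\<omega> \<in> space M. \<forall>k\<le>n. Z k \<omega> = (p(Suc n := b)) k}"
      by auto
    ultimately show ?thesis
      using Z_path[of n "p(Suc n := b)"] by simp
  qed
  have "(\<integral>\<omega>. F (\<lambda>k. Z k \<omega>) * \<psi> (Z n \<omega>) (Z (Suc n) \<omega>) \<partial>M)
      = (\<integral>\<omega>. (\<Sum>b\<in>UNIV. \<Sum>p\<in>S. indicator (?E' p b) \<omega> *\<^sub>R (F p * \<psi> (p n) b)) \<partial>M)"
  proof (rule Bochner_Integration.integral_cong[OF refl])
    fix \<omega> assume \<omega>: "\<omega> \<in> space M"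
    have "(\<Sum>b\<in>UNIV. \<Sum>p\<in>S. indicator (?E' p b) \<omega> *\<^sub>R (F p * \<psi> (p n) b))
        = (\<Sum>b\<in>UNIV. of_bool (b = Z (Suc n) \<omega>) *\<^sub>R
            (\<Sum>p\<in>S. indicator {\<omega>. \<forall>k\<le>n. Z k \<omega> = p k} \<omega> *\<^sub>R (F p * \<psi> (p n) b)))"
      unfolding scaleR_sum_right using \<omega> by (intro sum.cong refl) (auto simp: indicator_def)
    also have "\<dots> = (\<Sum>b\<in>UNIV. of_bool (b = Z (Suc n) \<omega>) *\<^sub>R (F (\<lambda>k. Z k \<omega>) * \<psi> (Z n \<omega>) b))"
      unfolding S_def by (subst path_expansion[symmetric, where H = "\<lambda>x. F x * \<psi> (x n) _"])
        (auto cong: F)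
    also have "\<dots> = F (\<lambda>k. Z k \<omega>) * \<psi> (Z n \<omega>) (Z (Suc n) \<omega>)"
      by (subst sum.remove[of _ "Z (Suc n) \<omega>"]) (auto intro!: sum.neutral)
    finally show "F (\<lambda>k. Z k \<omega>) * \<psi> (Z n \<omega>) (Z (Suc n) \<omega>)
        = (\<Sum>b\<in>UNIV. \<Sum>p\<in>S. indicator (?E' p b) \<omega> *\<^sub>R (F p * \<psi> (p n) b))" ..
  qed
  also have "\<dots> = (\<Sum>b\<in>UNIV. \<Sum>p\<in>S. prob (?E' p b) *\<^sub>R (F p * \<psi> (p n) b))"
    by (simp add: emeasure_eq_measure)
  also have "\<dots> = (\<Sum>p\<in>S. \<Sum>b\<in>UNIV. prob (?E' p b) *\<^sub>R (F p * \<psi> (p n) b))"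
    by (rule sum.swap)
  also have "\<dots> = (\<Sum>p\<in>S. prob (?E p) *\<^sub>R (F p * (\<Sum>b\<in>UNIV. R (p n) b *\<^sub>R \<psi> (p n) b)))"
    by (simp add: E'_prob sum_distrib_left scaleR_sum_right)
  also have "\<dots> = (\<integral>\<omega>. (\<Sum>p\<in>S. indicator (?E p) \<omega> *\<^sub>R (F p * (\<Sum>b\<in>UNIV. R (p n) b *\<^sub>R \<psi> (p n) b))) \<partial>M)"
    by (simp add: emeasure_eq_measure)
  also have "\<dots> = (\<integral>\<omega>. F (\<lambda>k. Z k \<omega>) * (\<Sum>b\<in>UNIV. R (Z n \<omega>) b *\<^sub>R \<psi> (Z n \<omega>) b) \<partial>M)"
  proof (rule Bochner_Integration.integral_cong[OF refl])
    fix \<omega> assume \<omega>: "\<omega> \<in> space M"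
    have "F (\<lambda>k. Z k \<omega>) * (\<Sum>b\<in>UNIV. R (Z n \<omega>) b *\<^sub>R \<psi> (Z n \<omega>) b)
       = (\<Sum>p\<in>S. indicator {\<omega>. \<forall>k\<le>n. Z k \<omega> = p k} \<omega> *\<^sub>R (F p * (\<Sum>b\<in>UNIV. R (p n) b *\<^sub>R \<psi> (p n) b)))"
      unfolding S_def by (rule path_expansion[where H = "\<lambda>x. F x * (\<Sum>b\<in>UNIV. R (x n) b *\<^sub>R \<psi> (x n) b)"])
        (auto cong: F)
    also have "\<dots> = (\<Sum>p\<in>S. indicator (?E p) \<omega> *\<^sub>R (F p * (\<Sum>b\<in>UNIV. R (p n) b *\<^sub>R \<psi> (p n) b)))"
      using \<omega> by (intro sum.cong refl) (auto simp: indicator_def)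
    finally show "(\<Sum>p\<in>S. indicator (?E p) \<omega> *\<^sub>R (F p * (\<Sum>b\<in>UNIV. R (p n) b *\<^sub>R \<psi> (p n) b)))
       = F (\<lambda>k. Z k \<omega>) * (\<Sum>b\<in>UNIV. R (Z n \<omega>) b *\<^sub>R \<psi> (Z n \<omega>) b)" ..
  qed
  finally show ?thesis .
qed

lemma expectation_step:
  fixes \<psi> :: "'a \<Rightarrow> 'a \<Rightarrow> real"
  shows "expectation (\<lambda>\<omega>. \<psi> (Z n \<omega>) (Z (Suc n) \<omega>))
    = expectation (\<lambda>\<omega>. \<Sum>b\<in>UNIV. R (Z n \<omega>) b * \<psi> (Z n \<omega>) b)"
  using markov_property[of n "\<lambda>_. 1::real" \<psi>] by simp

end

section \<open>Characteristic functions of normalized martingales\<close>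

lemma iexp_diff_bound: "cmod (iexp x - iexp y) \<le> \<bar>x - y\<bar>"
proof -
  have "iexp x - iexp y = iexp y * (iexp (x - y) - 1)"
    by (simp add: right_diff_distrib exp_diff)
  then show ?thesis
    using iexp_approx1[of "x - y" 0] by (simp add: norm_mult)
qed

text \<open>Since \<open>cmod r \<le> 1\<close>, earlier errors are not amplified and the one-step
  errors merely add up.\<close>

lemma perturbed_recurrence_bound:
  fixes A :: "nat \<Rightarrow> complex" and r :: complex
  assumes "cmod r \<le> 1" and step: "\<And>k. cmod (A (Suc k) - r * A k) \<le> \<epsilon>"
  shows "cmod (A n - r ^ n * A 0) \<le> real n * \<epsilon>"
proof (induction n)
  case (Suc n)
  have "cmod (A (Suc n) - r ^ Suc n * A 0) = cmod ((A (Suc n) - r * A n) + r * (A n - r ^ n * A 0))"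
    by (simp add: algebra_simps)
  also have "\<dots> \<le> \<epsilon> + 1 * (real n * \<epsilon>)"
    by (intro norm_triangle_le add_mono step)
      (use mult_mono[OF assms(1) Suc] in \<open>simp add: norm_mult\<close>)
  finally show ?case by (simp add: algebra_simps)
qed simp

locale ergodic_markov_process = ergodic_kernel R \<pi> + finite_markov_process M R Z
  for M :: "'w measure" and R :: "'a::finite \<Rightarrow> 'a \<Rightarrow> real" and \<pi> Z
begin

text \<open>With \<open>w - R w = v - \<sigma>\<^sup>2\<close>, where \<open>v\<close> is the conditional variance, the factor \<open>1 - s\<^sup>2 w / 2\<close>
  makes the characteristic function multiplicative up to an error of order \<open>s\<^sup>3\<close>.\<close>

lemma corrected_char_step:
  assumes d: "\<And>a. (\<Sum>b\<in>UNIV. R a b * d a b) = 0"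
    and w: "\<And>a. (\<Sum>b\<in>UNIV. R a b * (d a b)\<^sup>2) + (\<Sum>b\<in>UNIV. R a b * w b) = w a + \<sigma>2"
    and B: "\<And>a b. \<bar>d a b\<bar> \<le> B" "\<And>a. \<bar>w a\<bar> \<le> B" "\<bar>\<sigma>2\<bar> \<le> B" and s: "\<bar>s\<bar> \<le> 1"
  shows "cmod ((\<Sum>b\<in>UNIV. R a b *\<^sub>R (iexp (s * d a b) * complex_of_real (1 - s\<^sup>2 / 2 * w b)))
      - complex_of_real (1 - s\<^sup>2 * \<sigma>2 / 2) * complex_of_real (1 - s\<^sup>2 / 2 * w a)) \<le> (B ^ 3 + B\<^sup>2) * \<bar>s\<bar> ^ 3"
proof -
  have B0: "0 \<le> B" using B(3) by linarith
  \<comment> \<open>The product is truncated at order \<open>s^2\<close>. The remainder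
    \<open>e\<close> consists of the cubic Taylor error of the exponential and of
    \<open>iexp x - 1\<close> times the correction, both of order \<open>s^3\<close>.\<close>
  define m where "m b = 1 + \<i> * complex_of_real (s * d a b) - complex_of_real ((s * d a b)\<^sup>2 / 2)
      - complex_of_real (s\<^sup>2 / 2 * w b)" for b
  define e where "e b = iexp (s * d a b) * complex_of_real (1 - s\<^sup>2 / 2 * w b) - m b" for b
  have e: "cmod (e b) \<le> (B ^ 3 / 6 + B\<^sup>2 / 2) * \<bar>s\<bar> ^ 3" for b
  proof -
    define x where "x = s * d a b"
    have x: "\<bar>x\<bar> \<le> \<bar>s\<bar> * B" unfolding x_def abs_mult by (intro mult_left_mono B) auto
    have taylor: "(\<Sum>k\<le>2. (\<i> * complex_of_real x) ^ k / fact k) = 1 + \<i> * complex_of_real x - complex_of_real (x\<^sup>2 / 2)"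
      by (simp add: numeral_2_eq_2) (simp add: complex_eq_iff)
    have "e b = (iexp x - (\<Sum>k\<le>2. (\<i> * x) ^ k / fact k)) - (iexp x - 1) * complex_of_real (s\<^sup>2 / 2 * w b)"
      unfolding e_def m_def x_def[symmetric] taylor of_real_diff of_real_1
      by (simp only: right_diff_distrib left_diff_distrib mult_1_left mult_1_right) simp
    also have "cmod \<dots> \<le> \<bar>x\<bar> ^ 3 / 6 + \<bar>x\<bar> * (s\<^sup>2 / 2 * B)"
    proof (rule order.trans[OF norm_triangle_ineq4], rule add_mono)
      show "cmod (iexp x - (\<Sum>k\<le>2. (\<i> * x) ^ k / fact k)) \<le> \<bar>x\<bar> ^ 3 / 6"
        using iexp_approx1[of x 2] by (simp add: eval_nat_numeral)
      have "cmod (iexp x - 1) \<le> \<bar>x\<bar>" using iexp_approx1[of x 0] by simp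
      moreover have "cmod (complex_of_real (s\<^sup>2 / 2 * w b)) \<le> s\<^sup>2 / 2 * B"
        unfolding norm_of_real abs_mult by (intro mult_mono B) auto
      ultimately show "cmod ((iexp x - 1) * complex_of_real (s\<^sup>2 / 2 * w b)) \<le> \<bar>x\<bar> * (s\<^sup>2 / 2 * B)"
        unfolding norm_mult by (intro mult_mono) auto
    qed
    also have "\<dots> \<le> (\<bar>s\<bar> * B) ^ 3 / 6 + (\<bar>s\<bar> * B) * (s\<^sup>2 / 2 * B)"
      using x B0 by (intro add_mono divide_right_mono power_mono mult_right_mono) auto
    also have "\<dots> = (B ^ 3 / 6 + B\<^sup>2 / 2) * \<bar>s\<bar> ^ 3"
      by (simp add: power2_eq_square power3_eq_cube algebra_simps flip: power2_abs)
    finally show ?thesis .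
  qed
  have "(\<Sum>b\<in>UNIV. R a b *\<^sub>R m b) = complex_of_real (\<Sum>b\<in>UNIV. R a b)
      + \<i> * complex_of_real (s * (\<Sum>b\<in>UNIV. R a b * d a b))
      - complex_of_real (s\<^sup>2 / 2 * (\<Sum>b\<in>UNIV. R a b * (d a b)\<^sup>2))
      - complex_of_real (s\<^sup>2 / 2 * (\<Sum>b\<in>UNIV. R a b * w b))"
    by (simp add: m_def scaleR_conv_of_real ring_distribs sum.distrib sum_subtractf sum_distrib_left
        power_mult_distrib mult_ac)
  also have "\<dots> = complex_of_real (1 - s\<^sup>2 / 2 * ((\<Sum>b\<in>UNIV. R a b * (d a b)\<^sup>2) + (\<Sum>b\<in>UNIV. R a b * w b)))"
    by (simp add: d sum_one algebra_simps)
  finally have m: "(\<Sum>b\<in>UNIV. R a b *\<^sub>R m b) = complex_of_real (1 - s\<^sup>2 / 2 * (w a + \<sigma>2))"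
    by (simp only: w)
  have "(\<Sum>b\<in>UNIV. R a b *\<^sub>R (iexp (s * d a b) * complex_of_real (1 - s\<^sup>2 / 2 * w b)))
      = (\<Sum>b\<in>UNIV. R a b *\<^sub>R e b) + (\<Sum>b\<in>UNIV. R a b *\<^sub>R m b)"
    by (simp add: e_def scaleR_diff_right sum_subtractf)
  \<comment> \<open>Up to a term of order \<open>s^4\<close>, the mean of \<open>m\<close> factors
    into the state-free factor and the correction at the starting state \<open>a\<close>.\<close>
  moreover have second_order: "complex_of_real (1 - s\<^sup>2 / 2 * (w a + \<sigma>2))
      - complex_of_real (1 - s\<^sup>2 * \<sigma>2 / 2) * complex_of_real (1 - s\<^sup>2 / 2 * w a)
      = - complex_of_real (s ^ 4 / 4 * (\<sigma>2 * w a))"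
    unfolding of_real_mult[symmetric] of_real_diff[symmetric] of_real_minus[symmetric] of_real_eq_iff
    by (simp add: field_simps power2_eq_square power4_eq_xxxx)
  ultimately have "(\<Sum>b\<in>UNIV. R a b *\<^sub>R (iexp (s * d a b) * complex_of_real (1 - s\<^sup>2 / 2 * w b)))
      - complex_of_real (1 - s\<^sup>2 * \<sigma>2 / 2) * complex_of_real (1 - s\<^sup>2 / 2 * w a)
      = (\<Sum>b\<in>UNIV. R a b *\<^sub>R e b) - complex_of_real (s ^ 4 / 4 * (\<sigma>2 * w a))"
    unfolding m by (simp only: add_diff_eq[symmetric] second_order) simp
  also have "cmod \<dots> \<le> (B ^ 3 / 6 + B\<^sup>2 / 2) * \<bar>s\<bar> ^ 3 + B\<^sup>2 / 4 * \<bar>s\<bar> ^ 3"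
  proof (rule order.trans[OF norm_triangle_ineq4], rule add_mono)
    have "cmod (\<Sum>b\<in>UNIV. R a b *\<^sub>R e b) \<le> (\<Sum>b\<in>UNIV. R a b * ((B ^ 3 / 6 + B\<^sup>2 / 2) * \<bar>s\<bar> ^ 3))"
      by (rule order.trans[OF norm_sum]) (auto intro!: sum_mono mult_left_mono e simp: nonneg)
    then show "cmod (\<Sum>b\<in>UNIV. R a b *\<^sub>R e b) \<le> (B ^ 3 / 6 + B\<^sup>2 / 2) * \<bar>s\<bar> ^ 3"
      by (simp add: sum_one flip: sum_distrib_right)
    \<comment> \<open>Here \<open>\<bar>s\<bar> \<le> 1\<close> lowers the fourth power to the
      third.\<close>
    have "\<bar>s\<bar> ^ 4 / 4 * (\<bar>\<sigma>2\<bar> * \<bar>w a\<bar>) \<le> \<bar>s\<bar> ^ 3 / 4 * (B * B)"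
      using s B B0 by (intro mult_mono divide_right_mono power_decreasing) auto
    then show "cmod (complex_of_real (s ^ 4 / 4 * (\<sigma>2 * w a))) \<le> B\<^sup>2 / 4 * \<bar>s\<bar> ^ 3"
      by (simp only: norm_of_real abs_mult power_abs abs_divide) (simp add: power2_eq_square mult_ac)
  qed
  also have "\<dots> \<le> (B ^ 3 + B\<^sup>2) * \<bar>s\<bar> ^ 3"
    using B0 unfolding ring_distribs[symmetric] by (intro mult_right_mono) (auto simp: field_simps)
  finally show ?thesis .
qed

lemma martingale_clt:
  assumes d: "\<And>a. (\<Sum>b\<in>UNIV. R a b * d a b) = 0"
  shows "(\<lambda>n. \<integral>\<omega>. iexp ((\<Sum>j<n. d (Z j \<omega>) (Z (Suc j) \<omega>)) / sqrt n) \<partial>M)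
    \<longlonglongrightarrow> complex_of_real (exp (- pair_mean (\<lambda>a b. (d a b)\<^sup>2) / 2))"
proof -
  define \<sigma>2 where "\<sigma>2 = pair_mean (\<lambda>a b. (d a b)\<^sup>2)"
  have \<sigma>2: "0 \<le> \<sigma>2"
    unfolding \<sigma>2_def pair_mean_def by (intro sum_nonneg mult_nonneg_nonneg \<pi>_nonneg nonneg) auto
  \<comment> \<open>The centered conditional variance; its Poisson solution \<open>w\<close>
    supplies the correction.\<close>
  define v where "v a = drift (\<lambda>a b. (d a b)\<^sup>2) a - \<sigma>2" for a
  have v: "(\<Sum>a\<in>UNIV. \<pi> a * v a) = 0"
    by (simp add: v_def right_diff_distrib sum_subtractf drift_mean \<pi>_sum \<sigma>2_def flip: sum_distrib_right)
  define w where "w = potential v"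
  have w: "(\<Sum>b\<in>UNIV. R a b * (d a b)\<^sup>2) + (\<Sum>b\<in>UNIV. R a b * w b) = w a + \<sigma>2" for a
    using poisson_equation[OF v, of a] by (simp add: w_def v_def[of a] drift_def)
  define B where "B = (\<Sum>a\<in>UNIV. \<Sum>b\<in>UNIV. \<bar>d a b\<bar>) + (\<Sum>a\<in>UNIV. \<bar>w a\<bar>) + \<sigma>2"
  have Bd: "\<bar>d a b\<bar> \<le> B" for a b
  proof -
    have "\<bar>d a b\<bar> \<le> (\<Sum>b\<in>UNIV. \<bar>d a b\<bar>)" by (rule member_le_sum) auto
    also have "\<dots> \<le> (\<Sum>a\<in>UNIV. \<Sum>b\<in>UNIV. \<bar>d a b\<bar>)" by (rule member_le_sum) (auto intro: sum_nonneg)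
    also have "\<dots> \<le> B" using \<sigma>2 by (auto simp: B_def intro!: add_nonneg_nonneg sum_nonneg)
    finally show ?thesis .
  qed
  have Bw: "\<bar>w a\<bar> \<le> B" for a
  proof -
    have "\<bar>w a\<bar> \<le> (\<Sum>a\<in>UNIV. \<bar>w a\<bar>)" by (rule member_le_sum) auto
    also have "\<dots> \<le> B" using \<sigma>2 by (auto simp: B_def intro!: add_nonneg_nonneg sum_nonneg)
    finally show ?thesis .
  qed
  have B\<sigma>: "\<bar>\<sigma>2\<bar> \<le> B" using \<sigma>2 by (auto simp: B_def intro!: add_nonneg_nonneg sum_nonneg)
  then have B0: "0 \<le> B" by linarith
  define K where "K = B ^ 3 + B\<^sup>2"
  define \<Phi> where "\<Phi> n = (\<integral>\<omega>. iexp ((\<Sum>j<n. d (Z j \<omega>) (Z (Suc j) \<omega>)) / sqrt n) \<partial>M)" for n :: nat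
  have int: "integrable M (\<lambda>\<omega>. iexp (r * (\<Sum>j<k. d (Z j \<omega>) (Z (Suc j) \<omega>))) * g (Z k \<omega>))"
    for r k and g :: "'a \<Rightarrow> complex"
  proof (rule integrable_const_bound)
    show "AE \<omega> in M. cmod (iexp (r * (\<Sum>j<k. d (Z j \<omega>) (Z (Suc j) \<omega>))) * g (Z k \<omega>)) \<le> (\<Sum>a\<in>UNIV. cmod (g a))"
      by (intro always_eventually allI) (auto simp: norm_mult intro: member_le_sum)
  qed measurable
  \<comment> \<open>The condition \<open>\<sigma>2 \<le> 4 * real n\<close> is exactly what keeps
    \<open>1 - \<sigma>2 / (2 n)\<close> above \<open>-1\<close>, so that the recursion factor has
    modulus at most one.\<close>
  have main: "cmod (\<Phi> n - complex_of_real (1 - \<sigma>2 / 2 / real n) ^ n) \<le> K / sqrt n + B / real n"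
    if n: "0 < n" "\<sigma>2 \<le> 4 * real n" for n :: nat
  proof -
    define s where "s = 1 / sqrt n"
    have s: "0 < s" "\<bar>s\<bar> \<le> 1" "s\<^sup>2 = 1 / real n" using n by (auto simp: s_def power_divide)
    define c where "c a = complex_of_real (1 - s\<^sup>2 / 2 * w a)" for a
    define r where "r = complex_of_real (1 - s\<^sup>2 * \<sigma>2 / 2)"
    define A where "A k = (\<integral>\<omega>. iexp (s * (\<Sum>j<k. d (Z j \<omega>) (Z (Suc j) \<omega>))) * c (Z k \<omega>) \<partial>M)" for k
    have r: "cmod r \<le> 1"
      unfolding r_def norm_of_real using n \<sigma>2 by (auto simp: s abs_le_iff field_simps)
    have c1: "cmod (c a - 1) \<le> B / (2 * real n)" for a
      using Bw[of a] n by (simp add: c_def s norm_mult norm_divide field_simps)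
    have step: "cmod (A (Suc k) - r * A k) \<le> K * s ^ 3" for k
    proof -
      define F where "F x = iexp (s * (\<Sum>j<k. d (x j) (x (Suc j))))" for x :: "nat \<Rightarrow> 'a"
      have "A (Suc k) = (\<integral>\<omega>. F (\<lambda>k. Z k \<omega>) * (iexp (s * d (Z k \<omega>) (Z (Suc k) \<omega>)) * c (Z (Suc k) \<omega>)) \<partial>M)"
        by (simp add: A_def F_def ring_distribs exp_add mult_ac)
      also have "\<dots> = (\<integral>\<omega>. F (\<lambda>k. Z k \<omega>) * (\<Sum>b\<in>UNIV. R (Z k \<omega>) b *\<^sub>R (iexp (s * d (Z k \<omega>) b) * c b)) \<partial>M)"
        by (rule markov_property[where \<psi> = "\<lambda>a b. iexp (s * d a b) * c b"])
           (simp add: F_def)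
      finally have "A (Suc k) - r * A k = (\<integral>\<omega>. F (\<lambda>k. Z k \<omega>) *
          ((\<Sum>b\<in>UNIV. R (Z k \<omega>) b *\<^sub>R (iexp (s * d (Z k \<omega>) b) * c b)) - r * c (Z k \<omega>)) \<partial>M)"
        using int[of s k "\<lambda>a. \<Sum>b\<in>UNIV. R a b *\<^sub>R (iexp (s * d a b) * c b)"] int[of s k c]
        by (simp add: A_def F_def right_diff_distrib mult.left_commute[of _ r])
      also have "cmod \<dots> \<le> (\<integral>\<omega>. K * s ^ 3 \<partial>M)"
      proof (rule order.trans[OF integral_norm_bound], rule integral_mono_AE)
        show "AE \<omega> in M. cmod (F (\<lambda>k. Z k \<omega>) * ((\<Sum>b\<in>UNIV. R (Z k \<omega>) b *\<^sub>R (iexp (s * d (Z k \<omega>) b) * c b))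
            - r * c (Z k \<omega>))) \<le> K * s ^ 3"
          using corrected_char_step[OF d w Bd Bw B\<sigma> s(2)] s(1)
          by (intro always_eventually allI) (simp add: norm_mult F_def c_def r_def K_def)
        show "integrable M (\<lambda>\<omega>. cmod (F (\<lambda>k. Z k \<omega>) * ((\<Sum>b\<in>UNIV. R (Z k \<omega>) b *\<^sub>R (iexp (s * d (Z k \<omega>) b) * c b))
            - r * c (Z k \<omega>))))"
          unfolding F_def by (intro integrable_norm int)
      qed simp
      finally show ?thesis by (simp add: prob_space)
    qed
    have "cmod (A n - r ^ n * A 0) \<le> real n * (K * s ^ 3)"
      using r step by (rule perturbed_recurrence_bound[of r A])
    also have "\<dots> = K * (real n * s\<^sup>2) * s"
      by (simp add: power2_eq_square power3_eq_cube)
    also have "\<dots> = K / sqrt n"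
      using n unfolding s(3) by (simp add: s_def)
    finally have 1: "cmod (A n - r ^ n * A 0) \<le> K / sqrt n" .
    \<comment> \<open>The correction factor is within \<open>B / (2 n)\<close> of one, so it can be
      removed at both ends, time \<open>0\<close> and time \<open>n\<close>.\<close>
    have mean_c: "cmod ((\<integral>\<omega>. F \<omega> * c (Z k \<omega>) \<partial>M) - (\<integral>\<omega>. F \<omega> \<partial>M)) \<le> B / (2 * real n)"
      if [measurable]: "F \<in> borel_measurable M" and F1: "\<And>\<omega>. cmod (F \<omega>) = 1" for F k
    proof -
      have iF: "integrable M (\<lambda>\<omega>. F \<omega> * g (Z k \<omega>))" for g :: "'a \<Rightarrow> complex"
        by (rule integrable_const_bound[where B = "\<Sum>a\<in>UNIV. cmod (g a)"])
           (auto simp: norm_mult F1 intro!: member_le_sum always_eventually)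
      have "(\<integral>\<omega>. F \<omega> * c (Z k \<omega>) \<partial>M) - (\<integral>\<omega>. F \<omega> \<partial>M) = (\<integral>\<omega>. F \<omega> * (c (Z k \<omega>) - 1) \<partial>M)"
        using iF[of c] iF[of "\<lambda>_. 1"] by (simp add: right_diff_distrib)
      also have "cmod \<dots> \<le> (\<integral>\<omega>. B / (2 * real n) \<partial>M)"
        by (rule order.trans[OF integral_norm_bound], rule integral_mono_AE)
           (use integrable_norm[OF iF[of "\<lambda>a. c a - 1"]] c1 in \<open>auto simp: norm_mult F1 intro!: always_eventually\<close>)
      finally show ?thesis by (simp add: prob_space)
    qed
    have 2: "cmod (A 0 - 1) \<le> B / (2 * real n)"
      using mean_c[of "\<lambda>_. 1" 0] by (simp add: A_def prob_space)
    have 3: "cmod (A n - \<Phi> n) \<le> B / (2 * real n)"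
      using mean_c[of "\<lambda>\<omega>. iexp (s * (\<Sum>j<n. d (Z j \<omega>) (Z (Suc j) \<omega>)))" n]
      by (simp add: A_def \<Phi>_def s_def)
    have 4: "cmod (r ^ n * (A 0 - 1)) \<le> B / (2 * real n)"
    proof -
      have "cmod (r ^ n * (A 0 - 1)) \<le> 1 * (B / (2 * real n))"
        unfolding norm_mult using 2 r by (intro mult_mono) (auto simp: norm_power power_le_one)
      then show ?thesis by simp
    qed
    have "\<Phi> n - r ^ n = - (A n - \<Phi> n) + ((A n - r ^ n * A 0) + r ^ n * (A 0 - 1))"
      by (simp add: algebra_simps)
    then have "cmod (\<Phi> n - r ^ n) \<le> B / (2 * real n) + (K / sqrt n + B / (2 * real n))"
      using 1 3 4 by (metis add_mono norm_minus_cancel norm_triangle_le)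
    then show ?thesis
      by (simp add: r_def s field_simps)
  qed
  have "(\<lambda>n. \<Phi> n - complex_of_real (1 - \<sigma>2 / 2 / real n) ^ n) \<longlonglongrightarrow> 0"
  proof (rule Lim_null_comparison)
    obtain N :: nat where "\<sigma>2 \<le> 4 * real N" by (metis mult.commute real_arch_simple pos_divide_le_eq zero_less_numeral)
    then show "\<forall>\<^sub>F n in sequentially. cmod (\<Phi> n - complex_of_real (1 - \<sigma>2 / 2 / real n) ^ n) \<le> K / sqrt n + B / real n"
      by (intro eventually_mono[OF eventually_ge_at_top[of "Suc N"] main]) auto
    show "(\<lambda>n. K / sqrt n + B / real n) \<longlonglongrightarrow> 0"
      by real_asymp
  qed
  moreover have "(\<lambda>n. complex_of_real ((1 + (- (\<sigma>2 / 2)) / real n) ^ n)) \<longlonglongrightarrow> complex_of_real (exp (- (\<sigma>2 / 2)))"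
    by (intro tendsto_of_real tendsto_exp_limit_sequentially)
  ultimately have "(\<lambda>n. (\<Phi> n - complex_of_real (1 - \<sigma>2 / 2 / real n) ^ n)
      + complex_of_real ((1 + (- (\<sigma>2 / 2)) / real n) ^ n)) \<longlonglongrightarrow> 0 + complex_of_real (exp (- (\<sigma>2 / 2)))"
    by (rule tendsto_add)
  then show ?thesis
    by (simp add: \<Phi>_def \<sigma>2_def)
qed

text \<open>The joint characteristic function reduces to the scalar case: \<open>d\<close> is the
  linear combination of the martingale parts. The coboundaries telescope to two bounded boundary
  terms, which are negligible after division by \<open>sqrt n\<close>.\<close>

lemma pair_functional_clt:
  fixes h :: "'z::finite \<Rightarrow> 'a \<Rightarrow> 'a \<Rightarrow> real"
  assumes h: "\<And>z. pair_mean (h z) = 0"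
  shows "(\<lambda>n. \<integral>\<omega>. iexp (\<Sum>z\<in>UNIV. u z * ((\<Sum>j<n. h z (Z j \<omega>) (Z (Suc j) \<omega>)) / sqrt n)) \<partial>M)
    \<longlonglongrightarrow> complex_of_real (exp (- (\<Sum>z\<in>UNIV. \<Sum>z'\<in>UNIV. u z * u z' *
        pair_mean (\<lambda>a b. martingale_part (h z) a b * martingale_part (h z') a b)) / 2))"
proof -
  define d where "d a b = (\<Sum>z\<in>UNIV. u z * martingale_part (h z) a b)" for a b
  define g where "g a = (\<Sum>z\<in>UNIV. u z * potential (drift (h z)) a)" for a
  have "(\<Sum>b\<in>UNIV. R a b * d a b) = (\<Sum>z\<in>UNIV. u z * (\<Sum>b\<in>UNIV. R a b * martingale_part (h z) a b))" for a
    unfolding d_def sum_distrib_left by (subst sum.swap) (simp add: mult_ac)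
  then have d0: "(\<Sum>b\<in>UNIV. R a b * d a b) = 0" for a
    by (simp add: martingale_part_drift[OF h])
  have "(d a b)\<^sup>2 = (\<Sum>z\<in>UNIV. \<Sum>z'\<in>UNIV. u z * u z' *
      (martingale_part (h z) a b * martingale_part (h z') a b))" for a b
    by (simp add: d_def power2_eq_square sum_product mult_ac)
  then have var: "pair_mean (\<lambda>a b. (d a b)\<^sup>2) = (\<Sum>z\<in>UNIV. \<Sum>z'\<in>UNIV. u z * u z' *
        pair_mean (\<lambda>a b. martingale_part (h z) a b * martingale_part (h z') a b))"
    by (simp add: pair_mean_sum pair_mean_cmult)
  define S where "S n \<omega> = (\<Sum>z\<in>UNIV. u z * ((\<Sum>j<n. h z (Z j \<omega>) (Z (Suc j) \<omega>)) / sqrt n))" for n \<omega>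
  define D where "D n \<omega> = (\<Sum>j<n. d (Z j \<omega>) (Z (Suc j) \<omega>)) / sqrt n" for n \<omega>
  define B where "B = 2 * (\<Sum>a\<in>UNIV. \<bar>g a\<bar>)"
  have [measurable]: "S n \<in> borel_measurable M" "D n \<in> borel_measurable M" for n
    unfolding S_def D_def by measurable
  have diff: "\<bar>S n \<omega> - D n \<omega>\<bar> \<le> B / sqrt n" for n \<omega>
  proof -
    have "(\<Sum>j<n. d (Z j \<omega>) (Z (Suc j) \<omega>)) = (\<Sum>j<n. (\<Sum>z\<in>UNIV. u z * h z (Z j \<omega>) (Z (Suc j) \<omega>)) +
         (g (Z (Suc j) \<omega>) - g (Z j \<omega>)))"
      by (simp add: d_def g_def martingale_part_def ring_distribs sum.distrib sum_subtractf)
    also have "\<dots> = (\<Sum>j<n. \<Sum>z\<in>UNIV. u z * h z (Z j \<omega>) (Z (Suc j) \<omega>)) + (g (Z n \<omega>) - g (Z 0 \<omega>))"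
      by (simp add: sum.distrib sum_lessThan_telescope[of "\<lambda>j. g (Z j \<omega>)"])
    also have "(\<Sum>j<n. \<Sum>z\<in>UNIV. u z * h z (Z j \<omega>) (Z (Suc j) \<omega>)) = (\<Sum>z\<in>UNIV. u z * (\<Sum>j<n. h z (Z j \<omega>) (Z (Suc j) \<omega>)))"
      unfolding sum_distrib_left by (rule sum.swap)
    finally have "(\<Sum>z\<in>UNIV. u z * (\<Sum>j<n. h z (Z j \<omega>) (Z (Suc j) \<omega>))) / sqrt n - D n \<omega>
        = (g (Z 0 \<omega>) - g (Z n \<omega>)) / sqrt n"
      by (simp only: D_def diff_divide_distrib[symmetric]) (simp add: algebra_simps)
    moreover have "S n \<omega> = (\<Sum>z\<in>UNIV. u z * (\<Sum>j<n. h z (Z j \<omega>) (Z (Suc j) \<omega>))) / sqrt n"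
      by (simp only: S_def sum_divide_distrib[where A = "UNIV :: 'z set"] times_divide_eq_right)
    ultimately have "S n \<omega> - D n \<omega> = (g (Z 0 \<omega>) - g (Z n \<omega>)) / sqrt n"
      by simp
    moreover have "\<bar>g a\<bar> \<le> (\<Sum>a\<in>UNIV. \<bar>g a\<bar>)" for a by (rule member_le_sum) auto
    from this[of "Z 0 \<omega>"] this[of "Z n \<omega>"] have "\<bar>g (Z 0 \<omega>) - g (Z n \<omega>)\<bar> \<le> B"
      unfolding B_def by linarith
    ultimately show ?thesis by (auto simp: abs_divide intro!: divide_right_mono)
  qed
  have int: "integrable M (\<lambda>\<omega>. iexp (S n \<omega>))" "integrable M (\<lambda>\<omega>. iexp (D n \<omega>))" for n
    by (auto intro!: integrable_const_bound[where B = 1])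
  have "(\<lambda>n. (\<integral>\<omega>. iexp (S n \<omega>) \<partial>M) - (\<integral>\<omega>. iexp (D n \<omega>) \<partial>M)) \<longlonglongrightarrow> 0"
  proof (rule Lim_null_comparison)
    show "\<forall>\<^sub>F n in sequentially. cmod ((\<integral>\<omega>. iexp (S n \<omega>) \<partial>M) - (\<integral>\<omega>. iexp (D n \<omega>) \<partial>M)) \<le> B / sqrt n"
    proof (intro always_eventually allI)
      fix n
      have "cmod ((\<integral>\<omega>. iexp (S n \<omega>) \<partial>M) - (\<integral>\<omega>. iexp (D n \<omega>) \<partial>M)) = cmod (\<integral>\<omega>. iexp (S n \<omega>) - iexp (D n \<omega>) \<partial>M)"
        using int by simp
      also have "\<dots> \<le> (\<integral>\<omega>. B / sqrt n \<partial>M)"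
        by (rule order.trans[OF integral_norm_bound], rule integral_mono_AE)
           (use int order.trans[OF iexp_diff_bound diff] in \<open>auto intro!: always_eventually\<close>)
      finally show "cmod ((\<integral>\<omega>. iexp (S n \<omega>) \<partial>M) - (\<integral>\<omega>. iexp (D n \<omega>) \<partial>M)) \<le> B / sqrt n"
        by (simp add: prob_space)
    qed
    show "(\<lambda>n. B / sqrt n) \<longlonglongrightarrow> 0" by real_asymp
  qed
  from tendsto_add[OF this martingale_clt[OF d0, folded D_def]]
  show ?thesis by (simp add: S_def var)
qed

end

lemma sum_UNIV_prod: "(\<Sum>a\<in>UNIV. f a) = (\<Sum>x\<in>UNIV. \<Sum>y\<in>UNIV. f (x, y))"
  for f :: "'x::finite \<times> 'y::finite \<Rightarrow> 'c::comm_monoid_add"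
  by (simp add: sum.cartesian_product UNIV_Times_UNIV)

section \<open>Almost sure transitions and stationary covariances\<close>

context finite_markov_process
begin

text \<open>The indicator of a forbidden transition has conditional mean zero, hence expectation
  zero. This is the source of absolute continuity of the empirical law.\<close>

lemma AE_transition_nonzero: "AE \<omega> in M. R (Z n \<omega>) (Z (Suc n) \<omega>) \<noteq> 0"
proof -
  have int: "integrable M (\<lambda>\<omega>. of_bool (R (Z n \<omega>) (Z (Suc n) \<omega>) = 0) :: real)"
    by (rule integrable_const_bound[where B = 1]) auto
  have "(\<Sum>b\<in>UNIV. R a b * of_bool (R a b = 0)) = 0" for a
    by (intro sum.neutral) auto
  then have "expectation (\<lambda>\<omega>. of_bool (R (Z n \<omega>) (Z (Suc n) \<omega>) = 0)) = (0 :: real)"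
    by (simp add: expectation_step[of "\<lambda>a b. of_bool (R a b = 0)"])
  then have "AE \<omega> in M. (of_bool (R (Z n \<omega>) (Z (Suc n) \<omega>) = 0) :: real) = 0"
    using integral_nonneg_eq_0_iff_AE[OF int] by simp
  then show ?thesis by simp
qed

lemma expectation_initial:
  fixes f :: "'a \<Rightarrow> real"
  shows "expectation (\<lambda>\<omega>. f (Z 0 \<omega>)) = (\<Sum>a\<in>UNIV. prob {\<omega> \<in> space M. Z 0 \<omega> = a} * f a)"
proof -
  have "expectation (\<lambda>\<omega>. f (Z 0 \<omega>)) = expectation (\<lambda>\<omega>. \<Sum>a\<in>UNIV. f a * indicator {\<omega> \<in> space M. Z 0 \<omega> = a} \<omega>)"
  proof (rule Bochner_Integration.integral_cong[OF refl])
    fix \<omega> assume "\<omega> \<in> space M"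
    then have "(\<Sum>a\<in>UNIV. f a * indicator {\<omega> \<in> space M. Z 0 \<omega> = a} \<omega>) = (\<Sum>a\<in>UNIV. f a * indicator {Z 0 \<omega>} a)"
      by (intro sum.cong) (auto simp: indicator_def)
    then show "f (Z 0 \<omega>) = (\<Sum>a\<in>UNIV. f a * indicator {\<omega> \<in> space M. Z 0 \<omega> = a} \<omega>)"
      by (simp add: sum_mult_indicator_singleton)
  qed
  also have "\<dots> = (\<Sum>a\<in>UNIV. expectation (\<lambda>\<omega>. f a * indicator {\<omega> \<in> space M. Z 0 \<omega> = a} \<omega>))"
    by (intro Bochner_Integration.integral_sum integrable_mult_right) (simp add: emeasure_eq_measure)
  finally show ?thesis by (simp add: emeasure_eq_measure mult.commute)
qed

end

context ergodic_markov_process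
begin

context
  assumes stationary: "\<And>a. prob {\<omega> \<in> space M. Z 0 \<omega> = a} = \<pi> a"
begin

lemma expectation_first_step: "expectation (\<lambda>\<omega>. \<phi> (Z 0 \<omega>) (Z (Suc 0) \<omega>)) = pair_mean \<phi>"
  unfolding expectation_step expectation_initial[of "\<lambda>a. \<Sum>b\<in>UNIV. R a b * \<phi> a b"] stationary
  by (simp add: pair_mean_def sum_distrib_left mult.assoc)

text \<open>The last transition is averaged out, which replaces \<open>f\<close> by
  \<open>kernel_op R f\<close>; hence the induction over \<open>k\<close> with \<open>f\<close>
  arbitrary.\<close>

lemma expectation_later_state:
  fixes f :: "'a \<Rightarrow> real"
  shows "expectation (\<lambda>\<omega>. \<phi> (Z 0 \<omega>) (Z (Suc 0) \<omega>) * f (Z (Suc k) \<omega>))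
    = pair_mean (\<lambda>a b. \<phi> a b * iter k f b)"
proof (induction k arbitrary: f)
  case 0
  show ?case using expectation_first_step[of "\<lambda>a b. \<phi> a b * f b"] by simp
next
  case (Suc k)
  have "expectation (\<lambda>\<omega>. \<phi> (Z 0 \<omega>) (Z (Suc 0) \<omega>) * f (Z (Suc (Suc k)) \<omega>))
      = expectation (\<lambda>\<omega>. \<phi> (Z 0 \<omega>) (Z (Suc 0) \<omega>) * kernel_op R f (Z (Suc k) \<omega>))"
    using markov_property[of "Suc k" "\<lambda>x. \<phi> (x 0) (x (Suc 0))" "\<lambda>a b. f b"]
    by (simp add: kernel_op_def)
  also have "\<dots> = pair_mean (\<lambda>a b. \<phi> a b * iter (Suc k) f b)"
    unfolding Suc funpow_Suc_right by simp
  finally show ?case .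
qed

lemma expectation_later_step:
  "expectation (\<lambda>\<omega>. \<phi> (Z 0 \<omega>) (Z (Suc 0) \<omega>) * \<psi> (Z (Suc k) \<omega>) (Z (Suc (Suc k)) \<omega>))
    = pair_mean (\<lambda>a b. \<phi> a b * iter k (drift \<psi>) b)"
proof -
  have "expectation (\<lambda>\<omega>. \<phi> (Z 0 \<omega>) (Z (Suc 0) \<omega>) * \<psi> (Z (Suc k) \<omega>) (Z (Suc (Suc k)) \<omega>))
      = expectation (\<lambda>\<omega>. \<phi> (Z 0 \<omega>) (Z (Suc 0) \<omega>) * drift \<psi> (Z (Suc k) \<omega>))"
    using markov_property[of "Suc k" "\<lambda>x. \<phi> (x 0) (x (Suc 0))" \<psi>]
    by (simp add: drift_def)
  then show ?thesis by (simp add: expectation_later_state)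
qed

lemma expectation_stationary_step: "expectation (\<lambda>\<omega>. \<psi> (Z k \<omega>) (Z (Suc k) \<omega>)) = pair_mean \<psi>"
proof (cases k)
  case (Suc j)
  have "expectation (\<lambda>\<omega>. \<psi> (Z (Suc j) \<omega>) (Z (Suc (Suc j)) \<omega>)) = (\<Sum>b\<in>UNIV. \<pi> b * iter j (drift \<psi>) b)"
    using expectation_later_step[of "\<lambda>_ _. 1" \<psi> j] by (simp add: pair_mean_snd)
  then show ?thesis using Suc by (simp add: invariant_iter invariant drift_mean)
qed (simp add: expectation_first_step)

text \<open>A lag of \<open>k + 1\<close> gives only \<open>k\<close> iterates: the first transition
  ends at time \<open>1\<close>, the second one starts at time \<open>k + 1\<close>.\<close>

lemma covariance_later_step:
  "covariance M (\<lambda>\<omega>. \<phi> (Z 0 \<omega>) (Z (Suc 0) \<omega>)) (\<lambda>\<omega>. \<psi> (Z (Suc k) \<omega>) (Z (Suc (Suc k)) \<omega>))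
    = pair_mean (\<lambda>a b. (\<phi> a b - pair_mean \<phi>) * iter k (drift (\<lambda>a b. \<psi> a b - pair_mean \<psi>)) b)"
  using expectation_later_step[of "\<lambda>a b. \<phi> a b - pair_mean \<phi>" "\<lambda>a b. \<psi> a b - pair_mean \<psi>" k]
  by (simp add: covariance_def expectation_stationary_step expectation_first_step)

lemma covariance_first_step:
  "covariance M (\<lambda>\<omega>. \<phi> (Z 0 \<omega>) (Z (Suc 0) \<omega>)) (\<lambda>\<omega>. \<psi> (Z 0 \<omega>) (Z (Suc 0) \<omega>))
    = pair_mean (\<lambda>a b. (\<phi> a b - pair_mean \<phi>) * (\<psi> a b - pair_mean \<psi>))"
  using expectation_first_step[of "\<lambda>a b. (\<phi> a b - pair_mean \<phi>) * (\<psi> a b - pair_mean \<psi>)"]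
  by (simp add: covariance_def expectation_first_step)

end
end

section \<open>The limiting covariance as a Gram matrix\<close>

context ergodic_kernel
begin

lemma pair_mean_const: "pair_mean (\<lambda>_ _. c) = c"
  using pair_mean_snd[of "\<lambda>_. c"] by (simp add: \<pi>_sum flip: sum_distrib_right)

definition centered :: "('a \<Rightarrow> 'a \<Rightarrow> real) \<Rightarrow> 'a \<Rightarrow> 'a \<Rightarrow> real" where
  "centered \<phi> a b = \<phi> a b - pair_mean \<phi>"

lemma pair_mean_centered: "pair_mean (centered \<phi>) = 0"
  unfolding centered_def using pair_mean_diff[of \<phi> "\<lambda>_ _. pair_mean \<phi>"] by (simp add: pair_mean_const)

text \<open>A square root of the limiting covariance whose rows are indexed by the transitions
  \<open>(a, b)\<close>: the stationary weight of the transition is split evenly between the two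
  factors of the Gram product.\<close>

definition asymptotic_factor :: "('z \<Rightarrow> 'a \<Rightarrow> 'a \<Rightarrow> real) \<Rightarrow> 'a \<times> 'a \<Rightarrow> 'z \<Rightarrow> real" where
  "asymptotic_factor \<phi> i z = sqrt (\<pi> (fst i) * R (fst i) (snd i)) * martingale_part (centered (\<phi> z)) (fst i) (snd i)"

lemma asymptotic_factor_gram:
  "(\<Sum>i\<in>UNIV. asymptotic_factor \<phi> i z * asymptotic_factor \<phi> i w)
    = pair_mean (\<lambda>a b. martingale_part (centered (\<phi> z)) a b * martingale_part (centered (\<phi> w)) a b)"
proof -
  have "asymptotic_factor \<phi> (a, b) z * asymptotic_factor \<phi> (a, b) w
      = \<pi> a * R a b * (martingale_part (centered (\<phi> z)) a b * martingale_part (centered (\<phi> w)) a b)" for a b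
    using \<pi>_nonneg[of a] nonneg[of a b]
    by (simp add: asymptotic_factor_def mult_ac flip: real_sqrt_mult)
  then show ?thesis
    by (simp add: pair_mean_def sum_UNIV_prod)
qed

end

text \<open>The covariances at positive lags are the terms of the Neumann series in the Gram matrix.
  Their summability follows at once and makes \<open>suminf\<close> in
  \<open>limit_covariance\<close> meaningful.\<close>

lemma (in ergodic_markov_process) limit_covariance_eq:
  assumes stationary: "\<And>a. prob {\<omega> \<in> space M. Z 0 \<omega> = a} = \<pi> a"
    and Y: "\<And>z k. pair_indicator Y z k = (\<lambda>\<omega>. \<phi> z (Z k \<omega>) (Z (Suc k) \<omega>))"
  shows "limit_covariance M Y z w = (\<Sum>i\<in>UNIV. asymptotic_factor \<phi> i z * asymptotic_factor \<phi> i w)"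
    and "summable (\<lambda>k. covariance M (pair_indicator Y z 0) (pair_indicator Y w (Suc k)))"
proof -
  have cov: "covariance M (pair_indicator Y z 0) (pair_indicator Y w (Suc k))
      = pair_mean (\<lambda>a b. centered (\<phi> z) a b * iter k (drift (centered (\<phi> w))) b)" for z w k
    unfolding Y covariance_later_step[OF stationary] centered_def ..
  have cov0: "covariance M (pair_indicator Y z 0) (pair_indicator Y w 0)
      = pair_mean (\<lambda>a b. centered (\<phi> z) a b * centered (\<phi> w) a b)"
    unfolding Y covariance_first_step[OF stationary] centered_def ..
  show "limit_covariance M Y z w = (\<Sum>i\<in>UNIV. asymptotic_factor \<phi> i z * asymptotic_factor \<phi> i w)"
    unfolding limit_covariance_def asymptotic_factor_gram cov cov0
    by (rule pair_mean_martingale_part[symmetric]) (rule pair_mean_centered)+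
  show "summable (\<lambda>k. covariance M (pair_indicator Y z 0) (pair_indicator Y w (Suc k)))"
    unfolding cov by (rule sums_summable, rule pair_mean_sums) (simp add: drift_mean pair_mean_centered)
qed

section \<open>Gaussian vectors\<close>

abbreviation std_normal_product :: "('i::finite \<Rightarrow> real) measure" where
  "std_normal_product \<equiv> PiM UNIV (\<lambda>_. std_normal_distribution)"

lemma prob_space_std_normal_product: "prob_space (std_normal_product :: ('i::finite \<Rightarrow> real) measure)"
  by (intro prob_space_PiM prob_space_normal_density) simp

lemma std_normal_product_char:
  fixes t :: "'i::finite \<Rightarrow> real"
  shows "(\<integral>x. iexp (\<Sum>i\<in>UNIV. t i * x i) \<partial>std_normal_product)
    = complex_of_real (exp (- (\<Sum>i\<in>UNIV. (t i)\<^sup>2) / 2))"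
proof -
  interpret product_sigma_finite "\<lambda>_::'i. std_normal_distribution"
    by (auto simp: product_sigma_finite_def intro!: prob_space_imp_sigma_finite prob_space_normal_density)
  have "(\<integral>x. iexp (\<Sum>i\<in>UNIV. t i * x i) \<partial>std_normal_product)
      = (\<integral>x. (\<Prod>i\<in>UNIV. iexp (t i * x i)) \<partial>std_normal_product)"
    by (simp add: sum_distrib_left exp_sum)
  also have "\<dots> = (\<Prod>i\<in>UNIV. char std_normal_distribution (t i))"
    unfolding char_def
    by (rule product_integral_prod) (auto intro!: prob_space.integrable_iexp prob_space_normal_density)
  also have "\<dots> = complex_of_real (exp (\<Sum>i\<in>UNIV. - (t i)\<^sup>2 / 2))"
    by (simp add: char_std_normal_distribution exp_sum)
  finally show ?thesis by (simp add: sum_negf sum_divide_distrib)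
qed

text \<open>Scaling the standard normal also covers \<open>\<sigma> = 0\<close>, so transforms and
  moments need no case distinction afterwards.\<close>

lemma normal_law_eq_distr:
  assumes "0 \<le> \<sigma>"
  shows "normal_law 0 \<sigma> = distr std_normal_distribution borel (\<lambda>x. \<sigma> * x)"
proof (cases "\<sigma> = 0")
  case True
  interpret prob_space std_normal_distribution by (intro prob_space_normal_density) simp
  show ?thesis
    using True distr_const[of 0 borel] by (simp add: normal_law_def)
next
  case False
  interpret prob_space std_normal_distribution by (intro prob_space_normal_density) simp
  have "distributed std_normal_distribution lborel (\<lambda>x. x) std_normal_density"
    by (auto simp: distributed_def intro!: distr_id2)
  from normal_density_affine[OF this, of \<sigma> 0] False assms
  have "distributed std_normal_distribution lborel (\<lambda>x. \<sigma> * x) (normal_density 0 \<sigma>)"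
    by simp
  then have "distr std_normal_distribution lborel (\<lambda>x. \<sigma> * x) = density lborel (normal_density 0 \<sigma>)"
    by (simp add: distributed_def)
  moreover have "distr std_normal_distribution lborel (\<lambda>x. \<sigma> * x) = distr std_normal_distribution borel (\<lambda>x. \<sigma> * x)"
    by (rule distr_cong) auto
  ultimately show ?thesis
    using False by (simp add: normal_law_def)
qed

lemma real_distribution_normal_law:
  assumes "0 \<le> \<sigma>"
  shows "real_distribution (normal_law 0 \<sigma>)"
  unfolding normal_law_eq_distr[OF assms]
  by (intro prob_space.real_distribution_distr prob_space_normal_density) auto

lemma char_normal_law:
  assumes "0 \<le> \<sigma>"
  shows "char (normal_law 0 \<sigma>) t = complex_of_real (exp (- (\<sigma> * t)\<^sup>2 / 2))"
proof -
  have "char (normal_law 0 \<sigma>) t = char std_normal_distribution (\<sigma> * t)"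
    unfolding normal_law_eq_distr[OF assms] char_def by (subst integral_distr) (auto simp: mult_ac)
  then show ?thesis by (simp add: char_std_normal_distribution)
qed

lemma
  assumes "0 \<le> \<sigma>"
  shows integrable_normal_law_power: "integrable (normal_law 0 \<sigma>) (\<lambda>x. x ^ k)"
    and normal_law_mean: "(\<integral>x. x \<partial>normal_law 0 \<sigma>) = 0"
    and normal_law_second_moment: "(\<integral>x. x\<^sup>2 \<partial>normal_law 0 \<sigma>) = \<sigma>\<^sup>2"
proof -
  have "integrable std_normal_distribution (\<lambda>x. \<sigma> ^ k * x ^ k)"
    by (intro integrable_mult_right integrable_std_normal_distribution_moment)
  then show "integrable (normal_law 0 \<sigma>) (\<lambda>x. x ^ k)"
    unfolding normal_law_eq_distr[OF assms] by (subst integrable_distr_eq) (auto simp: power_mult_distrib)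
  show "(\<integral>x. x \<partial>normal_law 0 \<sigma>) = 0"
    unfolding normal_law_eq_distr[OF assms]
    using integral_std_normal_distribution_moment_odd[of 1] by (subst integral_distr) auto
  have "(\<integral>x. x\<^sup>2 \<partial>std_normal_distribution) = 1"
    using std_normal_distribution_even_moments(1)[of 1] by (simp add: numeral_2_eq_2)
  then show "(\<integral>x. x\<^sup>2 \<partial>normal_law 0 \<sigma>) = \<sigma>\<^sup>2"
    unfolding normal_law_eq_distr[OF assms] by (subst integral_distr) (auto simp: power_mult_distrib)
qed

text \<open>An image of independent standard normals, so that \<open>A\<close> may be rectangular
  and the covariance degenerate.\<close>

definition gaussian_law :: "('i::finite \<Rightarrow> 'z::finite \<Rightarrow> real) \<Rightarrow> (real ^ 'z) measure" where
  "gaussian_law A = distr std_normal_product borel (\<lambda>x. \<chi> z. \<Sum>i\<in>UNIV. A i z * x i)"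

lemma gaussian_law_measurable [measurable]:
  "(\<lambda>x. \<chi> z. \<Sum>i\<in>UNIV. A i z * x i) \<in> borel_measurable std_normal_product"
  for A :: "'i::finite \<Rightarrow> 'z::finite \<Rightarrow> real"
  by (subst borel_measurable_euclidean_space) (auto simp: Basis_vec_def inner_axis)

lemma prob_space_gaussian_law: "prob_space (gaussian_law A)"
  unfolding gaussian_law_def
  by (intro prob_space.prob_space_distr prob_space_std_normal_product) measurable

lemma sets_gaussian_law [measurable_cong]: "sets (gaussian_law A) = sets borel"
  by (simp add: gaussian_law_def)

lemma gram_quadratic_form:
  fixes A :: "'i::finite \<Rightarrow> 'z::finite \<Rightarrow> real"
  shows "(\<Sum>z\<in>UNIV. \<Sum>w\<in>UNIV. u z * u w * (\<Sum>i\<in>UNIV. A i z * A i w)) = (\<Sum>i\<in>UNIV. (\<Sum>z\<in>UNIV. u z * A i z)\<^sup>2)"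
proof -
  have "(\<Sum>i\<in>UNIV. (\<Sum>z\<in>UNIV. u z * A i z)\<^sup>2)
      = (\<Sum>i\<in>UNIV. \<Sum>z\<in>UNIV. \<Sum>w\<in>UNIV. u z * u w * (A i z * A i w))"
    by (simp add: power2_eq_square sum_product mult_ac)
  also have "\<dots> = (\<Sum>z\<in>UNIV. \<Sum>w\<in>UNIV. u z * u w * (\<Sum>i\<in>UNIV. A i z * A i w))"
    unfolding sum_distrib_left
    by (subst sum.swap, rule sum.cong[OF refl], rule sum.swap)
  finally show ?thesis ..
qed

lemma gaussian_law_char:
  fixes A :: "'i::finite \<Rightarrow> 'z::finite \<Rightarrow> real"
  shows "(\<integral>v. iexp (\<Sum>z\<in>UNIV. u z * v $ z) \<partial>gaussian_law A)
    = complex_of_real (exp (- (\<Sum>z\<in>UNIV. \<Sum>w\<in>UNIV. u z * u w * (\<Sum>i\<in>UNIV. A i z * A i w)) / 2))"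
proof -
  have "(\<integral>v. iexp (\<Sum>z\<in>UNIV. u z * v $ z) \<partial>gaussian_law A)
      = (\<integral>x. iexp (\<Sum>z\<in>UNIV. u z * (\<Sum>i\<in>UNIV. A i z * x i)) \<partial>std_normal_product)"
    unfolding gaussian_law_def by (subst integral_distr) auto
  also have "\<dots> = (\<integral>x. iexp (\<Sum>i\<in>UNIV. (\<Sum>z\<in>UNIV. u z * A i z) * x i) \<partial>std_normal_product)"
    unfolding sum_distrib_left sum_distrib_right by (subst sum.swap) (simp only: mult.assoc)
  also have "\<dots> = complex_of_real (exp (- (\<Sum>i\<in>UNIV. (\<Sum>z\<in>UNIV. u z * A i z)\<^sup>2) / 2))"
    by (rule std_normal_product_char)
  finally show ?thesis by (simp only: gram_quadratic_form)
qed

text \<open>Normality is required of scalar functionals only, so uniqueness of one-dimensional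
  characteristic functions is enough.\<close>

lemma gaussian_law_linear_functional:
  fixes A :: "'i::finite \<Rightarrow> 'z::finite \<Rightarrow> real"
  defines "q \<equiv> \<lambda>u. \<Sum>z\<in>UNIV. \<Sum>w\<in>UNIV. u $ z * u $ w * (\<Sum>i\<in>UNIV. A i z * A i w)"
  shows "0 \<le> q u" and "distr (gaussian_law A) borel (\<lambda>v. u \<bullet> v) = normal_law 0 (sqrt (q u))"
proof -
  show q0: "0 \<le> q u"
    unfolding q_def gram_quadratic_form by (simp add: sum_nonneg)
  show "distr (gaussian_law A) borel (\<lambda>v. u \<bullet> v) = normal_law 0 (sqrt (q u))"
  proof (rule Levy_uniqueness)
    show "real_distribution (distr (gaussian_law A) borel (\<lambda>v. u \<bullet> v))"
      by (intro prob_space.real_distribution_distr prob_space_gaussian_law) measurable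
    show "real_distribution (normal_law 0 (sqrt (q u)))"
      by (rule real_distribution_normal_law) (simp add: q0)
    show "char (distr (gaussian_law A) borel (\<lambda>v. u \<bullet> v)) = char (normal_law 0 (sqrt (q u)))"
    proof
      fix t
      have "char (distr (gaussian_law A) borel (\<lambda>v. u \<bullet> v)) t = (\<integral>v. iexp (t * (u \<bullet> v)) \<partial>gaussian_law A)"
        unfolding char_def by (subst integral_distr) auto
      also have "\<dots> = (\<integral>v. iexp (\<Sum>z\<in>UNIV. (t * u $ z) * v $ z) \<partial>gaussian_law A)"
        by (simp only: inner_vec_def inner_real_def sum_distrib_left mult.assoc)
      also have "\<dots> = complex_of_real (exp (- (t\<^sup>2 * q u) / 2))"
        unfolding gaussian_law_char q_def by (simp add: sum_distrib_left power2_eq_square mult_ac)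
      also have "\<dots> = char (normal_law 0 (sqrt (q u))) t"
        using q0 by (simp add: char_normal_law power_mult_distrib mult_ac)
      finally show "char (distr (gaussian_law A) borel (\<lambda>v. u \<bullet> v)) t = char (normal_law 0 (sqrt (q u))) t" .
    qed
  qed
qed

lemma centered_gaussian_vector_gaussian_law:
  fixes A :: "'i::finite \<Rightarrow> 'z::finite \<Rightarrow> real"
  shows "centered_gaussian_vector (gaussian_law A) (\<lambda>v. v) (\<lambda>z w. \<Sum>i\<in>UNIV. A i z * A i w)"
proof -
  define q where "q = (\<lambda>u :: real ^ 'z. \<Sum>z\<in>UNIV. \<Sum>w\<in>UNIV. u $ z * u $ w * (\<Sum>i\<in>UNIV. A i z * A i w))"
  have law: "0 \<le> q u" "distr (gaussian_law A) borel (\<lambda>v. u \<bullet> v) = normal_law 0 (sqrt (q u))" for u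
    unfolding q_def by (rule gaussian_law_linear_functional)+
  have [measurable]: "(\<lambda>v. u \<bullet> v) \<in> borel_measurable (gaussian_law A)" for u by measurable
  have int: "integrable (gaussian_law A) (\<lambda>v. (u \<bullet> v) ^ k)" for u k
  proof -
    have "integrable (distr (gaussian_law A) borel (\<lambda>v. u \<bullet> v)) (\<lambda>x. x ^ k)"
      unfolding law(2) by (rule integrable_normal_law_power) (simp add: law(1))
    then show ?thesis by (subst (asm) integrable_distr_eq) auto
  qed
  have mean: "(\<integral>v. u \<bullet> v \<partial>gaussian_law A) = 0" for u
  proof -
    have "(\<integral>x. x \<partial>distr (gaussian_law A) borel (\<lambda>v. u \<bullet> v)) = 0"
      unfolding law(2) by (rule normal_law_mean) (simp add: law(1))
    then show ?thesis by (subst (asm) integral_distr) auto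
  qed
  have second: "(\<integral>v. (u \<bullet> v)\<^sup>2 \<partial>gaussian_law A) = q u" for u
  proof -
    have "(\<integral>x. x\<^sup>2 \<partial>distr (gaussian_law A) borel (\<lambda>v. u \<bullet> v)) = (sqrt (q u))\<^sup>2"
      unfolding law(2) by (rule normal_law_second_moment) (simp add: law(1))
    then show ?thesis by (subst (asm) integral_distr) (auto simp: law(1))
  qed
  have ax: "axis z 1 \<bullet> v = v $ z" for z and v :: "real ^ 'z"
    by (simp add: cart_eq_inner_axis inner_commute)
  have sum_axis: "(\<Sum>z'\<in>UNIV. (axis z 1 :: real ^ 'z) $ z' * g z') = g z" for z g
    by (simp add: axis_def if_distrib[of "\<lambda>x. x * _"] cong: if_cong)
  have "(\<integral>v. v $ z * v $ w \<partial>gaussian_law A) = (\<Sum>i\<in>UNIV. A i z * A i w)" for z w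
  proof -
    \<comment> \<open>Polarization: second moments are known for scalar functionals, and a product
      of coordinates is a combination of three squares.\<close>
    have "(\<integral>v. v $ z * v $ w \<partial>gaussian_law A)
      = (\<integral>v. (((axis z 1 + axis w 1) \<bullet> v)\<^sup>2 - (axis z 1 \<bullet> v)\<^sup>2 - (axis w 1 \<bullet> v)\<^sup>2) / 2 \<partial>gaussian_law A)"
      by (simp add: inner_add_left ax power2_eq_square algebra_simps)
    also have "\<dots> = (q (axis z 1 + axis w 1) - q (axis z 1) - q (axis w 1)) / 2"
      by (simp add: int second)
    also have "\<dots> = (\<Sum>z'\<in>UNIV. \<Sum>w'\<in>UNIV. ((axis z 1 :: real ^ 'z) $ z' * (axis w 1 :: real ^ 'z) $ w'
        + (axis w 1 :: real ^ 'z) $ z' * (axis z 1 :: real ^ 'z) $ w') * (\<Sum>i\<in>UNIV. A i z' * A i w')) / 2"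
      unfolding q_def sum_subtractf[symmetric] by (simp add: algebra_simps)
    also have "\<dots> = ((\<Sum>i\<in>UNIV. A i z * A i w) + (\<Sum>i\<in>UNIV. A i w * A i z)) / 2"
      by (simp add: ring_distribs sum.distrib mult.assoc sum_axis flip: sum_distrib_left)
    finally show ?thesis by (simp add: mult.commute)
  qed
  moreover have mean': "(\<integral>v. v $ z \<partial>gaussian_law A) = 0" for z
    using mean[of "axis z 1"] by (simp add: ax)
  moreover have "gaussian_vector (gaussian_law A) (\<lambda>v. v)"
    unfolding gaussian_vector_def
  proof (intro conjI allI)
    show "\<exists>a \<sigma>. 0 \<le> \<sigma> \<and> distr (gaussian_law A) borel (\<lambda>\<omega>. u \<bullet> \<omega>) = normal_law a \<sigma>" for u
      using law[of u] by (intro exI[of _ 0] exI[of _ "sqrt (q u)"]) simp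
  qed (auto simp: prob_space_gaussian_law)
  ultimately show ?thesis
    by (simp add: centered_gaussian_vector_def covariance_def)
qed

text \<open>A sum of squares that vanishes makes the whole column \<open>A i z\<close> zero. This
  disposes of the points where \<open>Q\<close> vanishes.\<close>

lemma gaussian_law_component_AE_zero:
  assumes "(\<Sum>i\<in>UNIV. A i z * A i z) = 0"
  shows "AE v in gaussian_law A. v $ z = 0"
proof -
  have "A i z = 0" for i
    using assms by (subst (asm) sum_nonneg_eq_0_iff) auto
  then show ?thesis
    unfolding gaussian_law_def by (subst AE_distr_iff) auto
qed

text \<open>A Gaussian randomization of the argument turns characteristic functions into Laplace
  transforms of quadratic forms.\<close>

lemma exp_quadratic_eq_char_mixture:
  fixes X :: "'z::finite \<Rightarrow> 'w \<Rightarrow> real"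
  assumes M: "prob_space M" and X [measurable]: "\<And>z. X z \<in> borel_measurable M" and c: "\<And>z. 0 \<le> c z"
  shows "complex_of_real (\<integral>\<omega>. exp (- (\<Sum>z\<in>UNIV. c z * (X z \<omega>)\<^sup>2)) \<partial>M)
    = (\<integral>g. (\<integral>\<omega>. iexp (\<Sum>z\<in>UNIV. sqrt (2 * c z) * g z * X z \<omega>) \<partial>M) \<partial>std_normal_product)"
proof -
  interpret M: prob_space M by (rule M)
  interpret G: prob_space "std_normal_product :: ('z \<Rightarrow> real) measure"
    by (rule prob_space_std_normal_product)
  interpret P: pair_prob_space M "std_normal_product :: ('z \<Rightarrow> real) measure" ..
  \<comment> \<open>The factor \<open>sqrt (2 * c z)\<close> cancels the \<open>1/2\<close> in the
    exponent of the normal characteristic function.\<close>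
  have "exp (- (\<Sum>z\<in>UNIV. c z * (X z \<omega>)\<^sup>2)) = exp (- (\<Sum>z\<in>UNIV. (sqrt (2 * c z) * X z \<omega>)\<^sup>2) / 2)" for \<omega>
    using c by (simp add: power_mult_distrib sum_divide_distrib[symmetric] sum_distrib_left[symmetric] mult.assoc)
  then have "complex_of_real (exp (- (\<Sum>z\<in>UNIV. c z * (X z \<omega>)\<^sup>2)))
      = (\<integral>g. iexp (\<Sum>z\<in>UNIV. sqrt (2 * c z) * g z * X z \<omega>) \<partial>std_normal_product)" for \<omega>
    using std_normal_product_char[of "\<lambda>z. sqrt (2 * c z) * X z \<omega>"] by (simp add: mult_ac)
  then have "complex_of_real (\<integral>\<omega>. exp (- (\<Sum>z\<in>UNIV. c z * (X z \<omega>)\<^sup>2)) \<partial>M)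
      = (\<integral>\<omega>. (\<integral>g. iexp (\<Sum>z\<in>UNIV. sqrt (2 * c z) * g z * X z \<omega>) \<partial>std_normal_product) \<partial>M)"
    by (simp flip: integral_complex_of_real)
  also have "\<dots> = (\<integral>g. (\<integral>\<omega>. iexp (\<Sum>z\<in>UNIV. sqrt (2 * c z) * g z * X z \<omega>) \<partial>M) \<partial>std_normal_product)"
    by (rule P.Fubini_integral[symmetric]) (auto intro!: P.integrable_const_bound[where B = 1] simp: split_beta')
  finally show ?thesis .
qed

text \<open>In the mixture over \<open>g\<close> the inner integrals converge pointwise and have
  modulus at most one, so dominated convergence applies without control on the tails of
  \<open>X n z\<close>.\<close>

lemma tendsto_exp_quadratic:
  fixes X :: "nat \<Rightarrow> 'z::finite \<Rightarrow> 'w \<Rightarrow> real" and V :: "'z \<Rightarrow> 'v \<Rightarrow> real"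
  assumes M: "prob_space M" and N: "prob_space N"
    and X [measurable]: "\<And>n z. X n z \<in> borel_measurable M" and V [measurable]: "\<And>z. V z \<in> borel_measurable N"
    and lim: "\<And>u. (\<lambda>n. \<integral>\<omega>. iexp (\<Sum>z\<in>UNIV. u z * X n z \<omega>) \<partial>M) \<longlonglongrightarrow> (\<integral>\<omega>. iexp (\<Sum>z\<in>UNIV. u z * V z \<omega>) \<partial>N)"
    and c: "\<And>z. 0 \<le> c z"
  shows "(\<lambda>n. \<integral>\<omega>. exp (- (\<Sum>z\<in>UNIV. c z * (X n z \<omega>)\<^sup>2)) \<partial>M) \<longlonglongrightarrow> (\<integral>\<omega>. exp (- (\<Sum>z\<in>UNIV. c z * (V z \<omega>)\<^sup>2)) \<partial>N)"
proof -
  interpret M: prob_space M by (rule M)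
  interpret N: prob_space N by (rule N)
  interpret G: prob_space "std_normal_product :: ('z \<Rightarrow> real) measure"
    by (rule prob_space_std_normal_product)
  have "(\<lambda>n. \<integral>g. (\<integral>\<omega>. iexp (\<Sum>z\<in>UNIV. sqrt (2 * c z) * g z * X n z \<omega>) \<partial>M) \<partial>std_normal_product)
      \<longlonglongrightarrow> (\<integral>g. (\<integral>\<omega>. iexp (\<Sum>z\<in>UNIV. sqrt (2 * c z) * g z * V z \<omega>) \<partial>N) \<partial>std_normal_product)"
  proof (rule integral_dominated_convergence[where w = "\<lambda>_. 1"])
    show "AE g in std_normal_product. (\<lambda>n. \<integral>\<omega>. iexp (\<Sum>z\<in>UNIV. sqrt (2 * c z) * g z * X n z \<omega>) \<partial>M)
        \<longlonglongrightarrow> (\<integral>\<omega>. iexp (\<Sum>z\<in>UNIV. sqrt (2 * c z) * g z * V z \<omega>) \<partial>N)"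
      by (intro always_eventually allI lim)
    show "AE g in std_normal_product. cmod (\<integral>\<omega>. iexp (\<Sum>z\<in>UNIV. sqrt (2 * c z) * g z * X n z \<omega>) \<partial>M) \<le> 1" for n
    proof (intro always_eventually allI)
      fix g :: "'z \<Rightarrow> real"
      show "cmod (\<integral>\<omega>. iexp (\<Sum>z\<in>UNIV. sqrt (2 * c z) * g z * X n z \<omega>) \<partial>M) \<le> 1"
        by (rule order.trans[OF integral_norm_bound]) (simp add: M.prob_space)
    qed
  qed auto
  then show ?thesis
    unfolding exp_quadratic_eq_char_mixture[OF M X c, symmetric] exp_quadratic_eq_char_mixture[OF N V c, symmetric]
    by (simp only: tendsto_of_real_iff)
qed

section \<open>Convergence in law from exponential moments\<close>

text \<open>The substitution \<open>y = exp (- x)\<close> identifies \<open>[0, \<infinity>]\<close>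
  with the compact interval \<open>[0, 1]\<close>. Continuity of \<open>f\<close> at the infinite
  point settles \<open>y = 0\<close>.\<close>

lemma continuous_on_neg_ln_ereal:
  fixes f :: "ereal \<Rightarrow> real"
  assumes f: "continuous_on UNIV f"
  shows "continuous_on {0..1} (\<lambda>y. if y \<le> 0 then f \<infinity> else f (ereal (- ln y)))" (is "continuous_on _ ?h")
proof -
  have lim: "((\<lambda>y. f (ereal (- ln y))) \<longlongrightarrow> f \<infinity>) (at_right 0)"
  proof (rule continuous_on_tendsto_compose[OF f])
    have "filterlim (\<lambda>y::real. - ln y) at_top (at_right 0)"
      using ln_at_0 by (simp add: filterlim_uminus_at_top)
    then show "((\<lambda>y. ereal (- ln y)) \<longlongrightarrow> \<infinity>) (at_right 0)"
      by (simp add: tendsto_PInfty_eq_at_top)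
  qed auto
  have "continuous (at x within {0..1}) ?h" if x: "x \<in> {0..1}" for x
  proof (cases "x = 0")
    case True
    have "((\<lambda>y. ?h y) \<longlongrightarrow> f \<infinity>) (at_right 0)"
      by (rule tendsto_cong[THEN iffD1, OF _ lim]) (auto simp: eventually_at_right_less intro!: eventually_mono[OF eventually_at_right_less])
    then have "((\<lambda>y. ?h y) \<longlongrightarrow> f \<infinity>) (at 0 within {0..1})"
      by (simp add: at_within_Icc_at_right)
    with True show ?thesis by (simp add: continuous_within)
  next
    case False
    with x have x0: "x > 0" by auto
    have "isCont (\<lambda>y. f (ereal (- ln y))) x"
      by (rule isCont_o2[where g=f]) (use x0 f in \<open>auto simp: continuous_on_eq_continuous_at intro!: continuous_intros\<close>)
    moreover have "\<forall>\<^sub>F y in nhds x. ?h y = f (ereal (- ln y))"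
      using eventually_gt_at_top x0 by (intro eventually_mono[OF eventually_nhds_in_open[of "{0<..}"]]) auto
    ultimately have "isCont ?h x"
      by (simp add: isCont_cong)
    then show ?thesis by (simp add: continuous_at_imp_continuous_at_within)
  qed
  then show ?thesis by (simp add: continuous_on_eq_continuous_within)
qed

lemma tendsto_integral_of_exp_moments:
  fixes T :: "nat \<Rightarrow> 'w \<Rightarrow> real" and V :: "'v \<Rightarrow> real" and f :: "ereal \<Rightarrow> real"
  assumes M: "prob_space M" and N: "prob_space N"
    and T [measurable]: "\<And>n. T n \<in> borel_measurable M" and V [measurable]: "V \<in> borel_measurable N"
    and T0: "\<And>n. AE \<omega> in M. 0 \<le> T n \<omega>" and V0: "AE \<omega> in N. 0 \<le> V \<omega>"
    and lim: "\<And>k::nat. (\<lambda>n. \<integral>\<omega>. exp (- (real k * T n \<omega>)) \<partial>M) \<longlonglongrightarrow> (\<integral>\<omega>. exp (- (real k * V \<omega>)) \<partial>N)"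
    and f: "continuous_on UNIV f"
  shows "(\<lambda>n. \<integral>\<omega>. f (ereal (T n \<omega>)) \<partial>M) \<longlonglongrightarrow> (\<integral>\<omega>. f (ereal (V \<omega>)) \<partial>N)"
proof -
  interpret M: prob_space M by (rule M)
  interpret N: prob_space N by (rule N)
  have [measurable]: "f \<in> borel_measurable borel"
    using f by (rule borel_measurable_continuous_onI)
  define h where "h = (\<lambda>y::real. if y \<le> 0 then f \<infinity> else f (ereal (- ln y)))"
  have h: "continuous_on {0..1} h"
    unfolding h_def by (rule continuous_on_neg_ln_ereal[OF f])
  have hf: "h (exp (- x)) = f (ereal x)" for x
    by (simp add: h_def)
  show ?thesis
  proof (rule tendstoI, goal_cases)
    case (1 e)
    obtain p where p: "real_polynomial_function p" "\<And>y. y \<in> {0..1} \<Longrightarrow> \<bar>h y - p y\<bar> < e / 3"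
      using Stone_Weierstrass_real_polynomial_function[OF compact_Icc h, of "e/3"] 1 by auto
    obtain c m where c: "p = (\<lambda>y. \<Sum>i\<le>m. c i * y ^ i)"
      using p(1) by (auto simp: real_polynomial_function_iff_sum)
    \<comment> \<open>A polynomial in \<open>exp (- x)\<close> is a combination of the exponentials
      whose expectations converge by assumption.\<close>
    have pe: "p (exp (- x)) = (\<Sum>i\<le>m. c i * exp (- (real i * x)))" for x
      by (simp add: c exp_of_nat_mult[symmetric])
    have close: "\<bar>f (ereal x) - p (exp (- x))\<bar> \<le> e / 3" if "x \<ge> 0" for x
      using p(2)[of "exp (- x)"] that by (simp add: hf)
    have intM: "integrable M (\<lambda>\<omega>. exp (- (real i * T n \<omega>)))" for i n
      by (rule M.integrable_const_bound[of _ 1]) (use T0[of n] in auto)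
    have intN: "integrable N (\<lambda>\<omega>. exp (- (real i * V \<omega>)))" for i
      by (rule N.integrable_const_bound[of _ 1]) (use V0 in auto)
    \<comment> \<open>Compactness of \<open>ereal\<close> bounds \<open>f\<close>, so boundedness is
      not a separate assumption.\<close>
    have "compact (range f)"
      using compact_continuous_image[OF f] by (simp add: compact_UNIV)
    then obtain B where B: "\<And>x. \<bar>f x\<bar> \<le> B"
      by (metis compact_imp_bounded bounded_iff rangeI real_norm_def)
    have fM: "integrable M (\<lambda>\<omega>. f (ereal (T n \<omega>)))" for n
      by (rule M.integrable_const_bound[of _ B]) (auto simp: B)
    have fN: "integrable N (\<lambda>\<omega>. f (ereal (V \<omega>)))"
      by (rule N.integrable_const_bound[of _ B]) (auto simp: B)
    have pM: "integrable M (\<lambda>\<omega>. p (exp (- T n \<omega>)))" for n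
      unfolding pe using intM by auto
    have pN: "integrable N (\<lambda>\<omega>. p (exp (- V \<omega>)))"
      unfolding pe using intN by auto
    have "(\<lambda>n. \<integral>\<omega>. p (exp (- T n \<omega>)) \<partial>M) \<longlonglongrightarrow> (\<integral>\<omega>. p (exp (- V \<omega>)) \<partial>N)"
      unfolding pe using intM intN by (simp add: tendsto_sum tendsto_mult_left lim)
    then have "\<forall>\<^sub>F n in sequentially. dist (\<integral>\<omega>. p (exp (- T n \<omega>)) \<partial>M) (\<integral>\<omega>. p (exp (- V \<omega>)) \<partial>N) < e / 3"
      using 1 by (auto dest!: tendstoD[where e = "e/3"])
    then show ?case
    proof eventually_elim
      case (elim n)
      have "\<bar>(\<integral>\<omega>. f (ereal (T n \<omega>)) \<partial>M) - (\<integral>\<omega>. p (exp (- T n \<omega>)) \<partial>M)\<bar> \<le> (\<integral>\<omega>. e / 3 \<partial>M)"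
        unfolding Bochner_Integration.integral_diff[OF fM pM, symmetric]
        by (rule order.trans[OF integral_abs_bound], rule integral_mono_AE)
           (use fM pM close T0[of n] in auto)
      moreover have "\<bar>(\<integral>\<omega>. f (ereal (V \<omega>)) \<partial>N) - (\<integral>\<omega>. p (exp (- V \<omega>)) \<partial>N)\<bar> \<le> (\<integral>\<omega>. e / 3 \<partial>N)"
        unfolding Bochner_Integration.integral_diff[OF fN pN, symmetric]
        by (rule order.trans[OF integral_abs_bound], rule integral_mono_AE)
           (use fN pN close V0 in auto)
      ultimately show ?case
        using elim by (simp add: dist_real_def M.prob_space N.prob_space) (smt (verit))
    qed
  qed
qed

section \<open>Relative entropy and the chi-square divergence\<close>

text \<open>The lower bound for \<open>u \<ge> 1\<close> is the first Pade approximant of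
  \<open>ln\<close> at \<open>1\<close>, the upper one is \<open>sinh (ln u)\<close>. Both
  differences to \<open>ln\<close> are monotone and vanish at \<open>1\<close>, so the inequalities
  reverse for \<open>u \<le> 1\<close>.\<close>

lemma
  fixes u :: real
  assumes "0 < u"
  shows ln_pade_bound: "1 \<le> u \<Longrightarrow> 2 * (u - 1) / (u + 1) \<le> ln u" "u \<le> 1 \<Longrightarrow> ln u \<le> 2 * (u - 1) / (u + 1)"
    and ln_sinh_bound: "1 \<le> u \<Longrightarrow> ln u \<le> (u\<^sup>2 - 1) / (2 * u)" "u \<le> 1 \<Longrightarrow> (u\<^sup>2 - 1) / (2 * u) \<le> ln u"
proof -
  let ?f = "\<lambda>x::real. ln x - 2 * (x - 1) / (x + 1)" and ?g = "\<lambda>x::real. (x\<^sup>2 - 1) / (2 * x) - ln x"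
  have f: "?f a \<le> ?f b" if "0 < a" "a \<le> b" for a b
  proof (rule DERIV_nonneg_imp_nondecreasing[OF that(2)])
    fix x assume "a \<le> x" "x \<le> b"
    with that have x: "x > 0" by simp
    have "(?f has_real_derivative 1 / x - (2 * (x + 1) - 2 * (x - 1)) / (x + 1)\<^sup>2) (at x)"
      using x by (auto intro!: derivative_eq_intros simp: power2_eq_square)
    also have "1 / x - (2 * (x + 1) - 2 * (x - 1)) / (x + 1)\<^sup>2 = (x - 1)\<^sup>2 / (x * (x + 1)\<^sup>2)"
      using x by (simp add: divide_simps) (simp add: power2_eq_square algebra_simps)
    finally have "(?f has_real_derivative (x - 1)\<^sup>2 / (x * (x + 1)\<^sup>2)) (at x)" .
    then show "\<exists>y. (?f has_real_derivative y) (at x) \<and> 0 \<le> y"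
      using x by (intro exI conjI) auto
  qed
  have g: "?g a \<le> ?g b" if "0 < a" "a \<le> b" for a b
  proof (rule DERIV_nonneg_imp_nondecreasing[OF that(2)])
    fix x assume "a \<le> x" "x \<le> b"
    with that have x: "x > 0" by simp
    have "(?g has_real_derivative (1 - 1 / x)\<^sup>2 / 2) (at x)"
      using x by (auto intro!: derivative_eq_intros simp: field_simps power2_eq_square)
    then show "\<exists>y. (?g has_real_derivative y) (at x) \<and> 0 \<le> y"
      by (intro exI conjI) auto
  qed
  show "1 \<le> u \<Longrightarrow> 2 * (u - 1) / (u + 1) \<le> ln u" "u \<le> 1 \<Longrightarrow> ln u \<le> 2 * (u - 1) / (u + 1)"
    using f[of 1 u] f[of u 1] assms by auto
  show "1 \<le> u \<Longrightarrow> ln u \<le> (u\<^sup>2 - 1) / (2 * u)" "u \<le> 1 \<Longrightarrow> (u\<^sup>2 - 1) / (2 * u) \<le> ln u"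
    using g[of 1 u] g[of u 1] assms by auto
qed

text \<open>Inserting \<open>?p\<close> for the logarithm gives exactly \<open>(u - 1)^2\<close>,
  inserting \<open>?q\<close> gives it up to the cubic term \<open>D\<close>; the true value lies in
  between. At \<open>u = 0\<close> both sides equal one.\<close>

lemma entropy_function_quadratic_approx:
  fixes u :: real
  assumes "0 \<le> u"
  shows "\<bar>2 * (u * ln u - u + 1) - (u - 1)\<^sup>2\<bar> \<le> \<bar>u - 1\<bar> * (u - 1)\<^sup>2"
proof (cases "u = 0")
  case False
  with assms have u: "0 < u" by simp
  let ?p = "(u\<^sup>2 - 1) / (2 * u)" and ?q = "2 * (u - 1) / (u + 1)"
  have p: "2 * (u * ?p - u + 1) = (u - 1)\<^sup>2"
    using u by (simp add: field_simps power2_eq_square)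
  define D where "D = (u - 1) * (u - 1)\<^sup>2 / (u + 1)"
  have q: "2 * (u * ?q - u + 1) = (u - 1)\<^sup>2 - D"
    unfolding D_def using u by (simp add: divide_simps) (simp add: power2_eq_square algebra_simps)
  have D: "\<bar>D\<bar> \<le> \<bar>u - 1\<bar> * (u - 1)\<^sup>2"
    using u frac_le[of "\<bar>u - 1\<bar> * (u - 1)\<^sup>2" "\<bar>u - 1\<bar> * (u - 1)\<^sup>2" 1 "u + 1"]
    by (simp add: D_def abs_mult)
  have between: ?thesis if "u * ?q \<le> u * ln u \<and> u * ln u \<le> u * ?p \<or> u * ?p \<le> u * ln u \<and> u * ln u \<le> u * ?q"
  proof -
    have "\<bar>2 * (u * ln u - u + 1) - (u - 1)\<^sup>2\<bar> \<le> \<bar>D\<bar>"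
    proof -
      have "\<bar>2 * (e - u + 1) - S\<bar> \<le> \<bar>D\<bar>"
        if "b \<le> e \<and> e \<le> a \<or> a \<le> e \<and> e \<le> b" "2 * (a - u + 1) = S" "2 * (b - u + 1) = S - D" for a b e S :: real
        using that by auto
      from this[OF that p q] show ?thesis .
    qed
    with D show ?thesis by linarith
  qed
  show ?thesis
  proof (cases "1 \<le> u")
    case True
    have "u * ?q \<le> u * ln u" "u * ln u \<le> u * ?p"
      by (rule mult_left_mono[OF ln_pade_bound(1)[OF u True] less_imp_le[OF u]],
          rule mult_left_mono[OF ln_sinh_bound(1)[OF u True] less_imp_le[OF u]])
    then show ?thesis by (intro between) blast
  next
    case False
    then have le: "u \<le> 1" by simp
    have "u * ln u \<le> u * ?q" "u * ?p \<le> u * ln u"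
      by (rule mult_left_mono[OF ln_pade_bound(2)[OF u le] less_imp_le[OF u]],
          rule mult_left_mono[OF ln_sinh_bound(2)[OF u le] less_imp_le[OF u]])
    then show ?thesis by (intro between) blast
  qed
qed simp

text \<open>The inequality \<open>ln t \<le> t - 1\<close> at \<open>t = 1 / sqrt u\<close> gives
  the Hellinger bound \<open>(sqrt u - 1)^2\<close>, and \<open>u - 1\<close> factors as
  \<open>(sqrt u - 1) * (sqrt u + 1)\<close>.\<close>

lemma entropy_function_lower_bound:
  fixes u :: real
  assumes u: "0 \<le> u" "u \<le> K"
  shows "(u - 1)\<^sup>2 / (sqrt K + 1)\<^sup>2 \<le> u * ln u - u + 1"
proof -
  have "(sqrt u - 1)\<^sup>2 \<le> u * ln u - u + 1"
  proof (cases "u = 0")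
    case False
    with u have u0: "0 < u" by simp
    have "- ln (sqrt u) \<le> 1 / sqrt u - 1"
      using ln_le_minus_one[of "1 / sqrt u"] u0 by (simp add: ln_div)
    then have "2 * u * (1 - 1 / sqrt u) \<le> 2 * u * ln (sqrt u)"
      using u0 by (intro mult_left_mono) auto
    moreover have "u / sqrt u = sqrt u" using u0 by (simp add: real_div_sqrt)
    moreover have "2 * ln (sqrt u) = ln u" using u0 by (simp add: ln_sqrt)
    moreover have "2 * u * (1 - 1 / sqrt u) = 2 * u - 2 * (u / sqrt u)" by (simp add: algebra_simps)
    ultimately show ?thesis using u0 by (simp add: power2_diff algebra_simps)
  qed simp
  moreover have "(u - 1)\<^sup>2 / (sqrt K + 1)\<^sup>2 \<le> (sqrt u - 1)\<^sup>2"
  proof -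
    have "(u - 1)\<^sup>2 = (sqrt u - 1)\<^sup>2 * (sqrt u + 1)\<^sup>2"
      unfolding power_mult_distrib[symmetric] using u by (simp add: algebra_simps)
    also have "\<dots> \<le> (sqrt u - 1)\<^sup>2 * (sqrt K + 1)\<^sup>2"
      using u by (intro mult_left_mono power_mono) auto
    finally show ?thesis using u by (simp add: divide_le_eq zero_less_power2 add_nonneg_pos)
  qed
  ultimately show ?thesis by linarith
qed

context
  fixes L Q :: "'z::finite \<Rightarrow> real"
  assumes L0: "\<And>z. 0 \<le> L z" and L1: "(\<Sum>z\<in>UNIV. L z) = 1"
    and Q0: "\<And>z. 0 \<le> Q z" and Q1: "(\<Sum>z\<in>UNIV. Q z) = 1"
    and ac: "\<And>z. Q z = 0 \<Longrightarrow> L z = 0"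
begin

text \<open>Adding \<open>Q - L\<close>, of total mass zero, makes each summand nonnegative and of
  second order at \<open>L = Q\<close>. Absolute continuity removes the points where
  \<open>Q\<close> vanishes.\<close>

lemma entropy_eq_sum:
  "(\<Sum>z | L z > 0. L z * ln (L z / Q z))
    = (\<Sum>z\<in>UNIV. Q z * (L z / Q z * ln (L z / Q z) - L z / Q z + 1))"
proof -
  have "(\<Sum>z | L z > 0. L z * ln (L z / Q z)) = (\<Sum>z\<in>UNIV. L z * ln (L z / Q z))"
    by (rule sum.mono_neutral_left) (auto simp: L0 intro: antisym)
  also have "\<dots> = (\<Sum>z\<in>UNIV. L z * ln (L z / Q z) - L z + Q z)"
    by (simp add: sum.distrib sum_subtractf L1 Q1)
  also have "\<dots> = (\<Sum>z\<in>UNIV. Q z * (L z / Q z * ln (L z / Q z) - L z / Q z + 1))"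
    using ac by (intro sum.cong refl) (auto simp: ring_distribs right_diff_distrib)
  finally show ?thesis .
qed

lemma chi_square_eq_sum:
  "(\<Sum>z\<in>UNIV. (L z - Q z)\<^sup>2 / Q z) = (\<Sum>z\<in>UNIV. Q z * (L z / Q z - 1)\<^sup>2)"
proof (rule sum.cong[OF refl])
  fix z
  show "(L z - Q z)\<^sup>2 / Q z = Q z * (L z / Q z - 1)\<^sup>2"
  proof (cases "Q z = 0")
    case False
    then have "L z / Q z - 1 = (L z - Q z) / Q z" by (simp add: diff_divide_distrib)
    then show ?thesis by (simp add: power_divide power2_eq_square)
  qed simp
qed

lemma entropy_nonneg: "0 \<le> (\<Sum>z | L z > 0. L z * ln (L z / Q z))"
  unfolding entropy_eq_sum
proof (intro sum_nonneg mult_nonneg_nonneg Q0)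
  fix z
  have "0 \<le> (L z / Q z - 1)\<^sup>2 / (sqrt (L z / Q z) + 1)\<^sup>2" by simp
  also have "\<dots> \<le> L z / Q z * ln (L z / Q z) - L z / Q z + 1"
    by (intro entropy_function_lower_bound divide_nonneg_nonneg L0 Q0 order.refl)
  finally show "0 \<le> L z / Q z * ln (L z / Q z) - L z / Q z + 1" .
qed

text \<open>A lower bound \<open>q\<close> for the charged masses bounds each
  \<open>\<bar>L z / Q z - 1\<bar>\<close> by \<open>sqrt (X / q)\<close>. One factor of the cubic
  remainder is estimated this way, and the other two rebuild \<open>X\<close>.\<close>

lemma entropy_close_to_chi_square:
  assumes q: "0 < q" "\<And>z. Q z \<noteq> 0 \<Longrightarrow> q \<le> Q z"
  defines "X \<equiv> \<Sum>z\<in>UNIV. (L z - Q z)\<^sup>2 / Q z"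
  shows "\<bar>2 * (\<Sum>z | L z > 0. L z * ln (L z / Q z)) - X\<bar> \<le> sqrt (X / q) * X"
proof -
  have X: "X = (\<Sum>z\<in>UNIV. Q z * (L z / Q z - 1)\<^sup>2)"
    unfolding X_def by (rule chi_square_eq_sum)
  have dev: "\<bar>L z / Q z - 1\<bar> \<le> sqrt (X / q)" if "Q z \<noteq> 0" for z
  proof -
    have "q * (L z / Q z - 1)\<^sup>2 \<le> Q z * (L z / Q z - 1)\<^sup>2"
      using q(2)[OF that] by (intro mult_right_mono) auto
    also have "\<dots> \<le> X"
      unfolding X by (rule member_le_sum[of z UNIV "\<lambda>z. Q z * (L z / Q z - 1)\<^sup>2"]) (auto simp: Q0)
    finally show ?thesis
      using q(1) by (intro real_le_rsqrt) (simp add: field_simps)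
  qed
  have "2 * (\<Sum>z | L z > 0. L z * ln (L z / Q z)) - X
      = (\<Sum>z\<in>UNIV. Q z * (2 * (L z / Q z * ln (L z / Q z) - L z / Q z + 1) - (L z / Q z - 1)\<^sup>2))"
    unfolding entropy_eq_sum X sum_distrib_left sum_subtractf[symmetric]
    by (intro sum.cong refl) (simp only: right_diff_distrib mult.left_commute[of 2])
  then have "\<bar>2 * (\<Sum>z | L z > 0. L z * ln (L z / Q z)) - X\<bar>
      = \<bar>\<Sum>z\<in>UNIV. Q z * (2 * (L z / Q z * ln (L z / Q z) - L z / Q z + 1) - (L z / Q z - 1)\<^sup>2)\<bar>"
    by (rule arg_cong)
  also have "\<dots> \<le> (\<Sum>z\<in>UNIV. sqrt (X / q) * (Q z * (L z / Q z - 1)\<^sup>2))"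
  proof (rule order.trans[OF sum_abs], rule sum_mono)
    fix z
    show "\<bar>Q z * (2 * (L z / Q z * ln (L z / Q z) - L z / Q z + 1) - (L z / Q z - 1)\<^sup>2)\<bar>
        \<le> sqrt (X / q) * (Q z * (L z / Q z - 1)\<^sup>2)"
    proof (cases "Q z = 0")
      case False
      let ?u = "L z / Q z"
      have "\<bar>Q z * (2 * (?u * ln ?u - ?u + 1) - (?u - 1)\<^sup>2)\<bar> = Q z * \<bar>2 * (?u * ln ?u - ?u + 1) - (?u - 1)\<^sup>2\<bar>"
        using Q0[of z] by (simp add: abs_mult)
      also have "\<dots> \<le> Q z * (\<bar>?u - 1\<bar> * (?u - 1)\<^sup>2)"
        by (intro mult_left_mono entropy_function_quadratic_approx divide_nonneg_nonneg L0 Q0)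
      also have "\<dots> \<le> Q z * (sqrt (X / q) * (?u - 1)\<^sup>2)"
        by (intro mult_left_mono mult_right_mono dev False Q0) auto
      finally show ?thesis by (simp add: mult_ac)
    qed simp
  qed
  also have "\<dots> = sqrt (X / q) * X"
    unfolding sum_distrib_left[symmetric] X[symmetric] by (rule refl)
  finally show ?thesis .
qed

text \<open>Since \<open>L z \<le> 1\<close>, the ratios are at most \<open>1 / q\<close>, which
  serves as \<open>K\<close> in the pointwise lower bound.\<close>

lemma entropy_ge_chi_square:
  assumes q: "0 < q" "\<And>z. Q z \<noteq> 0 \<Longrightarrow> q \<le> Q z"
  shows "2 / (sqrt (1 / q) + 1)\<^sup>2 * (\<Sum>z\<in>UNIV. (L z - Q z)\<^sup>2 / Q z) \<le> 2 * (\<Sum>z | L z > 0. L z * ln (L z / Q z))"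
proof -
  have "1 / (sqrt (1 / q) + 1)\<^sup>2 * (\<Sum>z\<in>UNIV. (L z - Q z)\<^sup>2 / Q z) \<le> (\<Sum>z | L z > 0. L z * ln (L z / Q z))"
    unfolding entropy_eq_sum chi_square_eq_sum sum_distrib_left
  proof (rule sum_mono)
    fix z
    show "1 / (sqrt (1 / q) + 1)\<^sup>2 * (Q z * (L z / Q z - 1)\<^sup>2) \<le> Q z * (L z / Q z * ln (L z / Q z) - L z / Q z + 1)"
    proof (cases "Q z = 0")
      case False
      have "L z \<le> 1" unfolding L1[symmetric] by (rule member_le_sum) (auto simp: L0)
      then have "L z / Q z \<le> 1 / q"
        using q(2)[OF False] q(1) by (intro frac_le) auto
      from mult_left_mono[OF entropy_function_lower_bound[OF _ this] Q0[of z]]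
      show ?thesis using L0[of z] Q0[of z] by (simp add: mult_ac)
    qed simp
  qed
  then show ?thesis by simp
qed

end

section \<open>Comparison of the exponentials of the two divergences\<close>

lemma exp_neg_diff_bound:
  fixes x y :: real
  assumes "m \<le> x" "m \<le> y"
  shows "\<bar>exp (- x) - exp (- y)\<bar> \<le> \<bar>x - y\<bar> * exp (- m)"
proof -
  have *: "exp (- x) - exp (- y) \<le> (y - x) * exp (- m)" "0 \<le> exp (- x) - exp (- y)"
    if "m \<le> x" "x \<le> y" for x y :: real
  proof -
    have "exp (- x) - exp (- y) = exp (- x) * (1 - exp (- (y - x)))"
      by (simp add: right_diff_distrib flip: exp_add)
    also have "\<dots> \<le> exp (- x) * (y - x)"
      by (intro mult_left_mono) (use exp_ge_add_one_self[of "x - y"] in \<open>auto simp del: exp_ge_add_one_self\<close>)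
    also have "\<dots> \<le> exp (- m) * (y - x)"
      using that by (intro mult_right_mono) auto
    finally show "exp (- x) - exp (- y) \<le> (y - x) * exp (- m)" by (simp add: mult.commute)
    show "0 \<le> exp (- x) - exp (- y)" using that by simp
  qed
  show ?thesis
    using *[of x y] *[of y x] assms by (cases "x \<le> y") (auto simp: abs_minus_commute)
qed

lemma power_three_halves_exp_bound:
  fixes x c :: real
  assumes "0 \<le> x" "0 < c"
  shows "x * sqrt x * exp (- (c * x)) \<le> 1 + 2 / c\<^sup>2"
proof -
  have "x * sqrt x \<le> 1 + x\<^sup>2"
  proof (cases "x \<le> 1")
    case True
    then have "x * sqrt x \<le> 1 * 1" using assms by (intro mult_mono) auto
    then show ?thesis by (simp add: add_increasing2)
  next
    case False
    then have "sqrt x \<le> x" by (intro real_le_lsqrt) (auto simp: power2_eq_square)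
    then have "x * sqrt x \<le> x * x" using assms by (intro mult_left_mono) auto
    then show ?thesis by (simp add: power2_eq_square)
  qed
  then have "x * sqrt x * exp (- (c * x)) \<le> exp (- (c * x)) + x\<^sup>2 * exp (- (c * x))"
    using mult_right_mono[of "x * sqrt x" "1 + x\<^sup>2" "exp (- (c * x))"] by (simp add: ring_distribs)
  moreover have "exp (- (c * x)) \<le> 1" using assms by simp
  moreover have "x\<^sup>2 * exp (- (c * x)) \<le> 2 / c\<^sup>2"
  proof -
    have "c\<^sup>2 * x\<^sup>2 / 2 \<le> exp (c * x)"
      using exp_lower_Taylor_quadratic[of "c * x"] mult_nonneg_nonneg[of c x] assms
      unfolding power_mult_distrib by linarith
    then show ?thesis using assms by (simp add: exp_minus field_simps)
  qed
  ultimately show ?thesis by linarith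
qed

text \<open>With \<open>x = n X\<close> and \<open>y = 2 n H\<close>, the distance of
  \<open>y\<close> to \<open>x\<close> is at most \<open>x^(3/2) / sqrt (q n)\<close>, and both are
  at least \<open>c x\<close>. The constant depends on \<open>Q\<close> and \<open>k\<close> only,
  not on \<open>L\<close>.\<close>

lemma exp_entropy_close_to_exp_chi_square:
  fixes Q :: "'z::finite \<Rightarrow> real"
  assumes Q0: "\<And>z. 0 \<le> Q z" and Q1: "(\<Sum>z\<in>UNIV. Q z) = 1"
  obtains C where "\<And>L n. 0 < n \<Longrightarrow> (\<And>z. 0 \<le> L z) \<Longrightarrow> (\<Sum>z\<in>UNIV. L z) = 1 \<Longrightarrow>
      (\<And>z. Q z = 0 \<Longrightarrow> L z = 0) \<Longrightarrow>
      \<bar>exp (- (real k * (2 * real n * (\<Sum>z | L z > 0. L z * ln (L z / Q z)))))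
        - exp (- (real k * (real n * (\<Sum>z\<in>UNIV. (L z - Q z)\<^sup>2 / Q z))))\<bar> \<le> C / sqrt (real n)"
proof -
  \<comment> \<open>The least charged mass, positive because the space is finite.\<close>
  define q where "q = Min (Q ` {z. Q z \<noteq> 0})"
  have ne: "{z. Q z \<noteq> 0} \<noteq> {}"
    using Q1 by (auto simp: sum_nonneg_eq_0_iff intro: ccontr)
  have "q \<in> Q ` {z. Q z \<noteq> 0}"
    unfolding q_def using ne by (intro Min_in) auto
  then have "0 < q" using Q0 by (auto simp: less_le)
  moreover have "q \<le> Q z" if "Q z \<noteq> 0" for z
    unfolding q_def using that by (intro Min_le) auto
  ultimately have q: "0 < q" "\<And>z. Q z \<noteq> 0 \<Longrightarrow> q \<le> Q z" by blast+
  \<comment> \<open>The minimum with \<open>1\<close> makes \<open>c * x\<close> a lower bound for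
    \<open>x\<close> as well as for \<open>y\<close>.\<close>
  define c where "c = min (2 / (sqrt (1 / q) + 1)\<^sup>2) 1"
  have "0 < sqrt (1 / q) + 1" using q(1) by (intro add_nonneg_pos) auto
  then have c: "0 < c" "c \<le> 1" by (auto simp: c_def)
  show ?thesis
  proof
    fix L :: "'z \<Rightarrow> real" and n :: nat
    assume n: "0 < n" and L: "\<And>z. 0 \<le> L z" "(\<Sum>z\<in>UNIV. L z) = 1" "\<And>z. Q z = 0 \<Longrightarrow> L z = 0"
    define X where "X = (\<Sum>z\<in>UNIV. (L z - Q z)\<^sup>2 / Q z)"
    define H where "H = (\<Sum>z | L z > 0. L z * ln (L z / Q z))"
    have X0: "0 \<le> X" by (auto simp: X_def intro!: sum_nonneg divide_nonneg_nonneg Q0)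
    have close: "\<bar>2 * H - X\<bar> \<le> sqrt (X / q) * X"
      unfolding X_def H_def using L Q0 Q1 q by (intro entropy_close_to_chi_square) auto
    have "2 / (sqrt (1 / q) + 1)\<^sup>2 * X \<le> 2 * H"
      unfolding X_def H_def using L Q0 Q1 q by (intro entropy_ge_chi_square) auto
    moreover have "c * X \<le> 2 / (sqrt (1 / q) + 1)\<^sup>2 * X"
      using X0 by (intro mult_right_mono) (auto simp: c_def)
    ultimately have low: "c * X \<le> 2 * H" by linarith
    define x where "x = real n * X"
    define y where "y = 2 * real n * H"
    have x0: "0 \<le> x" using X0 by (simp add: x_def)
    have low: "c * x \<le> y" "c * x \<le> x"
      using mult_left_mono[OF low, of "real n"] mult_right_mono[OF c(2) x0] by (simp_all add: x_def y_def mult_ac)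
    have "\<bar>y - x\<bar> = real n * \<bar>2 * H - X\<bar>"
    proof -
      have "y - x = real n * (2 * H - X)" by (simp add: x_def y_def algebra_simps)
      then show ?thesis by (simp add: abs_mult)
    qed
    also have "\<dots> \<le> real n * (sqrt (X / q) * X)"
      by (intro mult_left_mono close) auto
    also have "\<dots> = x * sqrt x / sqrt q / sqrt (real n)"
      using n by (simp add: x_def real_sqrt_divide real_sqrt_mult)
    finally have dist: "\<bar>y - x\<bar> \<le> x * sqrt x / sqrt q / sqrt (real n)" .
    have "\<bar>exp (- (real k * y)) - exp (- (real k * x))\<bar> \<le> \<bar>real k * y - real k * x\<bar> * exp (- (real k * (c * x)))"
      using low by (intro exp_neg_diff_bound mult_left_mono) auto
    \<comment> \<open>For \<open>k \<ge> 1\<close> the factor \<open>k\<close> in the exponent may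
      be dropped; for \<open>k = 0\<close> both sides vanish.\<close>
    also have "\<dots> \<le> (real k * \<bar>y - x\<bar>) * exp (- (c * x))"
    proof (cases "k = 0")
      case False
      then have "1 * (c * x) \<le> real k * (c * x)" using c x0 by (intro mult_right_mono) auto
      then show ?thesis
        by (simp add: abs_mult right_diff_distrib[symmetric] mult_left_mono)
    qed simp
    also have "\<dots> \<le> (real k * (x * sqrt x / sqrt q / sqrt (real n))) * exp (- (c * x))"
      by (intro mult_right_mono mult_left_mono dist) auto
    also have "\<dots> = real k / sqrt q / sqrt (real n) * (x * sqrt x * exp (- (c * x)))"
      by simp
    also have "\<dots> \<le> real k / sqrt q / sqrt (real n) * (1 + 2 / c\<^sup>2)"
      using q(1) by (intro mult_left_mono power_three_halves_exp_bound x0 c) auto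
    also have "\<dots> = (real k / sqrt q * (1 + 2 / c\<^sup>2)) / sqrt (real n)"
      by simp
    finally show "\<bar>exp (- (real k * (2 * real n * (\<Sum>z | L z > 0. L z * ln (L z / Q z)))))
        - exp (- (real k * (real n * (\<Sum>z\<in>UNIV. (L z - Q z)\<^sup>2 / Q z))))\<bar>
        \<le> (real k / sqrt q * (1 + 2 / c\<^sup>2)) / sqrt (real n)"
      by (simp only: x_def y_def X_def H_def)
  qed
qed

section \<open>Hidden Markov models\<close>

definition hmm_kernel :: "real ^ 'm ^ 'm \<Rightarrow> ('m \<Rightarrow> 's::finite pmf) \<Rightarrow> 'm \<times> 's \<Rightarrow> 'm \<times> 's \<Rightarrow> real" where
  "hmm_kernel P e a b = P $ fst a $ fst b * pmf (e (fst b)) (snd b)"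

definition hmm_law :: "('m::finite) pmf \<Rightarrow> ('m \<Rightarrow> 's::finite pmf) \<Rightarrow> 'm \<times> 's \<Rightarrow> real" where
  "hmm_law \<mu> e a = pmf \<mu> (fst a) * pmf (e (fst a)) (snd a)"

lemma sum_pmf_UNIV: "(\<Sum>x\<in>UNIV. pmf p x) = 1" for p :: "'x::finite pmf"
  by (rule sum_pmf_eq_1) auto

lemma stochastic_kernel_hmm:
  assumes "stochastic_matrix P"
  shows "stochastic_kernel (hmm_kernel P e)"
  using assms
  by unfold_locales (auto simp: hmm_kernel_def stochastic_matrix_def sum_UNIV_prod sum_pmf_UNIV
      simp flip: sum_distrib_left)

text \<open>A transition of the pair forgets the current signal, so from the first step on only the
  emission average of \<open>f\<close> matters. The statement starts at \<open>Suc k\<close> because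
  with no step the signal is still remembered.\<close>

lemma hmm_kernel_iterate:
  "(kernel_op (hmm_kernel P e) ^^ Suc k) f a
    = (kernel_op (\<lambda>i j. P $ i $ j) ^^ Suc k) (\<lambda>x. \<Sum>y\<in>UNIV. pmf (e x) y * f (x, y)) (fst a)"
proof (induction k arbitrary: f)
  case 0
  show ?case by (simp add: kernel_op_def hmm_kernel_def sum_UNIV_prod sum_distrib_left mult.assoc)
next
  case (Suc k)
  have step: "kernel_op (hmm_kernel P e) f (x, y)
      = kernel_op (\<lambda>i j. P $ i $ j) (\<lambda>x. \<Sum>y\<in>UNIV. pmf (e x) y * f (x, y)) x" for x y
    by (simp add: kernel_op_def hmm_kernel_def sum_UNIV_prod sum_distrib_left mult.assoc)
  have "(\<Sum>y\<in>UNIV. pmf (e x) y * kernel_op (hmm_kernel P e) f (x, y))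
      = kernel_op (\<lambda>i j. P $ i $ j) (\<lambda>x. \<Sum>y\<in>UNIV. pmf (e x) y * f (x, y)) x" for x
    by (simp add: step sum_pmf_UNIV flip: sum_distrib_right)
  then show ?case
    using Suc[of "kernel_op (hmm_kernel P e) f"] by (simp only: funpow_Suc_right comp_apply)
qed

text \<open>What passes from the hidden chain to the pair chain is the summability of iterates: a
  function centered for the pair law has an emission average centered for the hidden law. The shift
  by one step does not affect convergence.\<close>

lemma ergodic_kernel_hmm:
  assumes P: "stochastic_matrix P" and n0: "1 \<le> n0" and \<kappa>: "0 < \<kappa>" and \<nu>0: "\<And>j. 0 < pmf \<nu>0 j"
    and minor: "\<And>i j. matrix_power P n0 $ i $ j \<ge> \<kappa> * pmf \<nu>0 j"
  shows "ergodic_kernel (hmm_kernel P e) (hmm_law (stationary_law P) e)"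
proof -
  interpret P: doeblin_kernel "\<lambda>i j. P $ i $ j" n0 \<kappa> "pmf \<nu>0"
    by (rule doeblin_kernel_matrix[OF P n0 \<kappa> minor])
  interpret stochastic_kernel "hmm_kernel P e"
    by (rule stochastic_kernel_hmm[OF P])
  let ?\<mu> = "stationary_law P"
  have inv: "(\<Sum>i\<in>UNIV. pmf ?\<mu> i * P $ i $ j) = pmf ?\<mu> j" for j
    using invariant_law_stationary_law[OF P n0 \<kappa> \<nu>0 minor] by (simp add: invariant_law_def)
  show ?thesis
  proof
    show "(\<Sum>a\<in>UNIV. hmm_law ?\<mu> e a) = 1"
      by (simp add: hmm_law_def sum_UNIV_prod sum_pmf_UNIV flip: sum_distrib_left)
    show "(\<Sum>a\<in>UNIV. hmm_law ?\<mu> e a * hmm_kernel P e a b) = hmm_law ?\<mu> e b" for b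
    proof -
      have "(\<Sum>a\<in>UNIV. hmm_law ?\<mu> e a * hmm_kernel P e a b)
          = (\<Sum>x\<in>UNIV. \<Sum>y\<in>UNIV. (pmf ?\<mu> x * P $ x $ fst b * pmf (e (fst b)) (snd b)) * pmf (e x) y)"
        by (simp add: hmm_law_def hmm_kernel_def sum_UNIV_prod mult_ac)
      also have "\<dots> = (\<Sum>x\<in>UNIV. pmf ?\<mu> x * P $ x $ fst b) * pmf (e (fst b)) (snd b)"
        by (simp add: sum_pmf_UNIV sum_distrib_right flip: sum_distrib_left)
      finally show ?thesis by (simp add: inv hmm_law_def)
    qed
    show "summable (\<lambda>k. (kernel_op (hmm_kernel P e) ^^ k) f a)"
      if "(\<Sum>a\<in>UNIV. hmm_law ?\<mu> e a * f a) = 0" for f a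
    proof -
      let ?f = "\<lambda>x. \<Sum>y\<in>UNIV. pmf (e x) y * f (x, y)"
      have "(\<Sum>x\<in>UNIV. pmf ?\<mu> x * ?f x) = 0"
        using that by (simp add: hmm_law_def sum_UNIV_prod sum_distrib_left mult.assoc)
      then have "summable (\<lambda>k. (kernel_op (\<lambda>i j. P $ i $ j) ^^ k) ?f (fst a))"
        by (intro P.summable_iter[OF _ sum_pmf_UNIV inv]) auto
      then have "summable (\<lambda>k. (kernel_op (hmm_kernel P e) ^^ Suc k) f a)"
        unfolding hmm_kernel_iterate by (subst summable_Suc_iff)
      then show ?thesis by (subst (asm) summable_Suc_iff)
    qed
  qed (simp add: hmm_law_def)
qed

text \<open>Conditional probabilities are specified on paths of positive probability only. The
  product form also covers null paths, as their extensions are null too.\<close>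

lemma hidden_path_prob_Suc:
  assumes "markov_chain M X P \<nu>"
  shows "\<P>(\<omega> in M. \<forall>k\<le>Suc n. X k \<omega> = x k) = \<P>(\<omega> in M. \<forall>k\<le>n. X k \<omega> = x k) * P $ x n $ x (Suc n)"
proof -
  interpret prob_space M using assms by (simp add: markov_chain_def)
  have [measurable]: "X n \<in> measurable M (count_space UNIV)" for n
    using assms by (simp add: markov_chain_def)
  have set_eq: "{\<omega> \<in> space M. \<forall>k\<le>Suc n. X k \<omega> = x k} = {\<omega> \<in> space M. X (Suc n) \<omega> = x (Suc n) \<and> (\<forall>k\<le>n. X k \<omega> = x k)}"
    by (auto simp: le_Suc_eq)
  show ?thesis
  proof (cases "\<P>(\<omega> in M. \<forall>k\<le>n. X k \<omega> = x k) > 0")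
    case True
    then have "\<P>(\<omega> in M. X (Suc n) \<omega> = x (Suc n) \<bar> \<forall>k\<le>n. X k \<omega> = x k) = P $ x n $ x (Suc n)"
      using assms by (simp add: markov_chain_def)
    then show ?thesis using True unfolding cond_prob_def set_eq by (simp add: field_simps)
  next
    case False
    then have "\<P>(\<omega> in M. \<forall>k\<le>n. X k \<omega> = x k) = 0" by (simp add: zero_less_measure_iff)
    moreover have "\<P>(\<omega> in M. \<forall>k\<le>Suc n. X k \<omega> = x k) \<le> \<P>(\<omega> in M. \<forall>k\<le>n. X k \<omega> = x k)"
      by (rule finite_measure_mono) auto
    ultimately show ?thesis by (simp add: measure_le_0_iff)
  qed
qed

text \<open>On a hidden path of positive probability, conditional independence is evaluated on
  singletons; on a null path the joint event is null as well.\<close>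

lemma hmm_path_prob:
  assumes hmm: "hidden_markov_model M X Y P e \<nu>"
  shows "\<P>(\<omega> in M. \<forall>k\<le>n. X k \<omega> = x k \<and> Y k \<omega> = y k)
    = \<P>(\<omega> in M. \<forall>k\<le>n. X k \<omega> = x k) * (\<Prod>k\<le>n. pmf (e (x k)) (y k))"
proof -
  have chain: "markov_chain M X P \<nu>" using hmm by (simp add: hidden_markov_model_def)
  interpret prob_space M using chain by (simp add: markov_chain_def)
  have [measurable]: "X n \<in> measurable M (count_space UNIV)" "Y n \<in> measurable M (count_space UNIV)" for n
    using hmm by (simp_all add: markov_chain_def hidden_markov_model_def)
  let ?B = "{\<omega> \<in> space M. \<forall>k\<le>n. X k \<omega> = x k}"
  have B [measurable]: "?B \<in> sets M" by measurable
  show ?thesis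
  proof (cases "prob ?B > 0")
    case True
    define C where "C = uniform_measure M ?B"
    have eB: "emeasure M ?B \<noteq> 0" using True by (simp add: emeasure_eq_measure)
    interpret C: prob_space C
      unfolding C_def using eB by (intro prob_space_uniform_measure) (auto simp: emeasure_eq_measure)
    have sp: "space C = space M" and sets_C: "sets C = sets M" by (simp_all add: C_def)
    have [measurable]: "Y n \<in> measurable C (count_space UNIV)" for n
      using sets_C by (subst measurable_cong_sets[OF _ refl]) auto
    have indep: "C.indep_vars (\<lambda>_. count_space UNIV) Y {..n}"
      and law: "distr C (count_space UNIV) (Y k) = measure_pmf (e (x k))" if "k \<le> n" for k
      using hmm True that unfolding hidden_markov_model_def C_def Let_def by blast+
    have "C.prob (\<Inter>k\<in>{..n}. Y k -` {y k} \<inter> space C) = (\<Prod>k\<in>{..n}. C.prob (Y k -` {y k} \<inter> space C))"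
      by (rule C.indep_varsD[OF indep]) auto
    also have "\<dots> = (\<Prod>k\<le>n. pmf (e (x k)) (y k))"
    proof (intro prod.cong refl)
      fix k assume "k \<in> {..n}"
      have "C.prob (Y k -` {y k} \<inter> space C) = measure (distr C (count_space UNIV) (Y k)) {y k}"
        by (simp add: measure_distr)
      then show "C.prob (Y k -` {y k} \<inter> space C) = pmf (e (x k)) (y k)"
        using law[of k] \<open>k \<in> {..n}\<close> by (simp add: measure_pmf_single)
    qed
    also have "C.prob (\<Inter>k\<in>{..n}. Y k -` {y k} \<inter> space C)
        = prob (?B \<inter> (\<Inter>k\<in>{..n}. Y k -` {y k} \<inter> space M)) / prob ?B"
      unfolding C_def using eB by (subst measure_uniform_measure) (auto simp: emeasure_eq_measure)
    also have "?B \<inter> (\<Inter>k\<in>{..n}. Y k -` {y k} \<inter> space M) = {\<omega> \<in> space M. \<forall>k\<le>n. X k \<omega> = x k \<and> Y k \<omega> = y k}"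
      by auto
    finally show ?thesis using True by (simp add: field_simps)
  next
    case False
    then have "prob ?B = 0" by (simp add: zero_less_measure_iff)
    moreover have "prob {\<omega> \<in> space M. \<forall>k\<le>n. X k \<omega> = x k \<and> Y k \<omega> = y k} \<le> prob ?B"
      by (rule finite_measure_mono) auto
    ultimately show ?thesis by (simp add: measure_le_0_iff)
  qed
qed

lemma finite_markov_process_hmm:
  assumes P: "stochastic_matrix P" and hmm: "hidden_markov_model M X Y P e \<nu>"
  shows "finite_markov_process M (hmm_kernel P e) (\<lambda>n \<omega>. (X n \<omega>, Y n \<omega>))"
proof -
  have chain: "markov_chain M X P \<nu>" using hmm by (simp add: hidden_markov_model_def)
  interpret prob_space M using chain by (simp add: markov_chain_def)
  interpret stochastic_kernel "hmm_kernel P e" by (rule stochastic_kernel_hmm[OF P])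
  have [measurable]: "X n \<in> measurable M (count_space UNIV)" "Y n \<in> measurable M (count_space UNIV)" for n
    using hmm by (simp_all add: markov_chain_def hidden_markov_model_def)
  show ?thesis
  proof
    show "(\<lambda>\<omega>. (X n \<omega>, Y n \<omega>)) \<in> measurable M (count_space UNIV)" for n
      by measurable
    have eq: "{\<omega> \<in> space M. \<forall>k\<le>n. (X k \<omega>, Y k \<omega>) = z k}
        = {\<omega> \<in> space M. \<forall>k\<le>n. X k \<omega> = fst (z k) \<and> Y k \<omega> = snd (z k)}" for n and z :: "nat \<Rightarrow> _"
      by (auto simp: prod_eq_iff)
    show "prob {\<omega> \<in> space M. \<forall>k\<le>Suc n. (X k \<omega>, Y k \<omega>) = z k}
        = prob {\<omega> \<in> space M. \<forall>k\<le>n. (X k \<omega>, Y k \<omega>) = z k} * hmm_kernel P e (z n) (z (Suc n))" for n z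
      unfolding eq hmm_path_prob[OF hmm] hidden_path_prob_Suc[OF chain]
      by (simp add: hmm_kernel_def mult_ac)
  qed
qed

lemma hmm_initial_prob:
  assumes hmm: "hidden_markov_model M X Y P e \<nu>"
  shows "\<P>(\<omega> in M. (X 0 \<omega>, Y 0 \<omega>) = a) = hmm_law \<nu> e a"
proof -
  have chain: "markov_chain M X P \<nu>" using hmm by (simp add: hidden_markov_model_def)
  interpret prob_space M using chain by (simp add: markov_chain_def)
  have X [measurable]: "X 0 \<in> measurable M (count_space UNIV)"
    using chain by (simp add: markov_chain_def)
  have "\<P>(\<omega> in M. (X 0 \<omega>, Y 0 \<omega>) = a) = \<P>(\<omega> in M. X 0 \<omega> = fst a) * pmf (e (fst a)) (snd a)"
    using hmm_path_prob[OF hmm, of 0 "\<lambda>_. fst a" "\<lambda>_. snd a"] by (simp add: prod_eq_iff)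
  also have "\<P>(\<omega> in M. X 0 \<omega> = fst a) = measure (distr M (count_space UNIV) (X 0)) {fst a}"
    by (subst measure_distr) (auto intro!: arg_cong[where f = prob])
  also have "\<dots> = pmf \<nu> (fst a)"
    using chain by (simp add: markov_chain_def measure_pmf_single)
  finally show ?thesis by (simp add: hmm_law_def)
qed

text \<open>Time \<open>0\<close> has no incoming transition and is treated through the initial law;
  later signals are covered by the transition that produces them.\<close>

lemma hmm_AE_emission_pos:
  assumes P: "stochastic_matrix P" and hmm: "hidden_markov_model M X Y P e \<nu>"
  shows "AE \<omega> in M. pmf (e (X n \<omega>)) (Y n \<omega>) \<noteq> 0"
proof -
  interpret finite_markov_process M "hmm_kernel P e" "\<lambda>n \<omega>. (X n \<omega>, Y n \<omega>)"
    by (rule finite_markov_process_hmm[OF P hmm])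
  show ?thesis
  proof (cases n)
    case 0
    have "AE \<omega> in M. (X 0 \<omega>, Y 0 \<omega>) = a \<longrightarrow> pmf (e (fst a)) (snd a) \<noteq> 0" for a
    proof (cases "pmf (e (fst a)) (snd a) = 0")
      case True
      then have "prob {\<omega> \<in> space M. (X 0 \<omega>, Y 0 \<omega>) = a} = 0"
        using hmm_initial_prob[OF hmm, of a] by (simp add: hmm_law_def)
      then have "AE \<omega> in M. \<not> (X 0 \<omega>, Y 0 \<omega>) = a"
        using Z_measurable[of 0] by (subst (asm) prob_Collect_eq_0) auto
      then show ?thesis by (rule eventually_mono) simp
    qed simp
    then have "AE \<omega> in M. \<forall>a\<in>UNIV. (X 0 \<omega>, Y 0 \<omega>) = a \<longrightarrow> pmf (e (fst a)) (snd a) \<noteq> 0"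
      by (intro AE_finite_allI) auto
    then show ?thesis using 0 by auto
  next
    case (Suc j)
    show ?thesis using AE_transition_nonzero[of j] by (auto simp: hmm_kernel_def Suc)
  qed
qed

section \<open>Empirical and stationary laws of pairs of signals\<close>

lemma empirical_two_step_eq:
  "empirical_two_step Y n \<omega> z = (\<Sum>j<n. indicator {z} (Y j \<omega>, Y (Suc j) \<omega>)) / real n"
  using sum.atLeast1_atMost_eq[of "\<lambda>k. indicator {z} (Y (k - 1) \<omega>, Y k \<omega>) :: real" n]
  by (simp add: empirical_two_step_def)

lemma empirical_two_step_nonneg: "0 \<le> empirical_two_step Y n \<omega> z"
  by (auto simp: empirical_two_step_eq intro!: divide_nonneg_nonneg sum_nonneg)

lemma empirical_two_step_sum:
  fixes Y :: "nat \<Rightarrow> 'w \<Rightarrow> 's::finite"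
  assumes "0 < n"
  shows "(\<Sum>z\<in>UNIV. empirical_two_step Y n \<omega> z) = 1"
proof -
  have "(\<Sum>z\<in>UNIV. indicator {z} (Y j \<omega>, Y (Suc j) \<omega>) :: real) = 1" for j
    using sum_mult_indicator_singleton[of "\<lambda>_. 1" "(Y j \<omega>, Y (Suc j) \<omega>)"] by (simp add: indicator_def eq_commute)
  then show ?thesis
    using assms unfolding empirical_two_step_eq sum_divide_distrib[symmetric] by (subst sum.swap) simp
qed

text \<open>Under absolute continuity the terms with \<open>\<mu> z = 0\<close> are
  \<open>0 / 0\<close>, which is zero both in \<open>ereal\<close> and in
  \<open>real\<close>.\<close>

lemma chi_square_eq_ereal:
  assumes "\<And>z. \<mu> z = 0 \<Longrightarrow> \<nu> z = 0"
  shows "chi_square \<nu> \<mu> = ereal (\<Sum>z\<in>UNIV. (\<nu> z - \<mu> z)\<^sup>2 / \<mu> z)"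
  unfolding chi_square_def sum_ereal[symmetric] using assms by (intro sum.cong refl) auto

lemma two_step_law_nonneg:
  assumes "stochastic_matrix P"
  shows "0 \<le> two_step_law P e z"
  using assms by (cases z) (auto simp: two_step_law_def stochastic_matrix_def intro!: sum_nonneg)

lemma pair_mean_two_step:
  assumes "ergodic_kernel (hmm_kernel P e) (hmm_law (stationary_law P) e)"
  shows "ergodic_kernel.pair_mean (hmm_kernel P e) (hmm_law (stationary_law P) e)
    (\<lambda>a b. indicator {z} (snd a, snd b)) = two_step_law P e z"
proof -
  interpret ergodic_kernel "hmm_kernel P e" "hmm_law (stationary_law P) e" by fact
  have ind: "indicator {z} (y, y') = (indicator {fst z} y * indicator {snd z} y' :: real)" for y y'
    by (cases z) (auto simp: indicator_def)
  have "pair_mean (\<lambda>a b. indicator {z} (snd a, snd b)) = (\<Sum>i\<in>UNIV. \<Sum>y\<in>UNIV. \<Sum>j\<in>UNIV. \<Sum>y'\<in>UNIV.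
      (pmf (stationary_law P) i * P $ i $ j * pmf (e i) y * pmf (e j) y' * indicator {fst z} y) * indicator {snd z} y')"
    by (simp add: pair_mean_def sum_UNIV_prod hmm_kernel_def hmm_law_def ind mult_ac)
  also have "\<dots> = (\<Sum>i\<in>UNIV. \<Sum>y\<in>UNIV. \<Sum>j\<in>UNIV.
      (pmf (stationary_law P) i * P $ i $ j * pmf (e i) y * pmf (e j) (snd z)) * indicator {fst z} y)"
    unfolding sum_mult_indicator_singleton by simp
  also have "\<dots> = (\<Sum>i\<in>UNIV. \<Sum>j\<in>UNIV. \<Sum>y\<in>UNIV.
      (pmf (stationary_law P) i * P $ i $ j * pmf (e i) y * pmf (e j) (snd z)) * indicator {fst z} y)"
    by (intro sum.cong refl, rule sum.swap)
  also have "\<dots> = two_step_law P e z"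
    unfolding sum_mult_indicator_singleton by (simp add: two_step_law_def split_beta)
  finally show ?thesis .
qed

text \<open>Positivity of the stationary law turns \<open>two_step_law P e z = 0\<close> into the
  vanishing of every single product of a transition and two emission probabilities. This condition
  is free of the initial law, so \<open>\<nu>\<close> may be arbitrary.\<close>

lemma hmm_AE_two_step_charged:
  assumes P: "stochastic_matrix P" and hmm: "hidden_markov_model M X Y P e \<nu>"
    and pos: "\<And>i. 0 < pmf (stationary_law P) i" and Q: "two_step_law P e z = 0"
  shows "AE \<omega> in M. (Y n \<omega>, Y (Suc n) \<omega>) \<noteq> z"
proof -
  interpret finite_markov_process M "hmm_kernel P e" "\<lambda>n \<omega>. (X n \<omega>, Y n \<omega>)"
    by (rule finite_markov_process_hmm[OF P hmm])
  have nn: "0 \<le> P $ i $ j" for i j using P by (simp add: stochastic_matrix_def)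
  have "pmf (stationary_law P) i * P $ i $ j * pmf (e i) (fst z) * pmf (e j) (snd z) = 0" for i j
    using Q by (auto simp: two_step_law_def split_beta sum_nonneg_eq_0_iff sum_nonneg nn)
  then have zero: "P $ i $ j * pmf (e i) (fst z) * pmf (e j) (snd z) = 0" for i j
    using pos[of i] by (metis less_irrefl mult_eq_0_iff)
  show ?thesis
    using AE_transition_nonzero[of n] hmm_AE_emission_pos[OF P hmm, of n]
  proof eventually_elim
    case (elim \<omega>)
    then show ?case
      using zero[of "X n \<omega>" "X (Suc n) \<omega>"] by (auto simp: hmm_kernel_def)
  qed
qed

text \<open>The statement for one fixed parameter. Two measures carry the same processes:
  \<open>M_stat\<close> determines the covariance, \<open>M\<close> with its arbitrary initial law
  is where convergence takes place.\<close>

lemma hmm_divergences_limit: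
  fixes P :: "real ^ 'm ^ 'm" and e :: "'m \<Rightarrow> 's::finite pmf" and X :: "nat \<Rightarrow> 'w \<Rightarrow> 'm" and Y :: "nat \<Rightarrow> 'w \<Rightarrow> 's"
  assumes P: "stochastic_matrix P" and n0: "1 \<le> n0" and \<kappa>: "0 < \<kappa>" and \<nu>0: "\<And>j. 0 < pmf \<nu>0 j"
    and minor: "\<And>i j. matrix_power P n0 $ i $ j \<ge> \<kappa> * pmf \<nu>0 j"
    and hmm: "hidden_markov_model M X Y P e \<nu>"
    and hmm_stat: "hidden_markov_model M_stat X Y P e (stationary_law P)"
  defines "Q \<equiv> two_step_law P e"
  shows "summable (\<lambda>k. covariance M_stat (pair_indicator Y z 0) (pair_indicator Y w (Suc k)))"
    and "\<exists>(N :: (real ^ ('s \<times> 's)) measure) (\<xi> :: real ^ ('s \<times> 's) \<Rightarrow> real ^ ('s \<times> 's)).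
       centered_gaussian_vector N \<xi> (limit_covariance M_stat Y) \<and>
       converges_in_law M (\<lambda>n \<omega>. ereal (2 * real n) * relative_entropy (empirical_two_step Y n \<omega>) Q)
         N (\<lambda>v. \<Sum>z\<in>UNIV. ereal ((\<xi> v $ z)\<^sup>2) / ereal (Q z)) \<and>
       converges_in_law M (\<lambda>n \<omega>. ereal (real n) * chi_square (empirical_two_step Y n \<omega>) Q)
         N (\<lambda>v. \<Sum>z\<in>UNIV. ereal ((\<xi> v $ z)\<^sup>2) / ereal (Q z))"
proof -
  let ?\<mu> = "stationary_law P" and ?Z = "\<lambda>n \<omega>. (X n \<omega>, Y n \<omega>)"
  let ?R = "hmm_kernel P e" and ?\<pi> = "hmm_law (stationary_law P) e"
  interpret K: ergodic_kernel ?R ?\<pi>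
    by (rule ergodic_kernel_hmm[OF P n0 \<kappa> \<nu>0 minor])
  interpret S: ergodic_markov_process M_stat ?R ?\<pi> ?Z
    by (intro ergodic_markov_process.intro ergodic_kernel_hmm[OF P n0 \<kappa> \<nu>0 minor] finite_markov_process_hmm[OF P hmm_stat])
  interpret M: ergodic_markov_process M ?R ?\<pi> ?Z
    by (intro ergodic_markov_process.intro ergodic_kernel_hmm[OF P n0 \<kappa> \<nu>0 minor] finite_markov_process_hmm[OF P hmm])
  have \<mu>_pos: "0 < pmf ?\<mu> i" for i
    by (rule stationary_law_pos[OF P n0 \<kappa> \<nu>0 minor])
  define \<phi> :: "'s \<times> 's \<Rightarrow> 'm \<times> 's \<Rightarrow> 'm \<times> 's \<Rightarrow> real" where "\<phi> z a b = indicator {z} (snd a, snd b)" for z a b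
  have Q: "K.pair_mean (\<phi> z) = Q z" for z
    unfolding \<phi>_def Q_def by (rule pair_mean_two_step) (rule K.ergodic_kernel_axioms)
  have Q0: "0 \<le> Q z" for z unfolding Q_def by (rule two_step_law_nonneg[OF P])
  have Q1: "(\<Sum>z\<in>UNIV. Q z) = 1"
  proof -
    have "(\<Sum>z\<in>UNIV. \<phi> z a b) = 1" for a b
      using sum_mult_indicator_singleton[of "\<lambda>_. 1" "(snd a, snd b)"] by (simp add: \<phi>_def indicator_def eq_commute)
    then show ?thesis
      unfolding Q[symmetric] K.pair_mean_sum[symmetric] by (simp add: K.pair_mean_const)
  qed
  define A where "A = K.asymptotic_factor \<phi>"
  have Y: "pair_indicator Y z k = (\<lambda>\<omega>. \<phi> z (?Z k \<omega>) (?Z (Suc k) \<omega>))" for z k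
    by (simp add: pair_indicator_def \<phi>_def fun_eq_iff)
  note stat = S.limit_covariance_eq[of Y \<phi>, OF hmm_initial_prob[OF hmm_stat] Y]
  show "summable (\<lambda>k. covariance M_stat (pair_indicator Y z 0) (pair_indicator Y w (Suc k)))"
    by (rule stat(2))
  have Gram: "limit_covariance M_stat Y = (\<lambda>z w. \<Sum>i\<in>UNIV. A i z * A i w)"
    by (intro ext) (simp add: stat(1) A_def)
  define N where "N = gaussian_law A"
  interpret N: prob_space N unfolding N_def by (rule prob_space_gaussian_law)
  have [measurable_cong]: "sets N = sets borel" by (simp add: N_def sets_gaussian_law)
  have gauss: "centered_gaussian_vector N (\<lambda>v. v) (limit_covariance M_stat Y)"
    unfolding N_def Gram by (rule centered_gaussian_vector_gaussian_law)
  have ac_M: "AE \<omega> in M. \<forall>n z. Q z = 0 \<longrightarrow> empirical_two_step Y n \<omega> z = 0"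
  proof -
    have "AE \<omega> in M. \<forall>z\<in>{z. Q z = 0}. (Y j \<omega>, Y (Suc j) \<omega>) \<noteq> z" for j
      by (intro AE_finite_allI hmm_AE_two_step_charged[OF P hmm \<mu>_pos]) (simp_all add: Q_def)
    then have "AE \<omega> in M. \<forall>j. \<forall>z\<in>{z. Q z = 0}. (Y j \<omega>, Y (Suc j) \<omega>) \<noteq> z"
      unfolding AE_all_countable by blast
    then show ?thesis
      by (rule eventually_mono) (auto simp: empirical_two_step_eq indicator_def intro!: sum.neutral)
  qed
  \<comment> \<open>At an uncharged point \<open>\<phi> z\<close> vanishes on every transition of
    positive stationary weight. The mean of its product with anything is then zero, and with it the
    variance.\<close>
  have ac_N: "AE v in N. \<forall>z\<in>{z. Q z = 0}. v $ z = 0"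
  proof (rule AE_finite_allI)
    fix z assume "z \<in> {z. Q z = 0}"
    then have "K.pair_mean (\<phi> z) = 0" by (simp add: Q)
    moreover have nn: "0 \<le> ?\<pi> a * ?R a b * \<phi> z a b" for a b
      by (simp add: K.\<pi>_nonneg K.nonneg \<phi>_def)
    ultimately have "?\<pi> a * ?R a b * \<phi> z a b = 0" for a b
      unfolding K.pair_mean_def
      by (metis (no_types, lifting) UNIV_I finite_code sum_nonneg_eq_0_iff sum_nonneg nn)
    then have "K.pair_mean (\<lambda>a b. \<phi> z a b * g a b) = 0" for g
      unfolding K.pair_mean_def mult.assoc[symmetric] by (metis (no_types, lifting) mult_zero_left sum.neutral)
    moreover have "K.centered (\<phi> z) a b = \<phi> z a b" for a b
      using \<open>K.pair_mean (\<phi> z) = 0\<close> by (simp add: K.centered_def)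
    ultimately have "(\<Sum>i\<in>UNIV. A i z * A i z) = 0"
      unfolding A_def K.asymptotic_factor_gram
      by (subst K.pair_mean_martingale_part) (auto simp: K.pair_mean_centered)
    then show "AE v in N. v $ z = 0"
      unfolding N_def by (rule gaussian_law_component_AE_zero)
  qed simp
  define x where "x n z \<omega> = (\<Sum>j<n. K.centered (\<phi> z) (?Z j \<omega>) (?Z (Suc j) \<omega>)) / sqrt (real n)" for n z \<omega>
  define T where "T n \<omega> = (\<Sum>z\<in>UNIV. (x n z \<omega>)\<^sup>2 / Q z)" for n \<omega>
  define H where "H n \<omega> = 2 * real n * (\<Sum>z | empirical_two_step Y n \<omega> z > 0.
      empirical_two_step Y n \<omega> z * ln (empirical_two_step Y n \<omega> z / Q z))" for n \<omega>
  define V where "V v = (\<Sum>z\<in>UNIV. (v $ z)\<^sup>2 / Q z)" for v :: "real ^ ('s \<times> 's)"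
  have [measurable]: "Y n \<in> measurable M (count_space UNIV)" for n
    using hmm by (simp add: hidden_markov_model_def)
  have [measurable]: "x n z \<in> borel_measurable M" for n z
    unfolding x_def using M.Z_measurable by measurable
  have T_meas [measurable]: "T n \<in> borel_measurable M" for n
    unfolding T_def by measurable
  have L_meas [measurable]: "(\<lambda>\<omega>. empirical_two_step Y n \<omega> z) \<in> borel_measurable M" for n z
    unfolding empirical_two_step_eq by measurable
  have H_meas [measurable]: "H n \<in> borel_measurable M" for n
  proof -
    \<comment> \<open>The index set of the sum depends on \<open>\<omega>\<close>; a conditional
      over all points makes measurability visible.\<close>
    have "H n = (\<lambda>\<omega>. 2 * real n * (\<Sum>z\<in>UNIV. if empirical_two_step Y n \<omega> z > 0
        then empirical_two_step Y n \<omega> z * ln (empirical_two_step Y n \<omega> z / Q z) else 0))"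
      by (simp add: H_def fun_eq_iff sum.If_cases)
    then show ?thesis by simp
  qed
  have V_meas [measurable]: "V \<in> borel_measurable N"
    unfolding V_def by measurable
  have T_eq: "T n \<omega> = real n * (\<Sum>z\<in>UNIV. (empirical_two_step Y n \<omega> z - Q z)\<^sup>2 / Q z)" if "0 < n" for n \<omega>
  proof -
    have "x n z \<omega> = sqrt (real n) * (empirical_two_step Y n \<omega> z - Q z)" for z
    proof -
      have "(\<Sum>j<n. K.centered (\<phi> z) (?Z j \<omega>) (?Z (Suc j) \<omega>)) = real n * (empirical_two_step Y n \<omega> z - Q z)"
        using that by (simp add: K.centered_def Q \<phi>_def empirical_two_step_eq sum_subtractf right_diff_distrib)
      then have "x n z \<omega> = real n / sqrt (real n) * (empirical_two_step Y n \<omega> z - Q z)"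
        by (simp add: x_def)
      then show ?thesis by (simp add: real_div_sqrt)
    qed
    then show ?thesis by (simp add: T_def power_mult_distrib sum_distrib_left)
  qed
  have T0: "0 \<le> T n \<omega>" for n \<omega> by (auto simp: T_def intro!: sum_nonneg divide_nonneg_nonneg Q0)
  have V0: "0 \<le> V v" for v by (auto simp: V_def intro!: sum_nonneg divide_nonneg_nonneg Q0)
  have H0: "AE \<omega> in M. 0 \<le> H n \<omega>" for n
  proof (cases "n = 0")
    case False
    show ?thesis
      using ac_M
    proof eventually_elim
      case (elim \<omega>)
      then show ?case
        unfolding H_def using False Q0 Q1
        by (intro mult_nonneg_nonneg entropy_nonneg empirical_two_step_nonneg empirical_two_step_sum) auto
    qed
  qed (simp add: H_def)
  have char: "(\<lambda>n. \<integral>\<omega>. iexp (\<Sum>z\<in>UNIV. u z * x n z \<omega>) \<partial>M) \<longlonglongrightarrow> (\<integral>v. iexp (\<Sum>z\<in>UNIV. u z * v $ z) \<partial>N)" for u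
    using M.pair_functional_clt[of "\<lambda>z. K.centered (\<phi> z)" u]
    unfolding N_def gaussian_law_char x_def A_def K.asymptotic_factor_gram by (simp add: K.pair_mean_centered)
  \<comment> \<open>At uncharged points the weight \<open>real k / Q z\<close> is zero by the
    convention for real division, in agreement with the quotients in \<open>T\<close> and
    \<open>V\<close>.\<close>
  have T_lim: "(\<lambda>n. \<integral>\<omega>. exp (- (real k * T n \<omega>)) \<partial>M) \<longlonglongrightarrow> (\<integral>v. exp (- (real k * V v)) \<partial>N)" for k
    using tendsto_exp_quadratic[of M N x "\<lambda>z v. v $ z" "\<lambda>z. real k / Q z", OF M.prob_space_axioms N.prob_space_axioms]
      char Q0 by (simp add: T_def V_def sum_distrib_left)
  have H_lim: "(\<lambda>n. \<integral>\<omega>. exp (- (real k * H n \<omega>)) \<partial>M) \<longlonglongrightarrow> (\<integral>v. exp (- (real k * V v)) \<partial>N)" for k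
  proof -
    obtain C where C: "\<And>L n. 0 < n \<Longrightarrow> (\<And>z. 0 \<le> L z) \<Longrightarrow> (\<Sum>z\<in>UNIV. L z) = 1 \<Longrightarrow>
      (\<And>z. Q z = 0 \<Longrightarrow> L z = 0) \<Longrightarrow>
      \<bar>exp (- (real k * (2 * real n * (\<Sum>z | L z > 0. L z * ln (L z / Q z)))))
        - exp (- (real k * (real n * (\<Sum>z\<in>UNIV. (L z - Q z)\<^sup>2 / Q z))))\<bar> \<le> C / sqrt (real n)"
      using exp_entropy_close_to_exp_chi_square[of Q k, OF Q0 Q1] by blast
    have int: "integrable M (\<lambda>\<omega>. exp (- (real k * H n \<omega>)))" "integrable M (\<lambda>\<omega>. exp (- (real k * T n \<omega>)))" for n
      using H0[of n] by (auto intro!: M.integrable_const_bound[where B = 1] simp: T0)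
    have "(\<lambda>n. (\<integral>\<omega>. exp (- (real k * H n \<omega>)) \<partial>M) - (\<integral>\<omega>. exp (- (real k * T n \<omega>)) \<partial>M)) \<longlonglongrightarrow> 0"
    proof (rule Lim_null_comparison)
      show "\<forall>\<^sub>F n in sequentially. norm ((\<integral>\<omega>. exp (- (real k * H n \<omega>)) \<partial>M) - (\<integral>\<omega>. exp (- (real k * T n \<omega>)) \<partial>M)) \<le> C / sqrt (real n)"
        using eventually_gt_at_top[of 0]
      proof eventually_elim
        case (elim n)
        have "norm ((\<integral>\<omega>. exp (- (real k * H n \<omega>)) \<partial>M) - (\<integral>\<omega>. exp (- (real k * T n \<omega>)) \<partial>M))
            = norm (\<integral>\<omega>. exp (- (real k * H n \<omega>)) - exp (- (real k * T n \<omega>)) \<partial>M)"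
          using int by simp
        also have "\<dots> \<le> (\<integral>\<omega>. C / sqrt (real n) \<partial>M)"
        proof (rule order.trans[OF integral_norm_bound], rule integral_mono_AE)
          show "AE \<omega> in M. norm (exp (- (real k * H n \<omega>)) - exp (- (real k * T n \<omega>))) \<le> C / sqrt (real n)"
            using ac_M
          proof eventually_elim
            case (elim \<omega>)
            then show ?case
              unfolding H_def T_eq[OF \<open>0 < n\<close>] real_norm_def
              using \<open>0 < n\<close> by (intro C empirical_two_step_nonneg empirical_two_step_sum) auto
          qed
        qed (use int in auto)
        finally show ?case by (simp add: M.prob_space)
      qed
      show "(\<lambda>n. C / sqrt (real n)) \<longlonglongrightarrow> 0" by real_asymp
    qed
    from tendsto_add[OF this T_lim[of k]] show ?thesis by simp
  qed
  have V_eq: "AE v in N. (\<Sum>z\<in>UNIV. ereal ((v $ z)\<^sup>2) / ereal (Q z)) = ereal (V v)"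
    using ac_N
  proof eventually_elim
    case (elim v)
    show ?case
      unfolding V_def sum_ereal[symmetric] using elim by (intro sum.cong refl) auto
  qed
  \<comment> \<open>Shared by both divergences: an extended real sequence \<open>U\<close> is
    replaced almost surely by a real one \<open>G\<close>, for which convergence of exponential
    moments suffices.\<close>
  have conv: "converges_in_law M U N (\<lambda>v. \<Sum>z\<in>UNIV. ereal ((v $ z)\<^sup>2) / ereal (Q z))"
    if U [measurable]: "\<And>n. U n \<in> borel_measurable M" and G [measurable]: "\<And>n. G n \<in> borel_measurable M"
      and G0: "\<And>n. AE \<omega> in M. 0 \<le> G n \<omega>" and UG: "\<And>n. 0 < n \<Longrightarrow> AE \<omega> in M. U n \<omega> = ereal (G n \<omega>)"
      and lim: "\<And>k. (\<lambda>n. \<integral>\<omega>. exp (- (real k * G n \<omega>)) \<partial>M) \<longlonglongrightarrow> (\<integral>v. exp (- (real k * V v)) \<partial>N)"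
    for U :: "nat \<Rightarrow> 'w \<Rightarrow> ereal" and G :: "nat \<Rightarrow> 'w \<Rightarrow> real"
    unfolding converges_in_law_def
  proof (intro conjI allI impI U)
    show V_meas' [measurable]: "(\<lambda>v. \<Sum>z\<in>UNIV. ereal ((v $ z)\<^sup>2) / ereal (Q z)) \<in> borel_measurable N"
      by measurable
    fix f :: "ereal \<Rightarrow> real" assume f: "continuous_on UNIV f"
    then have [measurable]: "f \<in> borel_measurable borel" by (rule borel_measurable_continuous_onI)
    have "(\<lambda>n. \<integral>\<omega>. f (ereal (G n \<omega>)) \<partial>M) \<longlonglongrightarrow> (\<integral>v. f (ereal (V v)) \<partial>N)"
      using V0 by (intro tendsto_integral_of_exp_moments M.prob_space_axioms N.prob_space_axioms G0 lim f) auto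
    also have "(\<integral>v. f (ereal (V v)) \<partial>N) = (\<integral>v. f (\<Sum>z\<in>UNIV. ereal ((v $ z)\<^sup>2) / ereal (Q z)) \<partial>N)"
      by (rule integral_cong_AE) (use V_eq in auto)
    finally show "(\<lambda>n. \<integral>\<omega>. f (U n \<omega>) \<partial>M) \<longlonglongrightarrow> (\<integral>v. f (\<Sum>z\<in>UNIV. ereal ((v $ z)\<^sup>2) / ereal (Q z)) \<partial>N)"
    proof (rule Lim_transform_eventually)
      show "\<forall>\<^sub>F n in sequentially. (\<integral>\<omega>. f (ereal (G n \<omega>)) \<partial>M) = (\<integral>\<omega>. f (U n \<omega>) \<partial>M)"
        using eventually_gt_at_top[of 0]
      proof eventually_elim
        case (elim n)
        show ?case by (rule integral_cong_AE) (use UG[OF elim] in auto)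
      qed
    qed
  qed
  have "converges_in_law M (\<lambda>n \<omega>. ereal (2 * real n) * relative_entropy (empirical_two_step Y n \<omega>) Q)
         N (\<lambda>v. \<Sum>z\<in>UNIV. ereal ((v $ z)\<^sup>2) / ereal (Q z))"
  proof (rule conv[of _ H])
    have "(\<lambda>\<omega>. relative_entropy (empirical_two_step Y n \<omega>) Q) = (\<lambda>\<omega>.
        if \<forall>z. Q z = 0 \<longrightarrow> empirical_two_step Y n \<omega> z = 0
        then ereal (\<Sum>z\<in>UNIV. if empirical_two_step Y n \<omega> z > 0
          then empirical_two_step Y n \<omega> z * ln (empirical_two_step Y n \<omega> z / Q z) else 0) else \<infinity>)" for n
      by (simp add: relative_entropy_def fun_eq_iff sum.If_cases)
    then have [measurable]: "(\<lambda>\<omega>. relative_entropy (empirical_two_step Y n \<omega>) Q) \<in> borel_measurable M" for n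
      by simp
    show "(\<lambda>\<omega>. ereal (2 * real n) * relative_entropy (empirical_two_step Y n \<omega>) Q) \<in> borel_measurable M" for n
      by measurable
    show "AE \<omega> in M. ereal (2 * real n) * relative_entropy (empirical_two_step Y n \<omega>) Q = ereal (H n \<omega>)" for n
      using ac_M by eventually_elim (simp add: relative_entropy_def H_def)
  qed (use H0 H_lim in auto)
  moreover have "converges_in_law M (\<lambda>n \<omega>. ereal (real n) * chi_square (empirical_two_step Y n \<omega>) Q)
         N (\<lambda>v. \<Sum>z\<in>UNIV. ereal ((v $ z)\<^sup>2) / ereal (Q z))"
  proof (rule conv[of _ T])
    show "(\<lambda>\<omega>. ereal (real n) * chi_square (empirical_two_step Y n \<omega>) Q) \<in> borel_measurable M" for n
      unfolding chi_square_def by measurable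
    show "AE \<omega> in M. ereal (real n) * chi_square (empirical_two_step Y n \<omega>) Q = ereal (T n \<omega>)" if "0 < n" for n
      using ac_M
    proof eventually_elim
      case (elim \<omega>)
      then have "chi_square (empirical_two_step Y n \<omega>) Q
          = ereal (\<Sum>z\<in>UNIV. (empirical_two_step Y n \<omega> z - Q z)\<^sup>2 / Q z)"
        by (intro chi_square_eq_ereal) blast
      then show ?case by (simp add: T_eq[OF that])
    qed
  qed (use T0 T_lim in auto)
  ultimately show "\<exists>(N :: (real ^ ('s \<times> 's)) measure) (\<xi> :: real ^ ('s \<times> 's) \<Rightarrow> real ^ ('s \<times> 's)).
       centered_gaussian_vector N \<xi> (limit_covariance M_stat Y) \<and>
       converges_in_law M (\<lambda>n \<omega>. ereal (2 * real n) * relative_entropy (empirical_two_step Y n \<omega>) Q)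
         N (\<lambda>v. \<Sum>z\<in>UNIV. ereal ((\<xi> v $ z)\<^sup>2) / ereal (Q z)) \<and>
       converges_in_law M (\<lambda>n \<omega>. ereal (real n) * chi_square (empirical_two_step Y n \<omega>) Q)
         N (\<lambda>v. \<Sum>z\<in>UNIV. ereal ((\<xi> v $ z)\<^sup>2) / ereal (Q z))"
    using gauss by (intro exI[of _ N] exI[of _ "\<lambda>v. v"]) simp
qed

theorem theorem5p2:
  fixes \<Theta> :: "(real ^ 'k) set"
    and Ob :: "(real ^ 'd) set"
    and P :: "real ^ 'k \<Rightarrow> real ^ 'm ^ 'm"
    and \<beta> :: "real ^ 'k \<Rightarrow> (real ^ 'd) ^ 'm"
    and q :: "real ^ 'd \<Rightarrow> 's::finite pmf"
    and Pr :: "real ^ 'k \<Rightarrow> 'm pmf \<Rightarrow> 'w measure"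
    and X :: "nat \<Rightarrow> 'w \<Rightarrow> 'm"
    and Y :: "nat \<Rightarrow> 'w \<Rightarrow> 's"
    and \<theta> :: "real ^ 'k"
    and \<nu> :: "'m pmf"
  assumes m: "CARD('m) \<ge> 2"
    and stochastic: "\<forall>\<theta>\<in>\<Theta>. stochastic_matrix (P \<theta>)"
    and hmm: "\<forall>\<theta>\<in>\<Theta>. \<forall>\<nu>. hidden_markov_model (Pr \<theta> \<nu>) X Y (P \<theta>) (\<lambda>i. q (\<beta> \<theta> $ i)) \<nu>"
    and H0: "regular_parametrization \<Theta> Ob P \<beta> q"
    and H1: "uniform_minorization \<Theta> P"
    and H2: "hidden_states_ordered \<Theta> \<beta>"
    and H3: "mixtures_identifiable TYPE('m) Ob q"
    and \<theta>: "\<theta> \<in> \<Theta>"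
  defines "Q \<equiv> two_step_law (P \<theta>) (\<lambda>i. q (\<beta> \<theta> $ i))"
    and "P_stat \<equiv> Pr \<theta> (stationary_law (P \<theta>))"
  shows "(\<forall>z w. summable (\<lambda>k. covariance P_stat (pair_indicator Y z 0) (pair_indicator Y w (Suc k)))) \<and>
    (\<exists>(N :: (real ^ ('s \<times> 's)) measure) (\<xi> :: real ^ ('s \<times> 's) \<Rightarrow> real ^ ('s \<times> 's)).
       centered_gaussian_vector N \<xi> (limit_covariance P_stat Y) \<and>
       converges_in_law (Pr \<theta> \<nu>)
         (\<lambda>n \<omega>. ereal (2 * real n) * relative_entropy (empirical_two_step Y n \<omega>) Q)
         N (\<lambda>v. \<Sum>z\<in>UNIV. ereal ((\<xi> v $ z)\<^sup>2) / ereal (Q z)) \<and>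
       converges_in_law (Pr \<theta> \<nu>)
         (\<lambda>n \<omega>. ereal (real n) * chi_square (empirical_two_step Y n \<omega>) Q)
         N (\<lambda>v. \<Sum>z\<in>UNIV. ereal ((\<xi> v $ z)\<^sup>2) / ereal (Q z)))"
proof -
  obtain n0 \<kappa> and \<nu>0 :: "'m pmf" where minor: "1 \<le> n0" "0 < \<kappa>" "\<And>j. 0 < pmf \<nu>0 j"
      "\<And>i j. matrix_power (P \<theta>) n0 $ i $ j \<ge> \<kappa> * pmf \<nu>0 j"
    using H1 \<theta> unfolding uniform_minorization_def by blast
  have P: "stochastic_matrix (P \<theta>)"
    using stochastic \<theta> by blast
  \<comment> \<open>The family is used twice, with the given initial law and with the stationary one
    that defines the covariances.\<close>
  have "hidden_markov_model (Pr \<theta> \<nu>) X Y (P \<theta>) (\<lambda>i. q (\<beta> \<theta> $ i)) \<nu>"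
    and "hidden_markov_model P_stat X Y (P \<theta>) (\<lambda>i. q (\<beta> \<theta> $ i)) (stationary_law (P \<theta>))"
    using hmm \<theta> unfolding P_stat_def by blast+
  note limit = hmm_divergences_limit[OF P minor this, folded Q_def]
  show ?thesis
    using limit by blast
qed

end
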